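(* Given a cartesian category $\mathcal{S}$ with weak pullbacks, let $\Psi:\mathcal{S}^{op}\to\mathbf{InfSL}$ be the elementary doctrine of weak subobjects. Then the doctrine $((\Psi)_q)_x:\mathcal{X}_{(\Psi)_q}^{op}\to\mathbf{InfSL}$ is equivalent to the doctrine $S:\mathcal{S}_{ex}^{op}\to\mathbf{InfSL}$ of subobjects on the exact completion $\mathcal{S}_{ex}$ of $\mathcal{S}$.
   Context: $\mathbf{InfSL}$ is the category of inf-semilattices (with top element $\top$) and homomorphisms. A cartesian category is a category with finite products. An elementary doctrine is a functor $P:\mathcal{C}^{op}\to\mathbf{InfSL}$, $\mathcal{C}$ a category with binary products (the action of $P$ on an arrow $f$ is written $P_f$), such that for every object $A$ of $\mathcal{C}$ there is $\delta_A\in P(A\times A)$ with: (i) $\alpha\mapsto P_{pr_1}(\alpha)\wedge\delta_A$, for $\alpha\in P(A)$, is left adjoint to $P_{\langle id_A,id_A\rangle}:P(A\times A)\to P(A)$; (ii) for every map $e=\langle pr_1,pr_2,pr_2\rangle:X\times A\to X\times A\times A$, the assignment $\alpha\mapsto P_{\langle pr_1,pr_2\rangle}(\alpha)\wedge P_{\langle pr_2,pr_3\rangle}(\delta_A)$, for $\alpha\in P(X\times A)$, is left adjoint to $P_e:P(X\times A\times A)\to P(X\times A)$. Doctrines $P:\mathcal{C}^{op}\to\mathbf{InfSL}$ and $R:\mathcal{D}^{op}\to\mathbf{InfSL}$ are compared in the 2-category $\mathbf{ED}$ of elementary doctrines, whose 1-arrows are pairs $(F,b)$ with $F:\mathcal{C}\to\mathcal{D}$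 preserving binary products and $b:P\to R\circ F^{op}$ natural, with each $b_A$ preserving finite meets and $b_{A\times A}(\delta_A)=R_{\langle F(pr_1),F(pr_2)\rangle}(\delta_{F(A)})$, and whose 2-arrows $(F,b)\Rightarrow(G,c)$ are natural transformations $\theta:F\to G$ with $b_A(\alpha)\le R_{\theta_A}(c_A(\alpha))$. The doctrine of weak subobjects $\Psi:\mathcal{S}^{op}\to\mathbf{InfSL}$: $\Psi(A)$ is the poset reflection of the comma category $\mathcal{S}/A$, and $\Psi_f$ is given by weak pullback along $f$; $\delta_A$ is the class of the diagonal $A\to A\times A$. The doctrine of subobjects $S$ on a category with finite limits sends $A$ to the poset of subobjects of $A$, acting by pullback. A $P$-equivalence relation on $A$ is $\rho\in P(A\times A)$ with $\delta_A\le\rho$; $\rho\le P_{\langle pr_2,pr_1\rangle}(\rho)$; and $P_{\langle pr_1,pr_2\rangle}(\rho)\wedge P_{\langle pr_2,pr_3\rangle}(\rho)\le P_{\langle pr_1,pr_3\rangle}(\rho)$ in $P(A\times A\times A)$. $\mathcal{D}es_\rho$ is the sub-poset of $P(A)$ of those $\alpha$ with $P_{pr_1}(\alpha)\wedge\rho\le P_{pr_2}(\alpha)$ in $P(A\times A)$. The category $\mathcal{R}_P$ has as objects pairs $(A,\rho)$ with $\rho$ a $P$-equivalence relation on $A$; an arrow $f:(A,\rho)\to(B,\sigma)$ is an arrow $f:A\to B$ of $\mathcal{C}$ with $\rho\le P_{f\times f}(\sigma)$; composition and identities are those of $\mathcal{C}$. The elementary doctrine $(P)_q:\mathcal{R}_P^{op}\to\mathbf{InfSL}$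 is $(P)_q(A,\rho)=\mathcal{D}es_\rho$, acting on an arrow $f$ by restriction of $P_f$. For an elementary doctrine $E:\mathcal{B}^{op}\to\mathbf{InfSL}$, the extensional collapse $\mathcal{X}_E$ is the category whose objects are the objects of $\mathcal{B}$, and whose arrows $[f]:A\to B$ are equivalence classes of arrows $f:A\to B$ of $\mathcal{B}$ such that $\delta_A\le E_{f\times f}(\delta_B)$ in $E(A\times A)$, with respect to the equivalence relating $f$ and $f'$ when $\delta_A\le E_{f\times f'}(\delta_B)$; composition and identities are given on representatives. The elementary doctrine $(E)_x:\mathcal{X}_E^{op}\to\mathbf{InfSL}$ is $(E)_x(A)=E(A)$ and $((E)_x)_{[f]}=E_f$. The exact completion $\mathcal{S}_{ex}$ of the weakly lex category $\mathcal{S}$ (Carboni–Vitale) is the category whose objects are pseudo-equivalence relations $r=\langle r_1,r_2\rangle:R\to A\times A$ in $\mathcal{S}$ (reflexive, symmetric, and transitive with respect to weak pullbacks, with $r$ not required monic), and whose arrows from $r:R\to A\times A$ to $s:T\to B\times B$ are equivalence classes of arrows $f:A\to B$ such that $(f\times f)\circ r$ factors through $s$, with $f\sim g$ when $\langle f,g\rangle:A\to B\times B$ factors through $s$. *)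

theory Defs
  imports "HOL-Algebra.Galois_Connection"
begin

section \<open>Categories\<close>

text \<open>
  Hom-sets are given as a family and need not be disjoint: the same arrow of the ambient category
  may be an arrow between several pairs of objects, as in the category of equivalence relations
  below. This is why composition takes the three objects as arguments:
  for \<open>f : X \<rightarrow> Y\<close> and \<open>g : Y \<rightarrow> Z\<close>, the composite \<open>g \<circ> f\<close> is \<open>Cmp C X Y Z g f\<close>.
\<close>

record ('o, 'a) cat =
  Obj :: "'o set"
  Hom :: "'o \<Rightarrow> 'o \<Rightarrow> 'a set"
  Id :: "'o \<Rightarrow> 'a"
  Cmp :: "'o \<Rightarrow> 'o \<Rightarrow> 'o \<Rightarrow> 'a \<Rightarrow> 'a \<Rightarrow> 'a"

locale category =
  fixes C :: "('o, 'a) cat"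
  assumes Id_closed: "X \<in> Obj C \<Longrightarrow> Id C X \<in> Hom C X X"
    and Cmp_closed: "\<lbrakk>X \<in> Obj C; Y \<in> Obj C; Z \<in> Obj C; f \<in> Hom C X Y; g \<in> Hom C Y Z\<rbrakk>
      \<Longrightarrow> Cmp C X Y Z g f \<in> Hom C X Z"
    and Cmp_Id_right: "\<lbrakk>X \<in> Obj C; Y \<in> Obj C; f \<in> Hom C X Y\<rbrakk> \<Longrightarrow> Cmp C X X Y f (Id C X) = f"
    and Cmp_Id_left: "\<lbrakk>X \<in> Obj C; Y \<in> Obj C; f \<in> Hom C X Y\<rbrakk> \<Longrightarrow> Cmp C X Y Y (Id C Y) f = f"
    and Cmp_assoc: "\<lbrakk>W \<in> Obj C; X \<in> Obj C; Y \<in> Obj C; Z \<in> Obj C;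
        f \<in> Hom C W X; g \<in> Hom C X Y; h \<in> Hom C Y Z\<rbrakk>
      \<Longrightarrow> Cmp C W X Z (Cmp C X Y Z h g) f = Cmp C W Y Z h (Cmp C W X Y g f)"

definition is_functor ::
  "('o, 'a) cat \<Rightarrow> ('p, 'b) cat \<Rightarrow> ('o \<Rightarrow> 'p) \<Rightarrow> ('o \<Rightarrow> 'o \<Rightarrow> 'a \<Rightarrow> 'b) \<Rightarrow> bool" where
  "is_functor C D F0 F1 \<longleftrightarrow>
    (\<forall>X\<in>Obj C. F0 X \<in> Obj D \<and> F1 X X (Id C X) = Id D (F0 X)) \<and>
    (\<forall>X\<in>Obj C. \<forall>Y\<in>Obj C. \<forall>f\<in>Hom C X Y. F1 X Y f \<in> Hom D (F0 X) (F0 Y)) \<and>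
    (\<forall>X\<in>Obj C. \<forall>Y\<in>Obj C. \<forall>Z\<in>Obj C. \<forall>f\<in>Hom C X Y. \<forall>g\<in>Hom C Y Z.
      F1 X Z (Cmp C X Y Z g f) = Cmp D (F0 X) (F0 Y) (F0 Z) (F1 Y Z g) (F1 X Y f))"

definition natural_transformation ::
  "('o, 'a) cat \<Rightarrow> ('p, 'b) cat \<Rightarrow> ('o \<Rightarrow> 'p) \<Rightarrow> ('o \<Rightarrow> 'o \<Rightarrow> 'a \<Rightarrow> 'b) \<Rightarrow>
    ('o \<Rightarrow> 'p) \<Rightarrow> ('o \<Rightarrow> 'o \<Rightarrow> 'a \<Rightarrow> 'b) \<Rightarrow> ('o \<Rightarrow> 'b) \<Rightarrow> bool" where
  "natural_transformation C D F0 F1 G0 G1 \<theta> \<longleftrightarrow>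
    (\<forall>X\<in>Obj C. \<theta> X \<in> Hom D (F0 X) (G0 X)) \<and>
    (\<forall>X\<in>Obj C. \<forall>Y\<in>Obj C. \<forall>f\<in>Hom C X Y.
      Cmp D (F0 X) (F0 Y) (G0 Y) (\<theta> Y) (F1 X Y f) = Cmp D (F0 X) (G0 X) (G0 Y) (G1 X Y f) (\<theta> X))"

definition is_mono :: "('o, 'a) cat \<Rightarrow> 'o \<Rightarrow> 'o \<Rightarrow> 'a \<Rightarrow> bool" where
  "is_mono C X Y m \<longleftrightarrow> m \<in> Hom C X Y \<and>
    (\<forall>Z\<in>Obj C. \<forall>g\<in>Hom C Z X. \<forall>h\<in>Hom C Z X. Cmp C Z X Y m g = Cmp C Z X Y m h \<longrightarrow> g = h)"

definition is_terminal :: "('o, 'a) cat \<Rightarrow> 'o \<Rightarrow> bool" where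
  "is_terminal C T \<longleftrightarrow> T \<in> Obj C \<and> (\<forall>X\<in>Obj C. \<exists>!f. f \<in> Hom C X T)"

definition is_product :: "('o, 'a) cat \<Rightarrow> 'o \<Rightarrow> 'o \<Rightarrow> 'o \<times> 'a \<times> 'a \<Rightarrow> bool" where
  "is_product C A B = (\<lambda>(W, p, q).
    W \<in> Obj C \<and> p \<in> Hom C W A \<and> q \<in> Hom C W B \<and>
    (\<forall>X\<in>Obj C. \<forall>f\<in>Hom C X A. \<forall>g\<in>Hom C X B.
      \<exists>!h. h \<in> Hom C X W \<and> Cmp C X W A p h = f \<and> Cmp C X W B q h = g))"

definition has_binary_products :: "('o, 'a) cat \<Rightarrow> bool" where
  "has_binary_products C \<longleftrightarrow> (\<forall>A\<in>Obj C. \<forall>B\<in>Obj C. \<exists>w. is_product C A B w)"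

definition cartesian_category :: "('o, 'a) cat \<Rightarrow> bool" where
  "cartesian_category C \<longleftrightarrow> category C \<and> (\<exists>T. is_terminal C T) \<and> has_binary_products C"

text \<open>For \<open>f : A \<rightarrow> C\<close> and \<open>g : B \<rightarrow> C\<close>; the projections are \<open>p : W \<rightarrow> A\<close> and \<open>q : W \<rightarrow> B\<close>.\<close>

definition is_weak_pullback ::
  "('o, 'a) cat \<Rightarrow> 'o \<Rightarrow> 'o \<Rightarrow> 'o \<Rightarrow> 'a \<Rightarrow> 'a \<Rightarrow> 'o \<Rightarrow> 'a \<Rightarrow> 'a \<Rightarrow> bool" where
  "is_weak_pullback C A B D f g W p q \<longleftrightarrow>
    W \<in> Obj C \<and> p \<in> Hom C W A \<and> q \<in> Hom C W B \<and> Cmp C W A D f p = Cmp C W B D g q \<and>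
    (\<forall>X\<in>Obj C. \<forall>a\<in>Hom C X A. \<forall>b\<in>Hom C X B. Cmp C X A D f a = Cmp C X B D g b \<longrightarrow>
      (\<exists>h. h \<in> Hom C X W \<and> Cmp C X W A p h = a \<and> Cmp C X W B q h = b))"

definition is_pullback ::
  "('o, 'a) cat \<Rightarrow> 'o \<Rightarrow> 'o \<Rightarrow> 'o \<Rightarrow> 'a \<Rightarrow> 'a \<Rightarrow> 'o \<Rightarrow> 'a \<Rightarrow> 'a \<Rightarrow> bool" where
  "is_pullback C A B D f g W p q \<longleftrightarrow>
    W \<in> Obj C \<and> p \<in> Hom C W A \<and> q \<in> Hom C W B \<and> Cmp C W A D f p = Cmp C W B D g q \<and>
    (\<forall>X\<in>Obj C. \<forall>a\<in>Hom C X A. \<forall>b\<in>Hom C X B. Cmp C X A D f a = Cmp C X B D g b \<longrightarrow>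
      (\<exists>!h. h \<in> Hom C X W \<and> Cmp C X W A p h = a \<and> Cmp C X W B q h = b))"

definition has_weak_pullbacks :: "('o, 'a) cat \<Rightarrow> bool" where
  "has_weak_pullbacks C \<longleftrightarrow>
    (\<forall>A\<in>Obj C. \<forall>B\<in>Obj C. \<forall>D\<in>Obj C. \<forall>f\<in>Hom C A D. \<forall>g\<in>Hom C B D.
      \<exists>W p q. is_weak_pullback C A B D f g W p q)"

text \<open>
  A choice of binary products. It is meaningful in a category with binary products, and the notions
  below do not depend on it because products are unique up to a unique isomorphism.
\<close>

definition some_product :: "('o, 'a) cat \<Rightarrow> 'o \<Rightarrow> 'o \<Rightarrow> 'o \<times> 'a \<times> 'a" where
  "some_product C A B = (SOME w. is_product C A B w)"

definition prd :: "('o, 'a) cat \<Rightarrow> 'o \<Rightarrow> 'o \<Rightarrow> 'o" where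
  "prd C A B = fst (some_product C A B)"

definition pr1 :: "('o, 'a) cat \<Rightarrow> 'o \<Rightarrow> 'o \<Rightarrow> 'a" where
  "pr1 C A B = fst (snd (some_product C A B))"

definition pr2 :: "('o, 'a) cat \<Rightarrow> 'o \<Rightarrow> 'o \<Rightarrow> 'a" where
  "pr2 C A B = snd (snd (some_product C A B))"

text \<open>\<open>\<langle>f, g\<rangle> : X \<rightarrow> A \<times> B\<close> for \<open>f : X \<rightarrow> A\<close> and \<open>g : X \<rightarrow> B\<close>.\<close>

definition pairing :: "('o, 'a) cat \<Rightarrow> 'o \<Rightarrow> 'o \<Rightarrow> 'o \<Rightarrow> 'a \<Rightarrow> 'a \<Rightarrow> 'a" where
  "pairing C X A B f g = (THE h. h \<in> Hom C X (prd C A B) \<and>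
    Cmp C X (prd C A B) A (pr1 C A B) h = f \<and> Cmp C X (prd C A B) B (pr2 C A B) h = g)"

text \<open>\<open>f \<times> g : A \<times> A \<rightarrow> B \<times> B\<close> for \<open>f, g : A \<rightarrow> B\<close>.\<close>

definition prd_map :: "('o, 'a) cat \<Rightarrow> 'o \<Rightarrow> 'o \<Rightarrow> 'a \<Rightarrow> 'a \<Rightarrow> 'a" where
  "prd_map C A B f g = pairing C (prd C A A) B B
    (Cmp C (prd C A A) A B f (pr1 C A A)) (Cmp C (prd C A A) A B g (pr2 C A A))"

definition diagonal :: "('o, 'a) cat \<Rightarrow> 'o \<Rightarrow> 'a" where
  "diagonal C A = pairing C A A A (Id C A) (Id C A)"

text \<open>The ternary product \<open>X \<times> A \<times> B\<close> is taken to be \<open>(X \<times> A) \<times> B\<close>.\<close>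

definition prd3 :: "('o, 'a) cat \<Rightarrow> 'o \<Rightarrow> 'o \<Rightarrow> 'o \<Rightarrow> 'o" where
  "prd3 C X A B = prd C (prd C X A) B"

definition pr13 :: "('o, 'a) cat \<Rightarrow> 'o \<Rightarrow> 'o \<Rightarrow> 'o \<Rightarrow> 'a" where
  "pr13 C X A B = Cmp C (prd3 C X A B) (prd C X A) X (pr1 C X A) (pr1 C (prd C X A) B)"

definition pr23 :: "('o, 'a) cat \<Rightarrow> 'o \<Rightarrow> 'o \<Rightarrow> 'o \<Rightarrow> 'a" where
  "pr23 C X A B = Cmp C (prd3 C X A B) (prd C X A) A (pr2 C X A) (pr1 C (prd C X A) B)"

definition pr33 :: "('o, 'a) cat \<Rightarrow> 'o \<Rightarrow> 'o \<Rightarrow> 'o \<Rightarrow> 'a" where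
  "pr33 C X A B = pr2 C (prd C X A) B"

text \<open>
  The quotient of a category by a family of relations on its hom-sets. \<open>E X Y\<close> is meant to be an
  equivalence relation on \<open>Hom C X Y\<close> that is compatible with composition; the composite of two
  classes is then the class of the composite of any representatives.
\<close>

definition quotient_category ::
  "('o, 'a) cat \<Rightarrow> ('o \<Rightarrow> 'o \<Rightarrow> ('a \<times> 'a) set) \<Rightarrow> ('o, 'a set) cat" where
  "quotient_category C E =
    \<lparr> Obj = Obj C,
      Hom = (\<lambda>X Y. Hom C X Y // E X Y),
      Id = (\<lambda>X. E X X `` {Id C X}),
      Cmp = (\<lambda>X Y Z G F. E X Z `` {Cmp C X Y Z g f | g f. g \<in> G \<and> f \<in> F}) \<rparr>"


section \<open>Elementary doctrines\<close>

text \<open>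
  Inf-semilattices with top are order structures of \<^theory>\<open>HOL-Algebra.Lattice\<close>, so meets and top
  elements are determined by the order.
\<close>

definition inf_semilattice :: "'p gorder \<Rightarrow> bool" where
  "inf_semilattice L \<longleftrightarrow> lower_semilattice L \<and> weak_partial_order_top L"

definition inf_semilattice_hom :: "'p gorder \<Rightarrow> 'q gorder \<Rightarrow> ('p \<Rightarrow> 'q) \<Rightarrow> bool" where
  "inf_semilattice_hom L M h \<longleftrightarrow> h \<in> carrier L \<rightarrow> carrier M \<and> h \<top>\<^bsub>L\<^esub> = \<top>\<^bsub>M\<^esub> \<and>
    (\<forall>x\<in>carrier L. \<forall>y\<in>carrier L. h (x \<sqinter>\<^bsub>L\<^esub> y) = h x \<sqinter>\<^bsub>M\<^esub> h y)"

definition left_adjoint :: "'p gorder \<Rightarrow> 'q gorder \<Rightarrow> ('p \<Rightarrow> 'q) \<Rightarrow> ('q \<Rightarrow> 'p) \<Rightarrow> bool" where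
  "left_adjoint L M l u \<longleftrightarrow> galois_connection \<lparr>orderA = L, orderB = M, lower = l, upper = u\<rparr>"

text \<open>For \<open>f : X \<rightarrow> Y\<close>, \<open>act P X Y f\<close> is the map from \<open>fib P Y\<close> to \<open>fib P X\<close>.\<close>

record ('o, 'a, 'p) doctrine =
  base :: "('o, 'a) cat"
  fib :: "'o \<Rightarrow> 'p gorder"
  act :: "'o \<Rightarrow> 'o \<Rightarrow> 'a \<Rightarrow> 'p \<Rightarrow> 'p"

definition is_doctrine :: "('o, 'a, 'p) doctrine \<Rightarrow> bool" where
  "is_doctrine P \<longleftrightarrow> (let C = base P in
    category C \<and> has_binary_products C \<and>
    (\<forall>A\<in>Obj C. inf_semilattice (fib P A)) \<and>
    (\<forall>A\<in>Obj C. \<forall>B\<in>Obj C. \<forall>f\<in>Hom C A B. inf_semilattice_hom (fib P B) (fib P A) (act P A B f)) \<and>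
    (\<forall>A\<in>Obj C. \<forall>\<alpha>\<in>carrier (fib P A). act P A A (Id C A) \<alpha> = \<alpha>) \<and>
    (\<forall>X\<in>Obj C. \<forall>Y\<in>Obj C. \<forall>Z\<in>Obj C. \<forall>f\<in>Hom C X Y. \<forall>g\<in>Hom C Y Z. \<forall>\<alpha>\<in>carrier (fib P Z).
      act P X Z (Cmp C X Y Z g f) \<alpha> = act P X Y f (act P Y Z g \<alpha>)))"

definition is_equality :: "('o, 'a, 'p) doctrine \<Rightarrow> 'o \<Rightarrow> 'p \<Rightarrow> bool" where
  "is_equality P A d \<longleftrightarrow> (let C = base P; AA = prd C A A in
    d \<in> carrier (fib P AA) \<and>
    left_adjoint (fib P A) (fib P AA)
      (\<lambda>\<alpha>. act P AA A (pr1 C A A) \<alpha> \<sqinter>\<^bsub>fib P AA\<^esub> d)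
      (act P A AA (diagonal C A)) \<and>
    (\<forall>X\<in>Obj C. let XA = prd C X A; XAA = prd3 C X A A;
        p1 = pr13 C X A A; p2 = pr23 C X A A; p3 = pr33 C X A A;
        e = pairing C XA XA A
              (pairing C XA X A (pr1 C X A) (pr2 C X A)) (pr2 C X A) in
      left_adjoint (fib P XA) (fib P XAA)
        (\<lambda>\<alpha>. act P XAA XA (pairing C XAA X A p1 p2) \<alpha>
            \<sqinter>\<^bsub>fib P XAA\<^esub> act P XAA AA (pairing C XAA A A p2 p3) d)
        (act P XA XAA e)))"

definition elementary_doctrine :: "('o, 'a, 'p) doctrine \<Rightarrow> bool" where
  "elementary_doctrine P \<longleftrightarrow> is_doctrine P \<and> (\<forall>A\<in>Obj (base P). \<exists>d. is_equality P A d)"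

text \<open>
  The element \<open>\<delta>\<^sub>A\<close> is unique: by the first adjunction it is the value at the top element of the
  left adjoint of reindexing along the diagonal.
\<close>

definition \<delta> :: "('o, 'a, 'p) doctrine \<Rightarrow> 'o \<Rightarrow> 'p" where
  "\<delta> P A = (THE d. is_equality P A d)"


section \<open>The 2-category of elementary doctrines\<close>

record ('o, 'a, 'p, 'o2, 'a2, 'p2) one_arrow =
  on_obj :: "'o \<Rightarrow> 'o2"
  on_arr :: "'o \<Rightarrow> 'o \<Rightarrow> 'a \<Rightarrow> 'a2"
  on_fib :: "'o \<Rightarrow> 'p \<Rightarrow> 'p2"

definition ED_one_arrow ::
  "('o, 'a, 'p) doctrine \<Rightarrow> ('o2, 'a2, 'p2) doctrine \<Rightarrow>
    ('o, 'a, 'p, 'o2, 'a2, 'p2) one_arrow \<Rightarrow> bool" where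
  "ED_one_arrow P R \<Phi> \<longleftrightarrow>
    (let C = base P; D = base R; F0 = on_obj \<Phi>; F1 = on_arr \<Phi>; b = on_fib \<Phi> in
    is_functor C D F0 F1 \<and>
    (\<forall>A\<in>Obj C. \<forall>B\<in>Obj C. \<forall>W p q. is_product C A B (W, p, q) \<longrightarrow>
      is_product D (F0 A) (F0 B) (F0 W, F1 W A p, F1 W B q)) \<and>
    (\<forall>A\<in>Obj C. inf_semilattice_hom (fib P A) (fib R (F0 A)) (b A)) \<and>
    (\<forall>A\<in>Obj C. \<forall>B\<in>Obj C. \<forall>f\<in>Hom C A B. \<forall>\<beta>\<in>carrier (fib P B).
      b A (act P A B f \<beta>) = act R (F0 A) (F0 B) (F1 A B f) (b B \<beta>)) \<and>
    (\<forall>A\<in>Obj C. let AA = prd C A A in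
      b AA (\<delta> P A) =
        act R (F0 AA) (prd D (F0 A) (F0 A))
          (pairing D (F0 AA) (F0 A) (F0 A) (F1 AA A (pr1 C A A)) (F1 AA A (pr2 C A A)))
          (\<delta> R (F0 A))))"

definition identity_one_arrow :: "('o, 'a, 'p, 'o, 'a, 'p) one_arrow" where
  "identity_one_arrow = \<lparr> on_obj = (\<lambda>A. A), on_arr = (\<lambda>A B f. f), on_fib = (\<lambda>A \<alpha>. \<alpha>) \<rparr>"

text \<open>\<open>compose_one_arrow \<Gamma> \<Phi>\<close> is first \<open>\<Phi>\<close>, then \<open>\<Gamma>\<close>.\<close>

definition compose_one_arrow ::
  "('o2, 'a2, 'p2, 'o3, 'a3, 'p3) one_arrow \<Rightarrow> ('o, 'a, 'p, 'o2, 'a2, 'p2) one_arrow \<Rightarrow>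
    ('o, 'a, 'p, 'o3, 'a3, 'p3) one_arrow" where
  "compose_one_arrow \<Gamma> \<Phi> =
    \<lparr> on_obj = (\<lambda>A. on_obj \<Gamma> (on_obj \<Phi> A)),
      on_arr = (\<lambda>A B f. on_arr \<Gamma> (on_obj \<Phi> A) (on_obj \<Phi> B) (on_arr \<Phi> A B f)),
      on_fib = (\<lambda>A \<alpha>. on_fib \<Gamma> (on_obj \<Phi> A) (on_fib \<Phi> A \<alpha>)) \<rparr>"

definition ED_two_arrow ::
  "('o, 'a, 'p) doctrine \<Rightarrow> ('o2, 'a2, 'p2) doctrine \<Rightarrow>
    ('o, 'a, 'p, 'o2, 'a2, 'p2) one_arrow \<Rightarrow> ('o, 'a, 'p, 'o2, 'a2, 'p2) one_arrow \<Rightarrow>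
    ('o \<Rightarrow> 'a2) \<Rightarrow> bool" where
  "ED_two_arrow P R \<Phi> \<Gamma> \<theta> \<longleftrightarrow>
    natural_transformation (base P) (base R)
      (on_obj \<Phi>) (on_arr \<Phi>) (on_obj \<Gamma>) (on_arr \<Gamma>) \<theta> \<and>
    (\<forall>A\<in>Obj (base P). \<forall>\<alpha>\<in>carrier (fib P A).
      on_fib \<Phi> A \<alpha> \<sqsubseteq>\<^bsub>fib R (on_obj \<Phi> A)\<^esub>
        act R (on_obj \<Phi> A) (on_obj \<Gamma> A) (\<theta> A) (on_fib \<Gamma> A \<alpha>))"

definition ED_isomorphic_one_arrows ::
  "('o, 'a, 'p) doctrine \<Rightarrow> ('o2, 'a2, 'p2) doctrine \<Rightarrow>
    ('o, 'a, 'p, 'o2, 'a2, 'p2) one_arrow \<Rightarrow> ('o, 'a, 'p, 'o2, 'a2, 'p2) one_arrow \<Rightarrow> bool" where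
  "ED_isomorphic_one_arrows P R \<Phi> \<Gamma> \<longleftrightarrow>
    (\<exists>\<theta> \<eta>. ED_two_arrow P R \<Phi> \<Gamma> \<theta> \<and> ED_two_arrow P R \<Gamma> \<Phi> \<eta> \<and>
      (\<forall>A\<in>Obj (base P).
        Cmp (base R) (on_obj \<Phi> A) (on_obj \<Gamma> A) (on_obj \<Phi> A) (\<eta> A) (\<theta> A)
          = Id (base R) (on_obj \<Phi> A) \<and>
        Cmp (base R) (on_obj \<Gamma> A) (on_obj \<Phi> A) (on_obj \<Gamma> A) (\<theta> A) (\<eta> A)
          = Id (base R) (on_obj \<Gamma> A)))"

definition ED_equivalent :: "('o, 'a, 'p) doctrine \<Rightarrow> ('o2, 'a2, 'p2) doctrine \<Rightarrow> bool" where
  "ED_equivalent P R \<longleftrightarrow> elementary_doctrine P \<and> elementary_doctrine R \<and>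
    (\<exists>\<Phi> \<Gamma>. ED_one_arrow P R \<Phi> \<and> ED_one_arrow R P \<Gamma> \<and>
      ED_isomorphic_one_arrows P P identity_one_arrow (compose_one_arrow \<Gamma> \<Phi>) \<and>
      ED_isomorphic_one_arrows R R (compose_one_arrow \<Phi> \<Gamma>) identity_one_arrow)"


section \<open>Weak subobjects and subobjects\<close>

text \<open>An object \<open>f : X \<rightarrow> A\<close> of the comma category over \<open>A\<close> is the pair \<open>(X, f)\<close>.\<close>

definition slice_objs :: "('o, 'a) cat \<Rightarrow> 'o \<Rightarrow> ('o \<times> 'a) set" where
  "slice_objs C A = {(X, f). X \<in> Obj C \<and> f \<in> Hom C X A}"

definition slice_monos :: "('o, 'a) cat \<Rightarrow> 'o \<Rightarrow> ('o \<times> 'a) set" where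
  "slice_monos C A = {(X, m). X \<in> Obj C \<and> is_mono C X A m}"

definition slice_le :: "('o, 'a) cat \<Rightarrow> 'o \<Rightarrow> 'o \<times> 'a \<Rightarrow> 'o \<times> 'a \<Rightarrow> bool" where
  "slice_le C A = (\<lambda>(X, f) (Y, g). \<exists>h\<in>Hom C X Y. Cmp C X Y A g h = f)"

definition slice_equiv :: "('o, 'a) cat \<Rightarrow> 'o \<Rightarrow> 'o \<times> 'a \<Rightarrow> 'o \<times> 'a \<Rightarrow> bool" where
  "slice_equiv C A x y \<longleftrightarrow> slice_le C A x y \<and> slice_le C A y x"

definition poset_reflection :: "'x set \<Rightarrow> ('x \<Rightarrow> 'x \<Rightarrow> bool) \<Rightarrow> 'x set gorder" where
  "poset_reflection M R =
    \<lparr> carrier = M // {(x, y). x \<in> M \<and> y \<in> M \<and> R x y \<and> R y x},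
      eq = (=),
      le = (\<lambda>\<alpha> \<beta>. \<exists>x\<in>\<alpha>. \<exists>y\<in>\<beta>. R x y) \<rparr>"

text \<open>
  Reindexing sends the class of \<open>g\<close> to the class of a weak pullback of \<open>g\<close>; stated as the set of all
  arrows equivalent to some weak pullback of some representative, it involves no choice.
\<close>

definition weak_subobjects :: "('o, 'a) cat \<Rightarrow> ('o, 'a, ('o \<times> 'a) set) doctrine" where
  "weak_subobjects C =
    \<lparr> base = C,
      fib = (\<lambda>A. poset_reflection (slice_objs C A) (slice_le C A)),
      act = (\<lambda>A B f \<beta>. {x \<in> slice_objs C A. \<exists>(Y, g)\<in>\<beta>. \<exists>W p q.
        is_weak_pullback C A Y B f g W p q \<and> slice_equiv C A x (W, p)}) \<rparr>"

definition subobjects :: "('o, 'a) cat \<Rightarrow> ('o, 'a, ('o \<times> 'a) set) doctrine" where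
  "subobjects C =
    \<lparr> base = C,
      fib = (\<lambda>A. poset_reflection (slice_monos C A) (slice_le C A)),
      act = (\<lambda>A B f \<beta>. {x \<in> slice_monos C A. \<exists>(Y, m)\<in>\<beta>. \<exists>W p q.
        is_pullback C A Y B f m W p q \<and> slice_equiv C A x (W, p)}) \<rparr>"


section \<open>Quotient completion and extensional collapse\<close>

definition P_equivalence :: "('o, 'a, 'p) doctrine \<Rightarrow> 'o \<Rightarrow> 'p \<Rightarrow> bool" where
  "P_equivalence P A \<rho> \<longleftrightarrow>
    (let C = base P; AA = prd C A A; AAA = prd3 C A A A;
         p1 = pr13 C A A A; p2 = pr23 C A A A; p3 = pr33 C A A A in
    \<rho> \<in> carrier (fib P AA) \<and>
    \<delta> P A \<sqsubseteq>\<^bsub>fib P AA\<^esub> \<rho> \<and>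
    \<rho> \<sqsubseteq>\<^bsub>fib P AA\<^esub> act P AA AA (pairing C AA A A (pr2 C A A) (pr1 C A A)) \<rho> \<and>
    act P AAA AA (pairing C AAA A A p1 p2) \<rho> \<sqinter>\<^bsub>fib P AAA\<^esub> act P AAA AA (pairing C AAA A A p2 p3) \<rho>
      \<sqsubseteq>\<^bsub>fib P AAA\<^esub> act P AAA AA (pairing C AAA A A p1 p3) \<rho>)"

definition Des :: "('o, 'a, 'p) doctrine \<Rightarrow> 'o \<Rightarrow> 'p \<Rightarrow> 'p gorder" where
  "Des P A \<rho> = (let C = base P; AA = prd C A A in
    (fib P A)\<lparr>carrier := {\<alpha> \<in> carrier (fib P A).
      act P AA A (pr1 C A A) \<alpha> \<sqinter>\<^bsub>fib P AA\<^esub> \<rho> \<sqsubseteq>\<^bsub>fib P AA\<^esub> act P AA A (pr2 C A A) \<alpha>}\<rparr>)"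

definition equivalence_category :: "('o, 'a, 'p) doctrine \<Rightarrow> ('o \<times> 'p, 'a) cat" where
  "equivalence_category P = (let C = base P in
    \<lparr> Obj = {(A, \<rho>). A \<in> Obj C \<and> P_equivalence P A \<rho>},
      Hom = (\<lambda>(A, \<rho>) (B, \<sigma>). {f \<in> Hom C A B.
        \<rho> \<sqsubseteq>\<^bsub>fib P (prd C A A)\<^esub> act P (prd C A A) (prd C B B) (prd_map C A B f f) \<sigma>}),
      Id = (\<lambda>(A, \<rho>). Id C A),
      Cmp = (\<lambda>(X, _) (Y, _) (Z, _). Cmp C X Y Z) \<rparr>)"

definition quotient_completion :: "('o, 'a, 'p) doctrine \<Rightarrow> ('o \<times> 'p, 'a, 'p) doctrine" where
  "quotient_completion P =
    \<lparr> base = equivalence_category P,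
      fib = (\<lambda>(A, \<rho>). Des P A \<rho>),
      act = (\<lambda>(A, _) (B, _). act P A B) \<rparr>"

definition ext_le :: "('o, 'a, 'p) doctrine \<Rightarrow> 'o \<Rightarrow> 'o \<Rightarrow> 'a \<Rightarrow> 'a \<Rightarrow> bool" where
  "ext_le E A B f f' \<longleftrightarrow> (let C = base E; AA = prd C A A; BB = prd C B B in
    \<delta> E A \<sqsubseteq>\<^bsub>fib E AA\<^esub> act E AA BB (prd_map C A B f f') (\<delta> E B))"

definition collapse_category :: "('o, 'a, 'p) doctrine \<Rightarrow> ('o, 'a set) cat" where
  "collapse_category E =
    (let C = (base E)\<lparr>Hom := (\<lambda>A B. {f \<in> Hom (base E) A B. ext_le E A B f f})\<rparr> in
    quotient_category C
      (\<lambda>A B. {(f, f'). f \<in> Hom C A B \<and> f' \<in> Hom C A B \<and> ext_le E A B f f'}))"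

text \<open>The action of a class is that of any representative.\<close>

definition extensional_collapse :: "('o, 'a, 'p) doctrine \<Rightarrow> ('o, 'a set, 'p) doctrine" where
  "extensional_collapse E =
    \<lparr> base = collapse_category E,
      fib = fib E,
      act = (\<lambda>A B F. act E A B (SOME f. f \<in> F)) \<rparr>"


section \<open>The exact completion\<close>

text \<open>The triple \<open>(A, R, r)\<close> stands for \<open>r = \<langle>r\<^sub>1, r\<^sub>2\<rangle> : R \<rightarrow> A \<times> A\<close>.\<close>

definition pseudo_equivalence :: "('o, 'a) cat \<Rightarrow> 'o \<times> 'o \<times> 'a \<Rightarrow> bool" where
  "pseudo_equivalence C = (\<lambda>(A, R, r). let AA = prd C A A;
      r1 = Cmp C R AA A (pr1 C A A) r; r2 = Cmp C R AA A (pr2 C A A) r in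
    A \<in> Obj C \<and> R \<in> Obj C \<and> r \<in> Hom C R AA \<and>
    (\<exists>s\<in>Hom C A R. Cmp C A R AA r s = diagonal C A) \<and>
    (\<exists>s\<in>Hom C R R. Cmp C R R AA r s = pairing C R A A r2 r1) \<and>
    (\<forall>W p q. is_weak_pullback C R R A r2 r1 W p q \<longrightarrow>
      (\<exists>t\<in>Hom C W R. Cmp C W R AA r t = pairing C W A A (Cmp C W R A r1 p) (Cmp C W R A r2 q))))"

text \<open>Pseudo-equivalence relations, with arrows not yet identified.\<close>

definition pseudo_equivalence_category :: "('o, 'a) cat \<Rightarrow> ('o \<times> 'o \<times> 'a, 'a) cat" where
  "pseudo_equivalence_category C =
    \<lparr> Obj = {x. pseudo_equivalence C x},
      Hom = (\<lambda>(A, R, r) (B, T, s). {f \<in> Hom C A B. \<exists>h\<in>Hom C R T.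
        Cmp C R T (prd C B B) s h = Cmp C R (prd C A A) (prd C B B) (prd_map C A B f f) r}),
      Id = (\<lambda>(A, R, r). Id C A),
      Cmp = (\<lambda>(X, _) (Y, _) (Z, _). Cmp C X Y Z) \<rparr>"

definition exact_completion :: "('o, 'a) cat \<Rightarrow> ('o \<times> 'o \<times> 'a, 'a set) cat" where
  "exact_completion C = (let D = pseudo_equivalence_category C in
    quotient_category D
      (\<lambda>x y. {(f, g). f \<in> Hom D x y \<and> g \<in> Hom D x y \<and>
        (case x of (A, R, r) \<Rightarrow> case y of (B, T, s) \<Rightarrow>
          \<exists>h\<in>Hom C A T. Cmp C A T (prd C B B) s h = pairing C A B B f g)}))"

end

theory Submission
  imports Defs
begin

text \<open>
  The theorem holds because both doctrines are, up to the names of objects, one and the same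
  doctrine of setoids. A weak subobject of \<open>A\<close> is determined by the generalized elements
  \<open>a : U \<rightarrow> A\<close> that factor through it, that is, by a principal sieve on \<open>A\<close>. In terms of sieves the
  order of \<open>\<Psi>(A)\<close> is inclusion, meets are intersections, reindexing along \<open>f\<close> is the preimage under
  composition with \<open>f\<close>, and \<open>\<delta>\<^sub>A\<close> consists of the arrows into \<open>A \<times> A\<close> with equal components.

  Consequently a \<open>\<Psi>\<close>-equivalence relation on \<open>A\<close> is a family of equivalence relations on the sets
  \<open>Hom(U, A)\<close>, stable under precomposition and generated by a single pair \<open>r\<^sub>1, r\<^sub>2 : R \<rightarrow> A\<close>. A
  pseudo-equivalence relation is the same thing together with a choice of the generating pair. Call
  \<open>A\<close> with such a family a setoid. Under this dictionary the arrows of the quotient completion and of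
  the category of pseudo-equivalence relations are both the relation-preserving arrows
  (\<open>equivalence_category_relabels\<close>, \<open>pseudo_equivalence_category_relabels\<close>), and the extensional
  collapse and the exact completion both identify \<open>f, g : A \<rightarrow> B\<close> when the pair \<open>(f, g)\<close> lies in the
  relation of \<open>B\<close> (\<open>ext_le_iff\<close>, \<open>exact_completion_relabels\<close>). So the two base categories have the
  same hom-sets and differ only in how objects are named.

  On fibres, descent data for \<open>\<rho>\<close> are the principal sieves closed under the relation
  (\<open>quotient_completion_relabels\<close>). A subobject \<open>m : x \<rightarrow> y\<close> of setoids gives the sieve of the elements
  of \<open>y\<close> that are related to some \<open>m c\<close>. Being monic means reflecting the relation, hence an arrow into
  \<open>y\<close> factors through \<open>m\<close> exactly if it lies in that sieve (\<open>factors_through_mono_iff\<close>). This makes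
  subobjects order-isomorphic to closed sieves and turns pullback into preimage
  (\<open>subobjects_relabels\<close>).

  What remains is general: a doctrine that differs from an elementary one only by names of objects
  and fibrewise order isomorphisms is elementary, and two such doctrines are equivalent
  (\<open>relabelings_equivalent\<close>). The obstacle is that equality predicates refer to chosen products,
  which a renaming of objects does not preserve. They are therefore described by reflexivity and
  Leibniz substitution on generalized elements, for an arbitrary product diagram
  (\<open>leibniz_equality\<close>); this description is invariant under renaming and determines \<open>\<delta>\<close>.
\<close>

section \<open>Inf-semilattices\<close>

lemma inf_semilatticeI:
  fixes L :: "'p gorder"
  assumes "eq L = (=)"
    and "\<And>x. x \<in> carrier L \<Longrightarrow> x \<sqsubseteq>\<^bsub>L\<^esub> x"
    and "\<And>x y. \<lbrakk>x \<in> carrier L; y \<in> carrier L; x \<sqsubseteq>\<^bsub>L\<^esub> y; y \<sqsubseteq>\<^bsub>L\<^esub> x\<rbrakk> \<Longrightarrow> x = y"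
    and "\<And>x y z. \<lbrakk>x \<in> carrier L; y \<in> carrier L; z \<in> carrier L; x \<sqsubseteq>\<^bsub>L\<^esub> y; y \<sqsubseteq>\<^bsub>L\<^esub> z\<rbrakk> \<Longrightarrow> x \<sqsubseteq>\<^bsub>L\<^esub> z"
    and meet: "\<And>x y. \<lbrakk>x \<in> carrier L; y \<in> carrier L\<rbrakk> \<Longrightarrow>
      \<exists>m\<in>carrier L. m \<sqsubseteq>\<^bsub>L\<^esub> x \<and> m \<sqsubseteq>\<^bsub>L\<^esub> y \<and> (\<forall>z\<in>carrier L. z \<sqsubseteq>\<^bsub>L\<^esub> x \<longrightarrow> z \<sqsubseteq>\<^bsub>L\<^esub> y \<longrightarrow> z \<sqsubseteq>\<^bsub>L\<^esub> m)"
    and top: "\<exists>t\<in>carrier L. \<forall>x\<in>carrier L. x \<sqsubseteq>\<^bsub>L\<^esub> t"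
  shows "inf_semilattice L"
proof -
  interpret partial_order L
    by unfold_locales (simp_all add: assms(1), (metis assms(2-4))+)
  have "lower_semilattice L"
  proof unfold_locales
    fix x y assume "x \<in> carrier L" "y \<in> carrier L"
    then show "\<exists>s. is_glb L s {x, y}"
      using meet[of x y] unfolding greatest_def Lower_def by auto
  qed
  moreover have "weak_partial_order_top L"
    by unfold_locales (use top in \<open>auto simp: greatest_def\<close>)
  ultimately show ?thesis
    unfolding inf_semilattice_def by blast
qed

locale meet_semilattice =
  fixes L :: "'p gorder"
  assumes inf_semilattice: "inf_semilattice L"
begin

sublocale lower_semilattice L
  using inf_semilattice unfolding inf_semilattice_def by blast

sublocale weak_partial_order_top L
  using inf_semilattice unfolding inf_semilattice_def by blast

lemma meet_eqI:
  assumes "x \<in> carrier L" "y \<in> carrier L" "m \<in> carrier L" "m \<sqsubseteq>\<^bsub>L\<^esub> x" "m \<sqsubseteq>\<^bsub>L\<^esub> y"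
    and "\<And>z. \<lbrakk>z \<in> carrier L; z \<sqsubseteq>\<^bsub>L\<^esub> x; z \<sqsubseteq>\<^bsub>L\<^esub> y\<rbrakk> \<Longrightarrow> z \<sqsubseteq>\<^bsub>L\<^esub> m"
  shows "x \<sqinter>\<^bsub>L\<^esub> y = m"
  using assms by (meson le_antisym meet_closed meet_le meet_left meet_right)

lemma top_eqI:
  assumes "t \<in> carrier L" "\<And>x. x \<in> carrier L \<Longrightarrow> x \<sqsubseteq>\<^bsub>L\<^esub> t"
  shows "\<top>\<^bsub>L\<^esub> = t"
  using assms by (meson le_antisym top_closed top_higher)

end

section \<open>Products\<close>

context category
begin

lemma product_cone:
  assumes "is_product C A B (W, p, q)"
  shows "W \<in> Obj C" "p \<in> Hom C W A" "q \<in> Hom C W B"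
  using assms unfolding is_product_def by auto

lemma product_pair:
  assumes "is_product C A B (W, p, q)" "X \<in> Obj C" "f \<in> Hom C X A" "g \<in> Hom C X B"
  obtains h where "h \<in> Hom C X W" "Cmp C X W A p h = f" "Cmp C X W B q h = g"
  using assms unfolding is_product_def by blast

lemma product_eqI:
  assumes "is_product C A B (W, p, q)" "A \<in> Obj C" "B \<in> Obj C" "X \<in> Obj C"
    and "h \<in> Hom C X W" "h' \<in> Hom C X W"
    and "Cmp C X W A p h = Cmp C X W A p h'" "Cmp C X W B q h = Cmp C X W B q h'"
  shows "h = h'"
proof -
  have "Cmp C X W A p h' \<in> Hom C X A" "Cmp C X W B q h' \<in> Hom C X B"
    using assms product_cone[OF assms(1)] Cmp_closed by auto
  then show ?thesis
    using assms(1,4-) unfolding is_product_def by blast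
qed

lemma chosen_product:
  assumes "has_binary_products C" "A \<in> Obj C" "B \<in> Obj C"
  shows "is_product C A B (prd C A B, pr1 C A B, pr2 C A B)"
proof -
  have "is_product C A B (some_product C A B)"
    unfolding some_product_def using assms by (metis has_binary_products_def someI_ex)
  then show ?thesis
    by (simp add: prd_def pr1_def pr2_def)
qed

lemma pairing:
  assumes "has_binary_products C" "A \<in> Obj C" "B \<in> Obj C" "X \<in> Obj C"
    and "f \<in> Hom C X A" "g \<in> Hom C X B"
  shows "pairing C X A B f g \<in> Hom C X (prd C A B)"
    and "Cmp C X (prd C A B) A (pr1 C A B) (pairing C X A B f g) = f"
    and "Cmp C X (prd C A B) B (pr2 C A B) (pairing C X A B f g) = g"
proof -
  have "\<exists>!h. h \<in> Hom C X (prd C A B) \<and>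
    Cmp C X (prd C A B) A (pr1 C A B) h = f \<and> Cmp C X (prd C A B) B (pr2 C A B) h = g"
    using chosen_product[OF assms(1-3)] assms(4-) unfolding is_product_def by blast
  from theI'[OF this]
  show "pairing C X A B f g \<in> Hom C X (prd C A B)"
    "Cmp C X (prd C A B) A (pr1 C A B) (pairing C X A B f g) = f"
    "Cmp C X (prd C A B) B (pr2 C A B) (pairing C X A B f g) = g"
    unfolding pairing_def by auto
qed

end

section \<open>Equality in a doctrine\<close>

locale semilattice_doctrine =
  fixes P :: "('o, 'a, 'p) doctrine"
  assumes is_doctrine: "is_doctrine P"
begin

abbreviation "C \<equiv> base P"

sublocale category C
  using is_doctrine unfolding is_doctrine_def by (simp add: Let_def)

lemma binary_products: "has_binary_products C"
  using is_doctrine unfolding is_doctrine_def by (simp add: Let_def)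

lemma fib_semilattice: "A \<in> Obj C \<Longrightarrow> meet_semilattice (fib P A)"
  using is_doctrine unfolding is_doctrine_def meet_semilattice_def by (simp add: Let_def)

lemma act_hom:
  "\<lbrakk>A \<in> Obj C; B \<in> Obj C; f \<in> Hom C A B\<rbrakk> \<Longrightarrow> inf_semilattice_hom (fib P B) (fib P A) (act P A B f)"
  using is_doctrine unfolding is_doctrine_def by (simp add: Let_def)

lemma act_closed:
  "\<lbrakk>A \<in> Obj C; B \<in> Obj C; f \<in> Hom C A B; \<beta> \<in> carrier (fib P B)\<rbrakk> \<Longrightarrow> act P A B f \<beta> \<in> carrier (fib P A)"
  using act_hom unfolding inf_semilattice_hom_def by blast

lemma act_top:
  "\<lbrakk>A \<in> Obj C; B \<in> Obj C; f \<in> Hom C A B\<rbrakk> \<Longrightarrow> act P A B f \<top>\<^bsub>fib P B\<^esub> = \<top>\<^bsub>fib P A\<^esub>"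
  using act_hom unfolding inf_semilattice_hom_def by blast

lemma act_meet:
  "\<lbrakk>A \<in> Obj C; B \<in> Obj C; f \<in> Hom C A B; \<alpha> \<in> carrier (fib P B); \<beta> \<in> carrier (fib P B)\<rbrakk> \<Longrightarrow>
    act P A B f (\<alpha> \<sqinter>\<^bsub>fib P B\<^esub> \<beta>) = act P A B f \<alpha> \<sqinter>\<^bsub>fib P A\<^esub> act P A B f \<beta>"
  using act_hom unfolding inf_semilattice_hom_def by blast

lemma act_Id: "\<lbrakk>A \<in> Obj C; \<alpha> \<in> carrier (fib P A)\<rbrakk> \<Longrightarrow> act P A A (Id C A) \<alpha> = \<alpha>"
  using is_doctrine unfolding is_doctrine_def by (simp add: Let_def)

lemma act_Cmp:
  "\<lbrakk>X \<in> Obj C; Y \<in> Obj C; Z \<in> Obj C; f \<in> Hom C X Y; g \<in> Hom C Y Z; \<alpha> \<in> carrier (fib P Z)\<rbrakk> \<Longrightarrow>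
    act P X Z (Cmp C X Y Z g f) \<alpha> = act P X Y f (act P Y Z g \<alpha>)"
  using is_doctrine unfolding is_doctrine_def by (simp add: Let_def)

lemma act_mono:
  assumes "A \<in> Obj C" "B \<in> Obj C" "f \<in> Hom C A B" "\<alpha> \<in> carrier (fib P B)" "\<beta> \<in> carrier (fib P B)"
    and "\<alpha> \<sqsubseteq>\<^bsub>fib P B\<^esub> \<beta>"
  shows "act P A B f \<alpha> \<sqsubseteq>\<^bsub>fib P A\<^esub> act P A B f \<beta>"
proof -
  interpret A: meet_semilattice "fib P A" using assms(1) by (rule fib_semilattice)
  interpret B: meet_semilattice "fib P B" using assms(2) by (rule fib_semilattice)
  have "\<alpha> \<sqinter>\<^bsub>fib P B\<^esub> \<beta> = \<alpha>"
    using assms by (intro B.meet_eqI) auto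
  then have "act P A B f \<alpha> = act P A B f \<alpha> \<sqinter>\<^bsub>fib P A\<^esub> act P A B f \<beta>"
    using act_meet[OF assms(1-5)] by simp
  then show ?thesis
    using A.meet_right assms act_closed by metis
qed

text \<open>
  The unit of this adjunction is an equality: \<open>e\<close> is a section of \<open>k\<close> and \<open>D\<close> becomes the top element
  along \<open>e\<close>. The last hypothesis is its counit. Both adjunctions that define an equality predicate
  have this form, with a diagonal as \<open>e\<close> and a projection as \<open>k\<close>.
\<close>

lemma left_adjoint_of_section:
  assumes "Y \<in> Obj C" "Z \<in> Obj C" "e \<in> Hom C Y Z" "k \<in> Hom C Z Y"
    and "Cmp C Y Z Y k e = Id C Y" and "D \<in> carrier (fib P Z)"
    and "act P Y Z e D = \<top>\<^bsub>fib P Y\<^esub>"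
    and ind: "\<And>\<beta>. \<beta> \<in> carrier (fib P Z) \<Longrightarrow>
      act P Z Z (Cmp C Z Y Z e k) \<beta> \<sqinter>\<^bsub>fib P Z\<^esub> D \<sqsubseteq>\<^bsub>fib P Z\<^esub> \<beta>"
  shows "left_adjoint (fib P Y) (fib P Z) (\<lambda>\<alpha>. act P Z Y k \<alpha> \<sqinter>\<^bsub>fib P Z\<^esub> D) (act P Y Z e)"
proof -
  interpret Y: meet_semilattice "fib P Y" using assms(1) by (rule fib_semilattice)
  interpret Z: meet_semilattice "fib P Z" using assms(2) by (rule fib_semilattice)
  have unit: "act P Y Z e (act P Z Y k \<alpha> \<sqinter>\<^bsub>fib P Z\<^esub> D) = \<alpha>" if "\<alpha> \<in> carrier (fib P Y)" for \<alpha>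
  proof -
    have "act P Y Z e (act P Z Y k \<alpha> \<sqinter>\<^bsub>fib P Z\<^esub> D) = \<alpha> \<sqinter>\<^bsub>fib P Y\<^esub> \<top>\<^bsub>fib P Y\<^esub>"
      using assms that by (simp add: act_meet act_closed act_Cmp[symmetric] act_Id)
    also have "\<dots> = \<alpha>"
      using that by (intro Y.meet_eqI) auto
    finally show ?thesis .
  qed
  have "act P Z Y k \<alpha> \<sqinter>\<^bsub>fib P Z\<^esub> D \<sqsubseteq>\<^bsub>fib P Z\<^esub> \<beta> \<longleftrightarrow> \<alpha> \<sqsubseteq>\<^bsub>fib P Y\<^esub> act P Y Z e \<beta>"
    if a: "\<alpha> \<in> carrier (fib P Y)" and b: "\<beta> \<in> carrier (fib P Z)" for \<alpha> \<beta>
  proof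
    assume "act P Z Y k \<alpha> \<sqinter>\<^bsub>fib P Z\<^esub> D \<sqsubseteq>\<^bsub>fib P Z\<^esub> \<beta>"
    then have "act P Y Z e (act P Z Y k \<alpha> \<sqinter>\<^bsub>fib P Z\<^esub> D) \<sqsubseteq>\<^bsub>fib P Y\<^esub> act P Y Z e \<beta>"
      using a b assms by (intro act_mono) (auto intro!: act_closed Z.meet_closed)
    then show "\<alpha> \<sqsubseteq>\<^bsub>fib P Y\<^esub> act P Y Z e \<beta>"
      using unit[OF a] by simp
  next
    assume "\<alpha> \<sqsubseteq>\<^bsub>fib P Y\<^esub> act P Y Z e \<beta>"
    then have le: "act P Z Y k \<alpha> \<sqsubseteq>\<^bsub>fib P Z\<^esub> act P Z Y k (act P Y Z e \<beta>)"
      using a b assms by (intro act_mono) (auto intro: act_closed)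
    have car: "act P Z Y k \<alpha> \<in> carrier (fib P Z)" "act P Z Y k (act P Y Z e \<beta>) \<in> carrier (fib P Z)"
      using a b assms by (auto intro: act_closed)
    have "act P Z Y k \<alpha> \<sqinter>\<^bsub>fib P Z\<^esub> D \<sqsubseteq>\<^bsub>fib P Z\<^esub> act P Z Y k (act P Y Z e \<beta>) \<sqinter>\<^bsub>fib P Z\<^esub> D"
      using car le assms(6) by (meson Z.le_trans Z.meet_closed Z.meet_le Z.meet_left Z.meet_right)
    also have "\<dots> \<sqsubseteq>\<^bsub>fib P Z\<^esub> \<beta>"
      using ind[OF b] b assms by (simp add: act_Cmp)
    finally show "act P Z Y k \<alpha> \<sqinter>\<^bsub>fib P Z\<^esub> D \<sqsubseteq>\<^bsub>fib P Z\<^esub> \<beta>"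
      using car b assms(6) by simp
  qed
  moreover have "act P Z Y k \<alpha> \<sqinter>\<^bsub>fib P Z\<^esub> D \<in> carrier (fib P Z)" if "\<alpha> \<in> carrier (fib P Y)" for \<alpha>
    using that assms(1-6) by (blast intro: act_closed Z.meet_closed)
  moreover have "act P Y Z e \<beta> \<in> carrier (fib P Y)" if "\<beta> \<in> carrier (fib P Z)" for \<beta>
    using that assms(1-6) by (blast intro: act_closed)
  ultimately show ?thesis
    unfolding left_adjoint_def galois_connection_def galois_connection_axioms_def connection_def
    using Y.partial_order_axioms Z.partial_order_axioms by simp
qed

end

text \<open>
  Equality of the two components \<open>p, q : W \<rightarrow> A\<close> of a product diagram, expressed on generalized
  elements: equal components satisfy \<open>d\<close>, and \<open>d(a, a')\<close> permits the replacement of \<open>a\<close> by \<open>a'\<close> in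
  every predicate \<open>\<beta>(x, a)\<close>, over every product diagram for \<open>X \<times> A\<close>. Quantifying over all product
  diagrams is what makes the notion independent of the chosen ones.
\<close>

definition leibniz_equality ::
  "('o, 'a, 'p) doctrine \<Rightarrow> 'o \<Rightarrow> 'o \<Rightarrow> 'a \<Rightarrow> 'a \<Rightarrow> 'p \<Rightarrow> bool" where
  "leibniz_equality P A W p q d \<longleftrightarrow> (let C = base P in
    d \<in> carrier (fib P W) \<and>
    (\<forall>Z\<in>Obj C. \<forall>h\<in>Hom C Z W. Cmp C Z W A p h = Cmp C Z W A q h \<longrightarrow> act P Z W h d = \<top>\<^bsub>fib P Z\<^esub>) \<and>
    (\<forall>X\<in>Obj C. \<forall>V s t. is_product C X A (V, s, t) \<longrightarrow>
      (\<forall>Z\<in>Obj C. \<forall>u\<in>Hom C Z V. \<forall>u'\<in>Hom C Z V. \<forall>w\<in>Hom C Z W. \<forall>\<beta>\<in>carrier (fib P V).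
        Cmp C Z V X s u = Cmp C Z V X s u' \<longrightarrow>
        Cmp C Z V A t u = Cmp C Z W A p w \<longrightarrow> Cmp C Z V A t u' = Cmp C Z W A q w \<longrightarrow>
        act P Z V u \<beta> \<sqinter>\<^bsub>fib P Z\<^esub> act P Z W w d \<sqsubseteq>\<^bsub>fib P Z\<^esub> act P Z V u' \<beta>)))"

lemma leibnizI:
  assumes "d \<in> carrier (fib P W)"
    and "\<And>Z h. \<lbrakk>Z \<in> Obj (base P); h \<in> Hom (base P) Z W; Cmp (base P) Z W A p h = Cmp (base P) Z W A q h\<rbrakk>
      \<Longrightarrow> act P Z W h d = \<top>\<^bsub>fib P Z\<^esub>"
    and "\<And>X V s t Z u u' w \<beta>. \<lbrakk>X \<in> Obj (base P); is_product (base P) X A (V, s, t); Z \<in> Obj (base P);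
      u \<in> Hom (base P) Z V; u' \<in> Hom (base P) Z V; w \<in> Hom (base P) Z W; \<beta> \<in> carrier (fib P V);
      Cmp (base P) Z V X s u = Cmp (base P) Z V X s u';
      Cmp (base P) Z V A t u = Cmp (base P) Z W A p w; Cmp (base P) Z V A t u' = Cmp (base P) Z W A q w\<rbrakk>
      \<Longrightarrow> act P Z V u \<beta> \<sqinter>\<^bsub>fib P Z\<^esub> act P Z W w d \<sqsubseteq>\<^bsub>fib P Z\<^esub> act P Z V u' \<beta>"
  shows "leibniz_equality P A W p q d"
  unfolding leibniz_equality_def Let_def using assms by simp

context semilattice_doctrine
begin

lemma leibniz_closed: "leibniz_equality P A W p q d \<Longrightarrow> d \<in> carrier (fib P W)"
  unfolding leibniz_equality_def by (simp add: Let_def)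

lemma leibniz_refl:
  "\<lbrakk>leibniz_equality P A W p q d; Z \<in> Obj C; h \<in> Hom C Z W; Cmp C Z W A p h = Cmp C Z W A q h\<rbrakk>
    \<Longrightarrow> act P Z W h d = \<top>\<^bsub>fib P Z\<^esub>"
  unfolding leibniz_equality_def by (simp add: Let_def)

lemma leibniz_subst:
  "\<lbrakk>leibniz_equality P A W p q d; is_product C X A (V, s, t); X \<in> Obj C; Z \<in> Obj C;
    u \<in> Hom C Z V; u' \<in> Hom C Z V; w \<in> Hom C Z W; \<beta> \<in> carrier (fib P V);
    Cmp C Z V X s u = Cmp C Z V X s u';
    Cmp C Z V A t u = Cmp C Z W A p w; Cmp C Z V A t u' = Cmp C Z W A q w\<rbrakk>
    \<Longrightarrow> act P Z V u \<beta> \<sqinter>\<^bsub>fib P Z\<^esub> act P Z W w d \<sqsubseteq>\<^bsub>fib P Z\<^esub> act P Z V u' \<beta>"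
  unfolding leibniz_equality_def Let_def by blast

text \<open>
  Substitution yields both counits. In the parametrized case \<open>\<beta>(x, a, a)\<close> and \<open>d(a, a')\<close> give
  \<open>\<beta>(x, a, a')\<close> when \<open>a\<close> is replaced in the last variable only, the parameter being \<open>(x, a)\<close>.
\<close>

lemma leibniz_imp_is_equality:
  assumes A: "A \<in> Obj C" and d: "leibniz_equality P A (prd C A A) (pr1 C A A) (pr2 C A A) d"
  shows "is_equality P A d"
proof -
  note bp = binary_products
  note AA = chosen_product[OF bp A A] and dA = leibniz_closed[OF d]
  note AAo = product_cone[OF AA]
  have "left_adjoint (fib P A) (fib P (prd C A A))
      (\<lambda>\<alpha>. act P (prd C A A) A (pr1 C A A) \<alpha> \<sqinter>\<^bsub>fib P (prd C A A)\<^esub> d)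
      (act P A (prd C A A) (diagonal C A))"
  proof (rule left_adjoint_of_section)
    note diag = pairing[OF bp A A A Id_closed[OF A] Id_closed[OF A], folded diagonal_def]
    show "diagonal C A \<in> Hom C A (prd C A A)"
      "Cmp C A (prd C A A) A (pr1 C A A) (diagonal C A) = Id C A"
      by (rule diag)+
    show "act P A (prd C A A) (diagonal C A) d = \<top>\<^bsub>fib P A\<^esub>"
      using diag A by (intro leibniz_refl[OF d]) auto
    fix \<beta> assume b: "\<beta> \<in> carrier (fib P (prd C A A))"
    have "act P (prd C A A) (prd C A A) (Cmp C (prd C A A) A (prd C A A) (diagonal C A) (pr1 C A A)) \<beta>
        \<sqinter>\<^bsub>fib P (prd C A A)\<^esub> act P (prd C A A) (prd C A A) (Id C (prd C A A)) d
      \<sqsubseteq>\<^bsub>fib P (prd C A A)\<^esub> act P (prd C A A) (prd C A A) (Id C (prd C A A)) \<beta>"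
    proof (rule leibniz_subst[OF d AA])
      show "Cmp C (prd C A A) (prd C A A) A (pr1 C A A) (Cmp C (prd C A A) A (prd C A A) (diagonal C A) (pr1 C A A))
          = Cmp C (prd C A A) (prd C A A) A (pr1 C A A) (Id C (prd C A A))"
        "Cmp C (prd C A A) (prd C A A) A (pr2 C A A) (Cmp C (prd C A A) A (prd C A A) (diagonal C A) (pr1 C A A))
          = Cmp C (prd C A A) (prd C A A) A (pr1 C A A) (Id C (prd C A A))"
        using A AAo diag by (simp_all add: Cmp_assoc[symmetric] Cmp_Id_left Cmp_Id_right)
    qed (use A AAo diag b in \<open>auto intro: Cmp_closed Id_closed\<close>)
    then show "act P (prd C A A) (prd C A A) (Cmp C (prd C A A) A (prd C A A) (diagonal C A) (pr1 C A A)) \<beta>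
        \<sqinter>\<^bsub>fib P (prd C A A)\<^esub> d \<sqsubseteq>\<^bsub>fib P (prd C A A)\<^esub> \<beta>"
      using b dA AAo by (simp add: act_Id)
  qed (use A AAo dA in auto)
  moreover
  have "left_adjoint (fib P XA) (fib P XAA)
        (\<lambda>\<alpha>. act P XAA XA (pairing C XAA X A p1 p2) \<alpha>
            \<sqinter>\<^bsub>fib P XAA\<^esub> act P XAA (prd C A A) (pairing C XAA A A p2 p3) d)
        (act P XA XAA e)"
    if X: "X \<in> Obj C" and XA_def: "XA = prd C X A" and XAA_def: "XAA = prd3 C X A A"
      and p1_def: "p1 = pr13 C X A A" and p2_def: "p2 = pr23 C X A A" and p3_def: "p3 = pr33 C X A A"
      and e_def: "e = pairing C XA XA A
              (pairing C XA X A (pr1 C X A) (pr2 C X A)) (pr2 C X A)" for X XA XAA p1 p2 p3 e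
  proof -
    have XA: "is_product C X A (XA, pr1 C X A, pr2 C X A)"
      unfolding XA_def by (rule chosen_product[OF bp X A])
    note XAo = product_cone[OF XA]
    have XAA: "is_product C XA A (XAA, pr1 C XA A, pr2 C XA A)"
      unfolding XAA_def prd3_def XA_def[symmetric] by (rule chosen_product[OF bp XAo(1) A])
    note XAAo = product_cone[OF XAA]
    have p: "p1 = Cmp C XAA XA X (pr1 C X A) (pr1 C XA A)"
       "p2 = Cmp C XAA XA A (pr2 C X A) (pr1 C XA A)" "p3 = pr2 C XA A"
      unfolding p1_def p2_def p3_def pr13_def pr23_def pr33_def XA_def XAA_def by simp_all
    have ph: "p1 \<in> Hom C XAA X" "p2 \<in> Hom C XAA A" "p3 \<in> Hom C XAA A"
      unfolding p using XAo XAAo X A by (auto intro: Cmp_closed)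
    have idXA: "pairing C XA X A (pr1 C X A) (pr2 C X A) = Id C XA"
      using pairing[OF bp X A XAo(1-3), folded XA_def] XAo X A
      by - (rule product_eqI[OF XA X A XAo(1)]; auto intro: Id_closed simp: Cmp_Id_right)
    have k: "pairing C XAA X A p1 p2 = pr1 C XA A"
      using pairing[OF bp X A XAAo(1) ph(1,2), folded XA_def] XAAo
      by - (rule product_eqI[OF XA X A XAAo(1)]; auto simp: p)
    note e = pairing[OF bp XAo(1) A XAo(1) Id_closed[OF XAo(1)] XAo(3), folded idXA, folded e_def,
        unfolded XA_def[symmetric], folded prd3_def[of C X A A, folded XA_def], folded XAA_def]
    have e': "e \<in> Hom C XA XAA" "Cmp C XA XAA XA (pr1 C XA A) e = Id C XA"
        "Cmp C XA XAA A (pr2 C XA A) e = pr2 C X A"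
      using e idXA by (simp_all add: XAA_def prd3_def XA_def)
    note w = pairing[OF bp A A XAAo(1) ph(2,3)]
    have p2e: "Cmp C XA XAA A p2 e = pr2 C X A"
      unfolding p using e' XAo XAAo X A by (simp add: Cmp_assoc Cmp_Id_right)
    have p1e: "Cmp C XA XAA X p1 e = pr1 C X A"
      unfolding p using e' XAo XAAo X A by (simp add: Cmp_assoc Cmp_Id_right)
    let ?w = "pairing C XAA A A p2 p3"
    show ?thesis unfolding k
    proof (rule left_adjoint_of_section)
      show "act P XAA (prd C A A) ?w d \<in> carrier (fib P XAA)"
        using w XAAo AAo dA by (auto intro: act_closed)
      have "act P XA XAA e (act P XAA (prd C A A) ?w d) = act P XA (prd C A A) (Cmp C XA XAA (prd C A A) ?w e) d"
        using w e' XAo XAAo AAo dA by (simp add: act_Cmp)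
      also have "\<dots> = \<top>\<^bsub>fib P XA\<^esub>"
        using w e' XAo XAAo AAo A p2e
        by (intro leibniz_refl[OF d]) (auto intro: Cmp_closed simp: Cmp_assoc[symmetric], auto simp: p)
      finally show "act P XA XAA e (act P XAA (prd C A A) ?w d) = \<top>\<^bsub>fib P XA\<^esub>" .
      fix \<beta> assume b: "\<beta> \<in> carrier (fib P XAA)"
      let ?u = "Cmp C XAA XA XAA e (pr1 C XA A)"
      \<comment> \<open>In variables: \<open>\<beta>(x, a, a)\<close> and \<open>d(a, a')\<close> imply \<open>\<beta>(x, a, a')\<close>.\<close>
      have "act P XAA XAA ?u \<beta> \<sqinter>\<^bsub>fib P XAA\<^esub> act P XAA (prd C A A) ?w d
          \<sqsubseteq>\<^bsub>fib P XAA\<^esub> act P XAA XAA (Id C XAA) \<beta>"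
      proof (rule leibniz_subst[OF d XAA])
        show "Cmp C XAA XAA XA (pr1 C XA A) ?u = Cmp C XAA XAA XA (pr1 C XA A) (Id C XAA)"
          using XAo XAAo A e' by (simp add: Cmp_assoc[symmetric] Cmp_Id_left Cmp_Id_right)
        show "Cmp C XAA XAA A (pr2 C XA A) ?u = Cmp C XAA (prd C A A) A (pr1 C A A) ?w"
          using XAo XAAo A e' w by (simp add: Cmp_assoc[symmetric] p)
        show "Cmp C XAA XAA A (pr2 C XA A) (Id C XAA) = Cmp C XAA (prd C A A) A (pr2 C A A) ?w"
          using XAo XAAo A w by (simp add: Cmp_Id_right p)
      qed (use XAo XAAo A e' w b in \<open>auto intro: Cmp_closed Id_closed\<close>)
      then show "act P XAA XAA ?u \<beta> \<sqinter>\<^bsub>fib P XAA\<^esub> act P XAA (prd C A A) ?w d \<sqsubseteq>\<^bsub>fib P XAA\<^esub> \<beta>"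
        using b XAAo by (simp add: act_Id)
    qed (use XAo XAAo e' in auto)
  qed
  ultimately show ?thesis
    unfolding is_equality_def Let_def using dA by blast
qed

text \<open>
  By the first adjunction, \<open>d\<close> is the value at the top element of the left adjoint of reindexing
  along the diagonal, hence determined by that map.
\<close>

lemma is_equality_unique:
  assumes A: "A \<in> Obj C" and "is_equality P A d" "is_equality P A d'"
  shows "d = d'"
proof -
  note AAo = product_cone[OF chosen_product[OF binary_products A A]]
  let ?AA = "fib P (prd C A A)"
  interpret AA: meet_semilattice ?AA using AAo(1) by (rule fib_semilattice)
  interpret A: meet_semilattice "fib P A" using A by (rule fib_semilattice)
  have *: "x \<in> carrier ?AA \<and> (\<forall>\<beta>\<in>carrier ?AA.
      x \<sqsubseteq>\<^bsub>?AA\<^esub> \<beta> \<longleftrightarrow> \<top>\<^bsub>fib P A\<^esub> \<sqsubseteq>\<^bsub>fib P A\<^esub> act P A (prd C A A) (diagonal C A) \<beta>)"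
    if "is_equality P A x" for x
  proof -
    have x: "x \<in> carrier ?AA"
      using that unfolding is_equality_def Let_def by blast
    then have "act P (prd C A A) A (pr1 C A A) \<top>\<^bsub>fib P A\<^esub> \<sqinter>\<^bsub>?AA\<^esub> x = x"
      using A AAo by (intro AA.meet_eqI) (auto simp: act_top)
    moreover have "left_adjoint (fib P A) ?AA
      (\<lambda>\<alpha>. act P (prd C A A) A (pr1 C A A) \<alpha> \<sqinter>\<^bsub>?AA\<^esub> x) (act P A (prd C A A) (diagonal C A))"
      using that unfolding is_equality_def Let_def by blast
    ultimately show ?thesis
      using x galois_connection.galois_property[of "\<lparr>orderA = fib P A, orderB = ?AA,
        lower = \<lambda>\<alpha>. act P (prd C A A) A (pr1 C A A) \<alpha> \<sqinter>\<^bsub>?AA\<^esub> x,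
        upper = act P A (prd C A A) (diagonal C A)\<rparr>" "\<top>\<^bsub>fib P A\<^esub>"]
      unfolding left_adjoint_def by auto
  qed
  from *[OF assms(2)] *[OF assms(3)] show ?thesis
    by (meson AA.le_antisym AA.le_refl)
qed

text \<open>
  Starting from \<open>d'(a, a)\<close>, which is the top element, a substitution along \<open>d(a, a')\<close> gives
  \<open>d'(a, a')\<close>; so \<open>d \<le> d'\<close>, and conversely.
\<close>

lemma leibniz_unique:
  assumes W: "is_product C A A (W, p, q)" and A: "A \<in> Obj C"
    and "leibniz_equality P A W p q d" "leibniz_equality P A W p q d'"
  shows "d = d'"
proof -
  note Wo = product_cone[OF W]
  interpret W: meet_semilattice "fib P W" using Wo(1) by (rule fib_semilattice)
  \<comment> \<open>\<open>u\<close> is \<open>(a, a') \<mapsto> (a, a)\<close>.\<close>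
  obtain u where u: "u \<in> Hom C W W" "Cmp C W W A p u = p" "Cmp C W W A q u = p"
    using product_pair[OF W Wo(1) Wo(2) Wo(2)] by blast
  have "x \<sqsubseteq>\<^bsub>fib P W\<^esub> y" if x: "leibniz_equality P A W p q x" and y: "leibniz_equality P A W p q y" for x y
  proof -
    note c = leibniz_closed[OF x] leibniz_closed[OF y]
    have "act P W W u y \<sqinter>\<^bsub>fib P W\<^esub> act P W W (Id C W) x \<sqsubseteq>\<^bsub>fib P W\<^esub> act P W W (Id C W) y"
      using u Wo A c by (intro leibniz_subst[OF x W]) (auto intro: Id_closed simp: Cmp_Id_right)
    moreover have "act P W W u y = \<top>\<^bsub>fib P W\<^esub>"
      using u Wo by (intro leibniz_refl[OF y]) auto
    moreover have "\<top>\<^bsub>fib P W\<^esub> \<sqinter>\<^bsub>fib P W\<^esub> x = x"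
      using c by (intro W.meet_eqI) auto
    ultimately show ?thesis using c Wo by (simp add: act_Id)
  qed
  then show ?thesis
    using assms leibniz_closed by (meson W.le_antisym)
qed

text \<open>
  Both clauses speak about generalized elements of the product diagram only through their
  components, and the comparison arrow \<open>h\<close> preserves components.
\<close>

lemma leibniz_reindex:
  assumes A: "A \<in> Obj C" and W: "is_product C A A (W, p, q)" and W': "is_product C A A (W', p', q')"
    and h: "h \<in> Hom C W' W" "Cmp C W' W A p h = p'" "Cmp C W' W A q h = q'"
    and d: "leibniz_equality P A W p q d"
  shows "leibniz_equality P A W' p' q' (act P W' W h d)"
  unfolding leibniz_equality_def Let_def
proof (intro conjI ballI allI impI)
  note Wo = product_cone[OF W] and Wo' = product_cone[OF W'] and dc = leibniz_closed[OF d]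
  show "act P W' W h d \<in> carrier (fib P W')"
    using Wo Wo' h dc by (auto intro: act_closed)
  {
    fix Z k assume "Z \<in> Obj C" "k \<in> Hom C Z W'" "Cmp C Z W' A p' k = Cmp C Z W' A q' k"
    then show "act P Z W' k (act P W' W h d) = \<top>\<^bsub>fib P Z\<^esub>"
      using Wo Wo' h dc A leibniz_refl[OF d, of Z "Cmp C Z W' W h k"]
      by (simp add: act_Cmp Cmp_closed Cmp_assoc[symmetric])
  }
  fix X V s t Z u u' w \<beta>
  assume "X \<in> Obj C" and V: "is_product C X A (V, s, t)" and "Z \<in> Obj C" "u \<in> Hom C Z V"
    "u' \<in> Hom C Z V" "w \<in> Hom C Z W'" "\<beta> \<in> carrier (fib P V)" "Cmp C Z V X s u = Cmp C Z V X s u'"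
    "Cmp C Z V A t u = Cmp C Z W' A p' w" "Cmp C Z V A t u' = Cmp C Z W' A q' w"
  then show "act P Z V u \<beta> \<sqinter>\<^bsub>fib P Z\<^esub> act P Z W' w (act P W' W h d) \<sqsubseteq>\<^bsub>fib P Z\<^esub> act P Z V u' \<beta>"
    using Wo Wo' h dc A leibniz_subst[OF d V, of Z u u' "Cmp C Z W' W h w"] product_cone[OF V]
    by (simp add: act_Cmp Cmp_closed Cmp_assoc[symmetric])
qed

lemma \<delta>_eqI:
  assumes "A \<in> Obj C" "is_equality P A d"
  shows "\<delta> P A = d"
  unfolding \<delta>_def using assms is_equality_unique by blast

end

text \<open>
  Equality is required over every product diagram, not just the chosen one: the image of a chosen
  product under a renaming of objects is a product, but need not be the chosen one.
\<close>

locale leibniz_doctrine = semilattice_doctrine +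
  assumes leibniz_exists: "\<lbrakk>A \<in> Obj C; is_product C A A (W, p, q)\<rbrakk> \<Longrightarrow> \<exists>d. leibniz_equality P A W p q d"
begin

lemma leibniz_\<delta>:
  assumes "A \<in> Obj C"
  shows "leibniz_equality P A (prd C A A) (pr1 C A A) (pr2 C A A) (\<delta> P A)"
  using assms leibniz_exists[OF assms chosen_product[OF binary_products assms assms]]
    \<delta>_eqI leibniz_imp_is_equality by blast

lemma elementary: "elementary_doctrine P"
  unfolding elementary_doctrine_def
  using is_doctrine leibniz_exists chosen_product binary_products leibniz_imp_is_equality by blast

end

section \<open>Categories and doctrines up to renaming of objects\<close>

text \<open>
  An equivalence of categories that is surjective on objects and literally the identity on arrows:
  \<open>C\<close> arises from \<open>D\<close> by giving each object one or several names.
\<close>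

definition relabels :: "('o, 'a) cat \<Rightarrow> ('o \<Rightarrow> 'p) \<Rightarrow> ('p, 'a) cat \<Rightarrow> bool" where
  "relabels C s D \<longleftrightarrow> s ` Obj C = Obj D \<and>
    (\<forall>X\<in>Obj C. Id C X = Id D (s X)) \<and>
    (\<forall>X\<in>Obj C. \<forall>Y\<in>Obj C. Hom C X Y = Hom D (s X) (s Y)) \<and>
    (\<forall>X\<in>Obj C. \<forall>Y\<in>Obj C. \<forall>Z\<in>Obj C. \<forall>f\<in>Hom C X Y. \<forall>g\<in>Hom C Y Z.
      Cmp C X Y Z g f = Cmp D (s X) (s Y) (s Z) g f)"

locale relabeling = target: category D
  for C :: "('o, 'a) cat" and s :: "'o \<Rightarrow> 'p" and D :: "('p, 'a) cat" +
  assumes relabels: "relabels C s D"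
begin

lemma obj_image: "s ` Obj C = Obj D"
  using relabels unfolding relabels_def by simp

lemma obj: "X \<in> Obj C \<Longrightarrow> s X \<in> Obj D"
  unfolding obj_image[symmetric] by (rule imageI)

lemma obj_surj:
  assumes "X' \<in> Obj D"
  obtains X where "X \<in> Obj C" "s X = X'"
  using assms that unfolding obj_image[symmetric] by (metis imageE)

text \<open>
  The bridge for all universal properties below, since it turns quantification over objects of \<open>D\<close>
  into quantification over their names.
\<close>

lemma all_obj: "(\<forall>X'\<in>Obj D. Q X') \<longleftrightarrow> (\<forall>X\<in>Obj C. Q (s X))"
  using obj obj_surj by metis

lemma id: "X \<in> Obj C \<Longrightarrow> Id C X = Id D (s X)"
  using relabels unfolding relabels_def by blast

lemma hom: "\<lbrakk>X \<in> Obj C; Y \<in> Obj C\<rbrakk> \<Longrightarrow> Hom C X Y = Hom D (s X) (s Y)"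
  using relabels unfolding relabels_def by blast

lemma cmp:
  "\<lbrakk>X \<in> Obj C; Y \<in> Obj C; Z \<in> Obj C; f \<in> Hom D (s X) (s Y); g \<in> Hom D (s Y) (s Z)\<rbrakk> \<Longrightarrow>
    Cmp C X Y Z g f = Cmp D (s X) (s Y) (s Z) g f"
  using relabels unfolding relabels_def by metis

lemma source_category: "category C"
  by unfold_locales
    (simp_all add: obj hom id cmp target.Id_closed target.Cmp_closed target.Cmp_Id_right
      target.Cmp_Id_left target.Cmp_assoc)

text \<open>
  A product diagram is tested against all objects only through their hom-sets, and these coincide.
\<close>

lemma is_product_iff:
  assumes "A \<in> Obj C" "B \<in> Obj C" "W \<in> Obj C"
  shows "is_product C A B (W, p, q) \<longleftrightarrow> is_product D (s A) (s B) (s W, p, q)"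
  using assms unfolding is_product_def
  by (simp add: hom obj all_obj cmp cong: conj_cong)

lemma is_mono_iff:
  assumes "X \<in> Obj C" "Y \<in> Obj C"
  shows "is_mono C X Y m \<longleftrightarrow> is_mono D (s X) (s Y) m"
  using assms unfolding is_mono_def by (simp add: hom all_obj cmp cong: conj_cong)

lemma slice_le_iff:
  assumes "A \<in> Obj C" "X \<in> Obj C" "Y \<in> Obj C" "g \<in> Hom D (s Y) (s A)"
  shows "slice_le C A (X, f) (Y, g) \<longleftrightarrow> slice_le D (s A) (s X, f) (s Y, g)"
  using assms unfolding slice_le_def by (simp add: hom cmp)

lemma is_pullback_iff:
  assumes "A \<in> Obj C" "B \<in> Obj C" "E \<in> Obj C" "W \<in> Obj C" "f \<in> Hom D (s A) (s E)" "g \<in> Hom D (s B) (s E)"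
  shows "is_pullback C A B E f g W p q \<longleftrightarrow> is_pullback D (s A) (s B) (s E) f g (s W) p q"
  using assms unfolding is_pullback_def by (simp add: hom obj all_obj cmp cong: conj_cong)

lemma binary_products:
  assumes "has_binary_products D"
  shows "has_binary_products C"
  unfolding has_binary_products_def
proof (intro ballI)
  fix A B assume AB: "A \<in> Obj C" "B \<in> Obj C"
  obtain W p q where W: "is_product D (s A) (s B) (W, p, q)"
    using assms AB obj unfolding has_binary_products_def by (metis prod_cases3)
  then obtain V where "V \<in> Obj C" "s V = W"
    using obj_surj target.product_cone(1) by metis
  then show "\<exists>w. is_product C A B w"
    using W is_product_iff AB by blast
qed

end

definition order_isomorphism :: "'p gorder \<Rightarrow> 'q gorder \<Rightarrow> ('p \<Rightarrow> 'q) \<Rightarrow> bool" where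
  "order_isomorphism L M h \<longleftrightarrow> eq L = (=) \<and> bij_betw h (carrier L) (carrier M) \<and>
    (\<forall>x\<in>carrier L. \<forall>y\<in>carrier L. x \<sqsubseteq>\<^bsub>L\<^esub> y \<longleftrightarrow> h x \<sqsubseteq>\<^bsub>M\<^esub> h y)"

locale semilattice_isomorphism = target: meet_semilattice M
  for L :: "'p gorder" and M :: "'q gorder" and h +
  assumes iso: "order_isomorphism L M h"
begin

lemma bij: "bij_betw h (carrier L) (carrier M)"
  using iso unfolding order_isomorphism_def by simp

lemma closed: "x \<in> carrier L \<Longrightarrow> h x \<in> carrier M"
  using bij by (rule bij_betwE[THEN bspec])

lemma inj: "\<lbrakk>x \<in> carrier L; y \<in> carrier L; h x = h y\<rbrakk> \<Longrightarrow> x = y"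
  using bij_betw_imp_inj_on[OF bij] by (simp add: inj_on_eq_iff)

lemma surj: "y \<in> carrier M \<Longrightarrow> \<exists>x\<in>carrier L. h x = y"
  using bij_betw_imp_surj_on[OF bij] by (metis imageE)

lemma le_iff: "\<lbrakk>x \<in> carrier L; y \<in> carrier L\<rbrakk> \<Longrightarrow> x \<sqsubseteq>\<^bsub>L\<^esub> y \<longleftrightarrow> h x \<sqsubseteq>\<^bsub>M\<^esub> h y"
  using iso unfolding order_isomorphism_def by simp

sublocale source: meet_semilattice L
proof
  show "inf_semilattice L"
  proof (rule inf_semilatticeI)
    show "eq L = (=)"
      using iso unfolding order_isomorphism_def by simp
    show "x \<sqsubseteq>\<^bsub>L\<^esub> x" if "x \<in> carrier L" for x
      using that by (simp add: le_iff closed)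
    show "x = y" if "x \<in> carrier L" "y \<in> carrier L" "x \<sqsubseteq>\<^bsub>L\<^esub> y" "y \<sqsubseteq>\<^bsub>L\<^esub> x" for x y
      using that by (simp add: le_iff closed inj target.le_antisym)
    show "x \<sqsubseteq>\<^bsub>L\<^esub> z" if "x \<in> carrier L" "y \<in> carrier L" "z \<in> carrier L" "x \<sqsubseteq>\<^bsub>L\<^esub> y" "y \<sqsubseteq>\<^bsub>L\<^esub> z" for x y z
      using that by (meson le_iff closed target.le_trans)
    show "\<exists>m\<in>carrier L. m \<sqsubseteq>\<^bsub>L\<^esub> x \<and> m \<sqsubseteq>\<^bsub>L\<^esub> y \<and>
        (\<forall>z\<in>carrier L. z \<sqsubseteq>\<^bsub>L\<^esub> x \<longrightarrow> z \<sqsubseteq>\<^bsub>L\<^esub> y \<longrightarrow> z \<sqsubseteq>\<^bsub>L\<^esub> m)"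
      if xy: "x \<in> carrier L" "y \<in> carrier L" for x y
    proof -
      obtain m where "m \<in> carrier L" "h m = h x \<sqinter>\<^bsub>M\<^esub> h y"
        using surj[OF target.meet_closed[OF closed closed]] xy by blast
      then show ?thesis
        using xy by (intro bexI[of _ m]) (auto simp: le_iff closed target.meet_left target.meet_right target.meet_le)
    qed
    show "\<exists>t\<in>carrier L. \<forall>x\<in>carrier L. x \<sqsubseteq>\<^bsub>L\<^esub> t"
    proof -
      obtain t where "t \<in> carrier L" "h t = \<top>\<^bsub>M\<^esub>"
        using surj[OF target.top_closed] by blast
      then show ?thesis
        by (intro bexI[of _ t]) (auto simp: le_iff closed)
    qed
  qed
qed

lemma meet: "\<lbrakk>x \<in> carrier L; y \<in> carrier L\<rbrakk> \<Longrightarrow> h (x \<sqinter>\<^bsub>L\<^esub> y) = h x \<sqinter>\<^bsub>M\<^esub> h y"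
proof -
  assume xy: "x \<in> carrier L" "y \<in> carrier L"
  have "z \<sqsubseteq>\<^bsub>M\<^esub> h (x \<sqinter>\<^bsub>L\<^esub> y)" if zM: "z \<in> carrier M" and "z \<sqsubseteq>\<^bsub>M\<^esub> h x" "z \<sqsubseteq>\<^bsub>M\<^esub> h y" for z
  proof -
    obtain x' where "x' \<in> carrier L" "h x' = z"
      using surj[OF zM] by blast
    then show ?thesis
      using that xy le_iff source.meet_le[of x' x y] source.meet_closed[of x y] by auto
  qed
  then show ?thesis
    using xy by (intro target.meet_eqI[symmetric])
      (auto simp: closed le_iff[symmetric] source.meet_left source.meet_right)
qed

lemma top: "h \<top>\<^bsub>L\<^esub> = \<top>\<^bsub>M\<^esub>"
proof (rule target.top_eqI[symmetric])
  show "h \<top>\<^bsub>L\<^esub> \<in> carrier M"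
    by (simp add: closed)
  show "y \<sqsubseteq>\<^bsub>M\<^esub> h \<top>\<^bsub>L\<^esub>" if yM: "y \<in> carrier M" for y
  proof -
    obtain x where "x \<in> carrier L" "h x = y"
      using surj[OF yM] by blast
    then show ?thesis
      using le_iff[of x "\<top>\<^bsub>L\<^esub>"] by simp
  qed
qed

end

definition doctrine_relabels ::
  "('o, 'a, 'p) doctrine \<Rightarrow> ('o \<Rightarrow> 'o2) \<Rightarrow> ('o \<Rightarrow> 'p \<Rightarrow> 'p2) \<Rightarrow> ('o2, 'a, 'p2) doctrine \<Rightarrow> bool" where
  "doctrine_relabels P s b R \<longleftrightarrow> (let C = base P in
    relabels C s (base R) \<and>
    (\<forall>A\<in>Obj C. order_isomorphism (fib P A) (fib R (s A)) (b A)) \<and>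
    (\<forall>A\<in>Obj C. \<forall>B\<in>Obj C. \<forall>f\<in>Hom C A B. \<forall>\<beta>\<in>carrier (fib P B).
      act P A B f \<beta> \<in> carrier (fib P A) \<and> b A (act P A B f \<beta>) = act R (s A) (s B) f (b B \<beta>)))"

locale doctrine_relabeling = target: leibniz_doctrine R
  for P :: "('o, 'a, 'p) doctrine" and s b and R :: "('o2, 'a, 'p2) doctrine" +
  assumes doctrine_relabels: "doctrine_relabels P s b R"
begin

sublocale relabeling "base P" s "base R"
  using doctrine_relabels unfolding doctrine_relabels_def by unfold_locales (simp add: Let_def)

lemma fib_iso: "A \<in> Obj (base P) \<Longrightarrow> semilattice_isomorphism (fib P A) (fib R (s A)) (b A)"
  using doctrine_relabels target.fib_semilattice[of "s A"] obj[of A]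
  unfolding doctrine_relabels_def semilattice_isomorphism_def semilattice_isomorphism_axioms_def
  by (simp add: Let_def)

lemma fib_act:
  "\<lbrakk>A \<in> Obj (base P); B \<in> Obj (base P); f \<in> Hom (base R) (s A) (s B); \<beta> \<in> carrier (fib P B)\<rbrakk> \<Longrightarrow>
    b A (act P A B f \<beta>) = act R (s A) (s B) f (b B \<beta>)"
  using doctrine_relabels hom unfolding doctrine_relabels_def by (simp add: Let_def)

lemma act_closed:
  "\<lbrakk>A \<in> Obj (base P); B \<in> Obj (base P); f \<in> Hom (base R) (s A) (s B); \<beta> \<in> carrier (fib P B)\<rbrakk> \<Longrightarrow>
    act P A B f \<beta> \<in> carrier (fib P A)"
  using doctrine_relabels hom unfolding doctrine_relabels_def by (simp add: Let_def)

lemma fib_closed: "\<lbrakk>A \<in> Obj (base P); \<alpha> \<in> carrier (fib P A)\<rbrakk> \<Longrightarrow> b A \<alpha> \<in> carrier (fib R (s A))"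
  using semilattice_isomorphism.closed[OF fib_iso] .

lemma fib_le_iff:
  "\<lbrakk>A \<in> Obj (base P); \<alpha> \<in> carrier (fib P A); \<beta> \<in> carrier (fib P A)\<rbrakk> \<Longrightarrow>
    \<alpha> \<sqsubseteq>\<^bsub>fib P A\<^esub> \<beta> \<longleftrightarrow> b A \<alpha> \<sqsubseteq>\<^bsub>fib R (s A)\<^esub> b A \<beta>"
  using semilattice_isomorphism.le_iff[OF fib_iso] .

lemma fib_inj:
  "\<lbrakk>A \<in> Obj (base P); \<alpha> \<in> carrier (fib P A); \<beta> \<in> carrier (fib P A); b A \<alpha> = b A \<beta>\<rbrakk> \<Longrightarrow> \<alpha> = \<beta>"
  using semilattice_isomorphism.inj[OF fib_iso] .

lemma fib_surj:
  "\<lbrakk>A \<in> Obj (base P); \<alpha>' \<in> carrier (fib R (s A))\<rbrakk> \<Longrightarrow> \<exists>\<alpha>\<in>carrier (fib P A). b A \<alpha> = \<alpha>'"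
  using semilattice_isomorphism.surj[OF fib_iso] .

lemma fib_meet:
  "\<lbrakk>A \<in> Obj (base P); \<alpha> \<in> carrier (fib P A); \<beta> \<in> carrier (fib P A)\<rbrakk> \<Longrightarrow>
    b A (\<alpha> \<sqinter>\<^bsub>fib P A\<^esub> \<beta>) = b A \<alpha> \<sqinter>\<^bsub>fib R (s A)\<^esub> b A \<beta>"
  using semilattice_isomorphism.meet[OF fib_iso] .

lemma fib_top: "A \<in> Obj (base P) \<Longrightarrow> b A \<top>\<^bsub>fib P A\<^esub> = \<top>\<^bsub>fib R (s A)\<^esub>"
  using semilattice_isomorphism.top[OF fib_iso] .

lemma source_fib: "A \<in> Obj (base P) \<Longrightarrow> meet_semilattice (fib P A)"
proof -
  assume "A \<in> Obj (base P)"
  then interpret semilattice_isomorphism "fib P A" "fib R (s A)" "b A" by (rule fib_iso)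
  show ?thesis by (rule source.meet_semilattice_axioms)
qed


sublocale source: semilattice_doctrine P
proof
  have hom_closed: "f \<in> Hom (base R) (s A) (s B)" if "A \<in> Obj (base P)" "B \<in> Obj (base P)" "f \<in> Hom (base P) A B" for A B f
    using that hom by simp
  have "inf_semilattice_hom (fib P B) (fib P A) (act P A B f)"
    if AB: "A \<in> Obj (base P)" "B \<in> Obj (base P)" and "f \<in> Hom (base P) A B" for A B f
  proof -
    interpret A: semilattice_isomorphism "fib P A" "fib R (s A)" "b A" using AB(1) by (rule fib_iso)
    interpret B: semilattice_isomorphism "fib P B" "fib R (s B)" "b B" using AB(2) by (rule fib_iso)
    have f: "f \<in> Hom (base R) (s A) (s B)"
      using that hom by simp
    note closed = act_closed[OF AB f]
    have "act P A B f \<top>\<^bsub>fib P B\<^esub> = \<top>\<^bsub>fib P A\<^esub>"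
      using AB f by (intro A.inj closed) (simp_all add: fib_act A.top B.top target.act_top obj)
    moreover have "act P A B f (x \<sqinter>\<^bsub>fib P B\<^esub> y) = act P A B f x \<sqinter>\<^bsub>fib P A\<^esub> act P A B f y"
      if "x \<in> carrier (fib P B)" "y \<in> carrier (fib P B)" for x y
      using AB f that
      by (intro A.inj closed A.source.meet_closed)
        (simp_all add: fib_act closed A.meet B.meet target.act_meet obj B.closed)
    ultimately show ?thesis
      unfolding inf_semilattice_hom_def using closed by blast
  qed
  moreover have "act P A A (Id (base P) A) \<alpha> = \<alpha>" if "A \<in> Obj (base P)" "\<alpha> \<in> carrier (fib P A)" for A \<alpha>
    using that obj
    by (intro fib_inj[OF that(1)] act_closed)
      (simp_all add: id fib_act target.Id_closed target.act_Id fib_closed)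
  moreover have "act P X Z (Cmp (base P) X Y Z g f) \<alpha> = act P X Y f (act P Y Z g \<alpha>)"
    if o: "X \<in> Obj (base P)" "Y \<in> Obj (base P)" "Z \<in> Obj (base P)"
      and "f \<in> Hom (base P) X Y" "g \<in> Hom (base P) Y Z" and \<alpha>: "\<alpha> \<in> carrier (fib P Z)" for X Y Z f g \<alpha>
  proof -
    have f: "f \<in> Hom (base R) (s X) (s Y)" and g: "g \<in> Hom (base R) (s Y) (s Z)"
      using that hom by simp_all
    have gf: "Cmp (base R) (s X) (s Y) (s Z) g f \<in> Hom (base R) (s X) (s Z)"
      using f g o by (auto intro: target.Cmp_closed obj)
    show ?thesis
      using o f g gf \<alpha>
      by (intro fib_inj[OF o(1)])
        (simp_all add: cmp fib_act act_closed target.act_Cmp fib_closed obj)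
  qed
  ultimately show "is_doctrine P"
    unfolding is_doctrine_def Let_def
    using source_category binary_products target.binary_products source_fib
    by (simp add: meet_semilattice_def)
qed

text \<open>
  The test objects \<open>Z\<close>, the product diagrams and the predicates \<open>\<beta>\<close> of \<open>P\<close> are all names of such data
  for \<open>R\<close>, so the two clauses for \<open>P\<close> are instances of those for \<open>R\<close>.
\<close>

lemma leibniz_transfer:
  assumes A: "A \<in> Obj (base P)" and W: "W \<in> Obj (base P)" and p: "p \<in> Hom (base R) (s W) (s A)"
    and q: "q \<in> Hom (base R) (s W) (s A)" and d: "d \<in> carrier (fib P W)"
    and eq: "leibniz_equality R (s A) (s W) p q (b W d)"
  shows "leibniz_equality P A W p q d"
  unfolding leibniz_equality_def Let_def
proof (intro conjI ballI allI impI d)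
  fix Z h assume Z: "Z \<in> Obj (base P)" and h: "h \<in> Hom (base P) Z W"
    and "Cmp (base P) Z W A p h = Cmp (base P) Z W A q h"
  then have "act R (s Z) (s W) h (b W d) = \<top>\<^bsub>fib R (s Z)\<^esub>"
    using A W p q by (intro target.leibniz_refl[OF eq]) (simp_all add: obj hom cmp)
  then show "act P Z W h d = \<top>\<^bsub>fib P Z\<^esub>"
    using Z W h d meet_semilattice.inf_semilattice[OF source_fib[OF Z]]
    by (intro fib_inj[OF Z] act_closed)
      (simp_all add: hom fib_act fib_top inf_semilattice_def weak_partial_order_top.top_closed)
next
  fix X V t t' Z u u' w \<beta>
  assume X: "X \<in> Obj (base P)" and V: "is_product (base P) X A (V, t, t')" and Z: "Z \<in> Obj (base P)"
    and "u \<in> Hom (base P) Z V" "u' \<in> Hom (base P) Z V" "w \<in> Hom (base P) Z W"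
    and \<beta>: "\<beta> \<in> carrier (fib P V)"
    and e: "Cmp (base P) Z V X t u = Cmp (base P) Z V X t u'"
      "Cmp (base P) Z V A t' u = Cmp (base P) Z W A p w"
      "Cmp (base P) Z V A t' u' = Cmp (base P) Z W A q w"
  have Vo: "V \<in> Obj (base P)"
    using V by (rule category.product_cone[OF source_category])
  have h: "u \<in> Hom (base R) (s Z) (s V)" "u' \<in> Hom (base R) (s Z) (s V)" "w \<in> Hom (base R) (s Z) (s W)"
    using \<open>u \<in> _\<close> \<open>u' \<in> _\<close> \<open>w \<in> _\<close> Z Vo W by (simp_all add: hom)
  have V': "is_product (base R) (s X) (s A) (s V, t, t')"
    using V X A Vo is_product_iff by blast
  note t = target.product_cone[OF V']
  have e': "Cmp (base R) (s Z) (s V) (s X) t u = Cmp (base R) (s Z) (s V) (s X) t u'"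
      "Cmp (base R) (s Z) (s V) (s A) t' u = Cmp (base R) (s Z) (s W) (s A) p w"
      "Cmp (base R) (s Z) (s V) (s A) t' u' = Cmp (base R) (s Z) (s W) (s A) q w"
    using e h t p q X Z Vo W A by (simp_all add: cmp)
  interpret Z: semilattice_isomorphism "fib P Z" "fib R (s Z)" "b Z" using Z by (rule fib_iso)
  have "act R (s Z) (s V) u (b V \<beta>) \<sqinter>\<^bsub>fib R (s Z)\<^esub> act R (s Z) (s W) w (b W d)
      \<sqsubseteq>\<^bsub>fib R (s Z)\<^esub> act R (s Z) (s V) u' (b V \<beta>)"
    by (rule target.leibniz_subst[OF eq V' _ _ h _ e']) (simp_all add: obj X Z fib_closed Vo \<beta>)
  then show "act P Z V u \<beta> \<sqinter>\<^bsub>fib P Z\<^esub> act P Z W w d \<sqsubseteq>\<^bsub>fib P Z\<^esub> act P Z V u' \<beta>"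
    using Z Vo W h \<beta> d by (simp add: Z.le_iff Z.meet fib_act act_closed)
qed

lemma leibniz_from_target:
  assumes "A \<in> Obj (base P)" and W: "is_product (base P) A A (W, p, q)"
  obtains d where "leibniz_equality P A W p q d" "leibniz_equality R (s A) (s W) p q (b W d)"
proof -
  note Wo = source.product_cone[OF W]
  have W': "is_product (base R) (s A) (s A) (s W, p, q)"
    using W assms(1) Wo is_product_iff by blast
  obtain d' where d': "leibniz_equality R (s A) (s W) p q d'"
    using target.leibniz_exists[OF _ W'] assms(1) obj by blast
  obtain d where d: "d \<in> carrier (fib P W)" "b W d = d'"
    using fib_surj[OF Wo(1) target.leibniz_closed[OF d']] by blast
  note W'o = target.product_cone[OF W']
  show thesis
    using that[of d] d d' leibniz_transfer[OF assms(1) Wo(1) W'o(2,3) d(1)] by blast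
qed

sublocale source: leibniz_doctrine P
  using leibniz_from_target by unfold_locales metis

lemma leibniz_preserved:
  assumes A: "A \<in> Obj (base P)" and W: "is_product (base P) A A (W, p, q)"
    and d: "leibniz_equality P A W p q d"
  shows "leibniz_equality R (s A) (s W) p q (b W d)"
proof -
  obtain d' where "leibniz_equality P A W p q d'" "leibniz_equality R (s A) (s W) p q (b W d')"
    using leibniz_from_target[OF A W] by blast
  then show ?thesis
    using source.leibniz_unique[OF W A d] by blast
qed

text \<open>
  A one-arrow that only exchanges the name of an object for another name of the same object is
  isomorphic to the identity; both components of the isomorphism are identity arrows.
\<close>

lemma isomorphic_one_arrows:
  assumes u: "\<And>A. A \<in> Obj (base P) \<Longrightarrow> u A \<in> Obj (base P) \<and> s (u A) = s A"
    and c: "\<And>A \<alpha>. \<lbrakk>A \<in> Obj (base P); \<alpha> \<in> carrier (fib P A)\<rbrakk> \<Longrightarrow>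
      c A \<alpha> \<in> carrier (fib P (u A)) \<and> b (u A) (c A \<alpha>) = b A \<alpha>"
    and \<Theta>: "\<Theta> = \<lparr>on_obj = u, on_arr = (\<lambda>A B f. f), on_fib = c\<rparr>"
  shows "ED_isomorphic_one_arrows P P identity_one_arrow \<Theta>"
    and "ED_isomorphic_one_arrows P P \<Theta> identity_one_arrow"
proof -
  note simps = hom obj id target.Id_closed cmp target.Cmp_Id_left target.Cmp_Id_right
    fib_le_iff act_closed fib_act target.act_Id fib_closed
  have refl: "\<alpha> \<sqsubseteq>\<^bsub>fib R (s A)\<^esub> \<alpha>" if "A \<in> Obj (base P)" "\<alpha> \<in> carrier (fib R (s A))" for A \<alpha>
  proof -
    interpret meet_semilattice "fib R (s A)" using that obj target.fib_semilattice by blast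
    show ?thesis using that by simp
  qed
  have 1: "ED_two_arrow P P identity_one_arrow \<Theta> (\<lambda>A. Id (base P) A)"
    unfolding ED_two_arrow_def natural_transformation_def identity_one_arrow_def \<Theta>
    using u c refl by (simp add: simps)
  have 2: "ED_two_arrow P P \<Theta> identity_one_arrow (\<lambda>A. Id (base P) A)"
    unfolding ED_two_arrow_def natural_transformation_def identity_one_arrow_def \<Theta>
    using u c refl by (simp add: simps)
  show "ED_isomorphic_one_arrows P P identity_one_arrow \<Theta>"
    "ED_isomorphic_one_arrows P P \<Theta> identity_one_arrow"
    unfolding ED_isomorphic_one_arrows_def
    using 1 2 u by (auto intro!: exI[of _ "\<lambda>A. Id (base P) A"]
        simp: identity_one_arrow_def \<Theta> simps)
qed

end

text \<open>
  Every object named by \<open>P\<close> has some name in \<open>P'\<close>, chosen as \<open>t\<close>, and the fibres are transported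
  through those of \<open>R\<close>. Equality predicates are preserved because both sides of the required equation
  are Leibniz equalities over the same product diagram.
\<close>

lemma one_arrow_between_relabelings:
  assumes P: "doctrine_relabeling P s b R" and P': "doctrine_relabeling P' s' b' R"
  obtains t c where
    "\<And>A. A \<in> Obj (base P) \<Longrightarrow> t A \<in> Obj (base P') \<and> s' (t A) = s A"
    "\<And>A \<alpha>. \<lbrakk>A \<in> Obj (base P); \<alpha> \<in> carrier (fib P A)\<rbrakk> \<Longrightarrow>
      c A \<alpha> \<in> carrier (fib P' (t A)) \<and> b' (t A) (c A \<alpha>) = b A \<alpha>"
    "ED_one_arrow P P' \<lparr>on_obj = t, on_arr = (\<lambda>A B f. f), on_fib = c\<rparr>"
proof -
  interpret P: doctrine_relabeling P s b R by (rule P)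
  interpret P': doctrine_relabeling P' s' b' R by (rule P')
  have "\<exists>A'\<in>Obj (base P'). s' A' = s A" if "A \<in> Obj (base P)" for A
    using P'.obj_surj[OF P.obj[OF that]] by blast
  then obtain t where t: "\<And>A. A \<in> Obj (base P) \<Longrightarrow> t A \<in> Obj (base P')"
      "\<And>A. A \<in> Obj (base P) \<Longrightarrow> s' (t A) = s A"
    by metis
  have "\<exists>\<alpha>'\<in>carrier (fib P' (t A)). b' (t A) \<alpha>' = b A \<alpha>"
    if "A \<in> Obj (base P)" "\<alpha> \<in> carrier (fib P A)" for A \<alpha>
    using P'.fib_surj[of "t A" "b A \<alpha>"] P.fib_closed[OF that] t that by simp
  then obtain c where c: "\<And>A \<alpha>. \<lbrakk>A \<in> Obj (base P); \<alpha> \<in> carrier (fib P A)\<rbrakk> \<Longrightarrow> c A \<alpha> \<in> carrier (fib P' (t A))"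
      "\<And>A \<alpha>. \<lbrakk>A \<in> Obj (base P); \<alpha> \<in> carrier (fib P A)\<rbrakk> \<Longrightarrow> b' (t A) (c A \<alpha>) = b A \<alpha>"
    by metis
  have prod: "is_product (base P') (t A) (t B) (t W, p, q)"
    if "A \<in> Obj (base P)" "B \<in> Obj (base P)" "is_product (base P) A B (W, p, q)" for A B W p q
    using that P.source.product_cone(1)[OF that(3)] t
    by (simp add: P.is_product_iff P'.is_product_iff)
  have "is_functor (base P) (base P') t (\<lambda>A B f. f)"
    unfolding is_functor_def by (simp add: t P.id P'.id P.hom P'.hom P.cmp P'.cmp)
  moreover have "inf_semilattice_hom (fib P A) (fib P' (t A)) (c A)" if A: "A \<in> Obj (base P)" for A
  proof -
    interpret A: semilattice_isomorphism "fib P A" "fib R (s A)" "b A"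
      using A by (rule P.fib_iso)
    interpret A': semilattice_isomorphism "fib P' (t A)" "fib R (s A)" "b' (t A)"
      using P'.fib_iso[OF t(1)[OF A]] t(2)[OF A] by simp
    show ?thesis
      unfolding inf_semilattice_hom_def
      using A by (auto intro!: A'.inj A'.source.meet_closed c simp: c A.top A'.top A.meet A'.meet)
  qed
  moreover have "c A (act P A B f \<beta>) = act P' (t A) (t B) f (c B \<beta>)"
    if "A \<in> Obj (base P)" "B \<in> Obj (base P)" "f \<in> Hom (base P) A B" "\<beta> \<in> carrier (fib P B)" for A B f \<beta>
    using that t
    by (intro P'.fib_inj[of "t A"] c P.act_closed P'.act_closed)
      (simp_all add: c P.hom P.act_closed P.fib_act P'.fib_act)
  moreover have "c (prd (base P) A A) (\<delta> P A) = act P' (t (prd (base P) A A)) (prd (base P') (t A) (t A))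
      (pairing (base P') (t (prd (base P) A A)) (t A) (t A) (pr1 (base P) A A) (pr2 (base P) A A)) (\<delta> P' (t A))"
    if A: "A \<in> Obj (base P)" for A
  proof -
    define W where "W = prd (base P) A A"
    let ?p = "pr1 (base P) A A" and ?q = "pr2 (base P) A A"
    have W: "is_product (base P) A A (W, ?p, ?q)"
      unfolding W_def using A P.source.chosen_product P.source.binary_products by blast
    note tW = prod[OF A A W]
    note bp = P'.source.binary_products
    note tWo = P'.source.product_cone[OF tW] and Wo = P.source.product_cone[OF W]
    have d: "leibniz_equality P A W ?p ?q (\<delta> P A)"
      unfolding W_def by (rule P.source.leibniz_\<delta>[OF A])
    then have "\<delta> P A \<in> carrier (fib P W)" by (rule P.source.leibniz_closed)
    note cW = c[OF Wo(1) this]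
    have "leibniz_equality P' (t A) (t W) ?p ?q (c W (\<delta> P A))"
      using P.leibniz_preserved[OF A W d] t(2)[OF A] t(2)[OF Wo(1)] cW tWo Wo A
      by (intro P'.leibniz_transfer[OF t(1)[OF A] tWo(1)]) (simp_all add: P.hom)
    moreover have "leibniz_equality P' (t A) (t W) ?p ?q (act P' (t W) (prd (base P') (t A) (t A))
      (pairing (base P') (t W) (t A) (t A) ?p ?q) (\<delta> P' (t A)))"
      by (rule P'.source.leibniz_reindex[OF t(1)[OF A] P'.source.chosen_product[OF bp t(1)[OF A] t(1)[OF A]] tW
            P'.source.pairing[OF bp t(1)[OF A] t(1)[OF A] tWo] P'.source.leibniz_\<delta>[OF t(1)[OF A]]])
    ultimately show ?thesis
      unfolding W_def[symmetric] by (rule P'.source.leibniz_unique[OF tW t(1)[OF A]])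
  qed
  ultimately have "ED_one_arrow P P' \<lparr>on_obj = t, on_arr = (\<lambda>A B f. f), on_fib = c\<rparr>"
    unfolding ED_one_arrow_def Let_def using prod by simp
  with t c that show thesis by blast
qed

text \<open>
  The one-arrows in the two directions compose to one-arrows that merely change names.
\<close>

lemma relabelings_equivalent:
  assumes "leibniz_doctrine R" and "doctrine_relabels P s b R" and "doctrine_relabels P' s' b' R"
  shows "ED_equivalent P P'"
proof -
  have P: "doctrine_relabeling P s b R" and P': "doctrine_relabeling P' s' b' R"
    using assms by (simp_all add: doctrine_relabeling_def doctrine_relabeling_axioms_def)
  interpret P: doctrine_relabeling P s b R by (rule P)
  interpret P': doctrine_relabeling P' s' b' R by (rule P')
  obtain t c where t: "\<And>A. A \<in> Obj (base P) \<Longrightarrow> t A \<in> Obj (base P') \<and> s' (t A) = s A"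
    and c: "\<And>A \<alpha>. \<lbrakk>A \<in> Obj (base P); \<alpha> \<in> carrier (fib P A)\<rbrakk> \<Longrightarrow>
      c A \<alpha> \<in> carrier (fib P' (t A)) \<and> b' (t A) (c A \<alpha>) = b A \<alpha>"
    and F: "ED_one_arrow P P' \<lparr>on_obj = t, on_arr = (\<lambda>A B f. f), on_fib = c\<rparr>"
    using one_arrow_between_relabelings[OF P P'] by blast
  obtain t' c' where t': "\<And>A. A \<in> Obj (base P') \<Longrightarrow> t' A \<in> Obj (base P) \<and> s (t' A) = s' A"
    and c': "\<And>A \<alpha>. \<lbrakk>A \<in> Obj (base P'); \<alpha> \<in> carrier (fib P' A)\<rbrakk> \<Longrightarrow>
      c' A \<alpha> \<in> carrier (fib P (t' A)) \<and> b (t' A) (c' A \<alpha>) = b' A \<alpha>"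
    and G: "ED_one_arrow P' P \<lparr>on_obj = t', on_arr = (\<lambda>A B f. f), on_fib = c'\<rparr>"
    using one_arrow_between_relabelings[OF P' P] by blast
  let ?F = "\<lparr>on_obj = t, on_arr = (\<lambda>A B f. f), on_fib = c\<rparr>"
  let ?G = "\<lparr>on_obj = t', on_arr = (\<lambda>A B f. f), on_fib = c'\<rparr>"
  have "ED_isomorphic_one_arrows P P identity_one_arrow (compose_one_arrow ?G ?F)"
    using t c t' c'
    by (intro P.isomorphic_one_arrows(1)[of "\<lambda>A. t' (t A)" "\<lambda>A \<alpha>. c' (t A) (c A \<alpha>)"])
      (simp_all add: compose_one_arrow_def)
  moreover have "ED_isomorphic_one_arrows P' P' (compose_one_arrow ?F ?G) identity_one_arrow"
    using t c t' c'
    by (intro P'.isomorphic_one_arrows(2)[of "\<lambda>A. t (t' A)" "\<lambda>A \<alpha>. c (t' A) (c' A \<alpha>)"])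
      (simp_all add: compose_one_arrow_def)
  ultimately show ?thesis
    unfolding ED_equivalent_def using P.source.elementary P'.source.elementary F G by blast
qed

section \<open>Principal sieves\<close>

definition subset_order :: "'x set set \<Rightarrow> 'x set gorder" where
  "subset_order K = \<lparr>carrier = K, eq = (=), le = (\<subseteq>)\<rparr>"

lemma subset_order_simps [simp]:
  "carrier (subset_order K) = K" "eq (subset_order K) = (=)" "x \<sqsubseteq>\<^bsub>subset_order K\<^esub> y \<longleftrightarrow> x \<subseteq> y"
  by (simp_all add: subset_order_def)

text \<open>
  All fibres of the doctrines of sieves below have this form, with meets computed as intersections.
\<close>

lemma subset_order_semilattice:
  assumes "\<And>x y. \<lbrakk>x \<in> K; y \<in> K\<rbrakk> \<Longrightarrow> x \<inter> y \<in> K" and "T \<in> K" "\<And>x. x \<in> K \<Longrightarrow> x \<subseteq> T"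
  shows "inf_semilattice (subset_order K)"
    and "\<top>\<^bsub>subset_order K\<^esub> = T"
    and "\<lbrakk>x \<in> K; y \<in> K\<rbrakk> \<Longrightarrow> x \<sqinter>\<^bsub>subset_order K\<^esub> y = x \<inter> y"
proof -
  show L: "inf_semilattice (subset_order K)"
  proof (rule inf_semilatticeI)
    show "\<exists>m\<in>carrier (subset_order K). m \<sqsubseteq>\<^bsub>subset_order K\<^esub> x \<and> m \<sqsubseteq>\<^bsub>subset_order K\<^esub> y \<and>
      (\<forall>z\<in>carrier (subset_order K). z \<sqsubseteq>\<^bsub>subset_order K\<^esub> x \<longrightarrow> z \<sqsubseteq>\<^bsub>subset_order K\<^esub> y \<longrightarrow> z \<sqsubseteq>\<^bsub>subset_order K\<^esub> m)"
      if "x \<in> carrier (subset_order K)" "y \<in> carrier (subset_order K)" for x y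
      using that assms(1)[of x y] by (intro bexI[of _ "x \<inter> y"]) auto
    show "\<exists>t\<in>carrier (subset_order K). \<forall>x\<in>carrier (subset_order K). x \<sqsubseteq>\<^bsub>subset_order K\<^esub> t"
      using assms(2,3) by auto
  qed auto
  then interpret meet_semilattice "subset_order K" by unfold_locales
  show "\<top>\<^bsub>subset_order K\<^esub> = T"
    using assms by (intro top_eqI) auto
  show "x \<sqinter>\<^bsub>subset_order K\<^esub> y = x \<inter> y" if "x \<in> K" "y \<in> K"
    using assms that by (intro meet_eqI) auto
qed

definition generated_sieve :: "('o, 'a) cat \<Rightarrow> 'o \<Rightarrow> 'o \<Rightarrow> 'a \<Rightarrow> ('o \<times> 'a) set" where
  "generated_sieve C A X x = {(U, a). U \<in> Obj C \<and> (\<exists>h\<in>Hom C U X. Cmp C U X A x h = a)}"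

definition principal_sieves :: "('o, 'a) cat \<Rightarrow> 'o \<Rightarrow> ('o \<times> 'a) set set" where
  "principal_sieves C A = {\<phi>. \<exists>X\<in>Obj C. \<exists>x\<in>Hom C X A. \<phi> = generated_sieve C A X x}"

definition reindex :: "('o, 'a) cat \<Rightarrow> 'o \<Rightarrow> 'o \<Rightarrow> 'a \<Rightarrow> ('o \<times> 'a) set \<Rightarrow> ('o \<times> 'a) set" where
  "reindex C A B f \<phi> = {(U, a). U \<in> Obj C \<and> a \<in> Hom C U A \<and> (U, Cmp C U A B f a) \<in> \<phi>}"

lemma mem_slice_objs: "(U, a) \<in> slice_objs C A \<longleftrightarrow> U \<in> Obj C \<and> a \<in> Hom C U A"
  by (simp add: slice_objs_def)

lemma mem_reindex:
  "(U, a) \<in> reindex C A B f \<phi> \<longleftrightarrow> U \<in> Obj C \<and> a \<in> Hom C U A \<and> (U, Cmp C U A B f a) \<in> \<phi>"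
  by (simp add: reindex_def)

lemma mem_generated_sieve:
  "(U, a) \<in> generated_sieve C A X x \<longleftrightarrow> U \<in> Obj C \<and> (\<exists>h\<in>Hom C U X. Cmp C U X A x h = a)"
  by (simp add: generated_sieve_def)

context category
begin

lemma generated_sieve_principal:
  "\<lbrakk>X \<in> Obj C; x \<in> Hom C X A\<rbrakk> \<Longrightarrow> generated_sieve C A X x \<in> principal_sieves C A"
  unfolding principal_sieves_def by blast

lemma principal_sieveE:
  assumes "\<phi> \<in> principal_sieves C A"
  obtains X x where "X \<in> Obj C" "x \<in> Hom C X A" "\<phi> = generated_sieve C A X x"
  using assms unfolding principal_sieves_def by blast

lemma principal_sieve_arrow:
  assumes "\<phi> \<in> principal_sieves C A" "A \<in> Obj C" "(U, a) \<in> \<phi>"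
  shows "U \<in> Obj C" "a \<in> Hom C U A"
proof -
  obtain X x where "X \<in> Obj C" "x \<in> Hom C X A" "\<phi> = generated_sieve C A X x"
    using assms(1) by (rule principal_sieveE)
  then show "U \<in> Obj C" "a \<in> Hom C U A"
    using assms(2,3) Cmp_closed by (auto simp: mem_generated_sieve)
qed

lemma principal_sieve_subset: "\<lbrakk>\<phi> \<in> principal_sieves C A; A \<in> Obj C\<rbrakk> \<Longrightarrow> \<phi> \<subseteq> slice_objs C A"
  using principal_sieve_arrow by (auto simp: mem_slice_objs)

lemma principal_sieve_precompose:
  assumes "\<phi> \<in> principal_sieves C A" "A \<in> Obj C" "(U, a) \<in> \<phi>" "V \<in> Obj C" "h \<in> Hom C V U"
  shows "(V, Cmp C V U A a h) \<in> \<phi>"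
proof -
  obtain X x where X: "X \<in> Obj C" "x \<in> Hom C X A" and \<phi>: "\<phi> = generated_sieve C A X x"
    using assms(1) by (rule principal_sieveE)
  then obtain k where k: "U \<in> Obj C" "k \<in> Hom C U X" "Cmp C U X A x k = a"
    using assms(3) by (auto simp: mem_generated_sieve)
  then have "Cmp C V X A x (Cmp C V U X k h) = Cmp C V U A a h"
    using assms X by (simp add: Cmp_assoc[symmetric])
  then show ?thesis
    using assms(4,5) X k Cmp_closed unfolding \<phi> mem_generated_sieve by blast
qed

lemma generator_mem: "\<lbrakk>X \<in> Obj C; A \<in> Obj C; x \<in> Hom C X A\<rbrakk> \<Longrightarrow> (X, x) \<in> generated_sieve C A X x"
  unfolding mem_generated_sieve by (intro conjI bexI[of _ "Id C X"]) (simp_all add: Cmp_Id_right Id_closed)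

text \<open>
  Yoneda: \<open>\<psi>\<close> is closed under precomposition, so it contains the sieve as soon as it contains the
  generator.
\<close>

lemma generated_sieve_subset_iff:
  assumes "X \<in> Obj C" "x \<in> Hom C X A" "A \<in> Obj C" "\<psi> \<in> principal_sieves C A"
  shows "generated_sieve C A X x \<subseteq> \<psi> \<longleftrightarrow> (X, x) \<in> \<psi>"
  using assms generator_mem principal_sieve_precompose[OF assms(4,3), of X x]
  by (auto simp: mem_generated_sieve)

lemma top_sieve: "A \<in> Obj C \<Longrightarrow> generated_sieve C A A (Id C A) = slice_objs C A"
  using Cmp_Id_left by (auto simp: mem_generated_sieve mem_slice_objs)

lemma top_sieve_principal: "A \<in> Obj C \<Longrightarrow> slice_objs C A \<in> principal_sieves C A"
  using generated_sieve_principal[of A "Id C A" A] top_sieve Id_closed by simp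

lemma image_sieve_principal:
  assumes "A \<in> Obj C" "B \<in> Obj C" "f \<in> Hom C A B" "\<phi> \<in> principal_sieves C A"
  shows "{(U, Cmp C U A B f a) | U a. (U, a) \<in> \<phi>} \<in> principal_sieves C B"
proof -
  obtain X x where X: "X \<in> Obj C" "x \<in> Hom C X A" and \<phi>: "\<phi> = generated_sieve C A X x"
    using assms(4) by (rule principal_sieveE)
  have "{(U, Cmp C U A B f a) | U a. (U, a) \<in> \<phi>} = generated_sieve C B X (Cmp C X A B f x)"
    using X assms unfolding \<phi> generated_sieve_def
    by (auto simp: Cmp_assoc) (metis Cmp_assoc)
  then show ?thesis
    using X assms Cmp_closed generated_sieve_principal by simp
qed

lemma reindex_Id: "\<lbrakk>A \<in> Obj C; \<phi> \<subseteq> slice_objs C A\<rbrakk> \<Longrightarrow> reindex C A A (Id C A) \<phi> = \<phi>"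
  by (auto simp: mem_reindex Cmp_Id_left mem_slice_objs)

lemma reindex_Cmp:
  assumes "X \<in> Obj C" "Y \<in> Obj C" "Z \<in> Obj C" "f \<in> Hom C X Y" "g \<in> Hom C Y Z"
  shows "reindex C X Z (Cmp C X Y Z g f) \<phi> = reindex C X Y f (reindex C Y Z g \<phi>)"
  using assms Cmp_closed by (auto simp: mem_reindex Cmp_assoc)

lemma reindex_top:
  "\<lbrakk>A \<in> Obj C; B \<in> Obj C; f \<in> Hom C A B\<rbrakk> \<Longrightarrow> reindex C A B f (slice_objs C B) = slice_objs C A"
  using Cmp_closed by (auto simp: mem_reindex mem_slice_objs)

lemma reindex_Int: "reindex C A B f (\<phi> \<inter> \<psi>) = reindex C A B f \<phi> \<inter> reindex C A B f \<psi>"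
  by (auto simp: mem_reindex)

end

locale weakly_lex_category = category C for C :: "('o, 'a) cat" +
  assumes binary_products: "has_binary_products C"
    and weak_pullbacks: "has_weak_pullbacks C"
begin

text \<open>
  Exactly the weak universal property of \<open>W\<close>: an arrow \<open>a\<close> factors through \<open>p\<close> if and only if \<open>f a\<close>
  factors through \<open>g\<close>.
\<close>

lemma reindex_generated_sieve:
  assumes "A \<in> Obj C" "B \<in> Obj C" "f \<in> Hom C A B" "Y \<in> Obj C" "g \<in> Hom C Y B"
    and W: "is_weak_pullback C A Y B f g W p q"
  shows "reindex C A B f (generated_sieve C B Y g) = generated_sieve C A W p"
proof -
  have Wo: "W \<in> Obj C" "p \<in> Hom C W A" "q \<in> Hom C W Y" "Cmp C W A B f p = Cmp C W Y B g q"
    and u: "\<And>X a b. \<lbrakk>X \<in> Obj C; a \<in> Hom C X A; b \<in> Hom C X Y; Cmp C X A B f a = Cmp C X Y B g b\<rbrakk>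
      \<Longrightarrow> \<exists>h. h \<in> Hom C X W \<and> Cmp C X W A p h = a \<and> Cmp C X W Y q h = b"
    using W unfolding is_weak_pullback_def by auto
  show ?thesis
  proof (intro equalityI subsetI)
    fix y assume "y \<in> reindex C A B f (generated_sieve C B Y g)"
    then obtain U a k where y: "y = (U, a)" and U: "U \<in> Obj C" "a \<in> Hom C U A"
      and "k \<in> Hom C U Y" "Cmp C U Y B g k = Cmp C U A B f a"
      by (cases y) (auto simp: mem_reindex mem_generated_sieve)
    then obtain h where "h \<in> Hom C U W" "Cmp C U W A p h = a"
      using u[of U a k] by auto
    then show "y \<in> generated_sieve C A W p"
      unfolding y mem_generated_sieve using U by blast
  next
    fix y assume "y \<in> generated_sieve C A W p"
    then obtain U h where y: "y = (U, Cmp C U W A p h)" and U: "U \<in> Obj C" "h \<in> Hom C U W"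
      by (cases y) (auto simp: mem_generated_sieve)
    have "Cmp C U A B f (Cmp C U W A p h) = Cmp C U Y B g (Cmp C U W Y q h)"
      using U assms Wo by (simp add: Cmp_assoc[symmetric])
    moreover have "Cmp C U W A p h \<in> Hom C U A" "Cmp C U W Y q h \<in> Hom C U Y"
      using U assms Wo Cmp_closed by auto
    ultimately show "y \<in> reindex C A B f (generated_sieve C B Y g)"
      unfolding y mem_reindex mem_generated_sieve using U by auto
  qed
qed

lemma reindex_principal:
  assumes "A \<in> Obj C" "B \<in> Obj C" "f \<in> Hom C A B" "\<phi> \<in> principal_sieves C B"
  shows "reindex C A B f \<phi> \<in> principal_sieves C A"
proof -
  obtain Y g where Y: "Y \<in> Obj C" "g \<in> Hom C Y B" and \<phi>: "\<phi> = generated_sieve C B Y g"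
    using assms(4) by (rule principal_sieveE)
  obtain W p q where W: "is_weak_pullback C A Y B f g W p q"
    using weak_pullbacks assms Y unfolding has_weak_pullbacks_def by meson
  then have "W \<in> Obj C" "p \<in> Hom C W A"
    unfolding is_weak_pullback_def by auto
  then show ?thesis
    using reindex_generated_sieve[OF assms(1-3) Y W] generated_sieve_principal \<phi> by simp
qed

text \<open>
  If \<open>g\<close> generates \<open>\<phi>\<close>, the intersection is the image under \<open>g\<close> of the preimage of \<open>\<psi>\<close> under \<open>g\<close>.
\<close>

lemma Int_principal:
  assumes "A \<in> Obj C" "\<phi> \<in> principal_sieves C A" "\<psi> \<in> principal_sieves C A"
  shows "\<phi> \<inter> \<psi> \<in> principal_sieves C A"
proof -
  obtain Y g where Y: "Y \<in> Obj C" "g \<in> Hom C Y A" and \<phi>: "\<phi> = generated_sieve C A Y g"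
    using assms(2) by (rule principal_sieveE)
  have "\<phi> \<inter> \<psi> = {(U, Cmp C U Y A g a) | U a. (U, a) \<in> reindex C Y A g \<psi>}"
    unfolding \<phi> by (auto simp: mem_generated_sieve mem_reindex)
  also have "\<dots> \<in> principal_sieves C A"
    using Y assms by (intro image_sieve_principal reindex_principal)
  finally show ?thesis .
qed

text \<open>
  Weak pullbacks suffice for genuine meets, because different weak intersections generate the same
  sieve.
\<close>

lemma principal_sieves_semilattice:
  assumes "A \<in> Obj C"
  shows "inf_semilattice (subset_order (principal_sieves C A))"
    and "\<top>\<^bsub>subset_order (principal_sieves C A)\<^esub> = slice_objs C A"
    and "\<lbrakk>\<phi> \<in> principal_sieves C A; \<psi> \<in> principal_sieves C A\<rbrakk> \<Longrightarrow>
      \<phi> \<sqinter>\<^bsub>subset_order (principal_sieves C A)\<^esub> \<psi> = \<phi> \<inter> \<psi>"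
  by (rule subset_order_semilattice[OF Int_principal[OF assms] top_sieve_principal[OF assms]
        principal_sieve_subset[OF _ assms]]; assumption)+

text \<open>
  The sieve is the preimage under \<open>\<langle>f, g\<rangle>\<close> of the sieve generated by the diagonal.
\<close>

lemma equalizer_sieve_principal:
  assumes "X \<in> Obj C" "A \<in> Obj C" "f \<in> Hom C X A" "g \<in> Hom C X A"
  shows "{(U, x). U \<in> Obj C \<and> x \<in> Hom C U X \<and> Cmp C U X A f x = Cmp C U X A g x} \<in> principal_sieves C X"
proof -
  note AA = chosen_product[OF binary_products assms(2,2)]
  note AAo = product_cone[OF AA]
  note k = pairing[OF binary_products assms(2,2,1,3,4)]
  note d = pairing[OF binary_products assms(2,2,2) Id_closed[OF assms(2)] Id_closed[OF assms(2)], folded diagonal_def]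
  let ?k = "pairing C X A A f g" and ?d = "generated_sieve C (prd C A A) A (diagonal C A)"
  have "(U, x) \<in> reindex C X (prd C A A) ?k ?d \<longleftrightarrow> Cmp C U X A f x = Cmp C U X A g x"
    if U: "U \<in> Obj C" "x \<in> Hom C U X" for U x
  proof -
    have kx: "Cmp C U X (prd C A A) ?k x \<in> Hom C U (prd C A A)"
      "Cmp C U (prd C A A) A (pr1 C A A) (Cmp C U X (prd C A A) ?k x) = Cmp C U X A f x"
      "Cmp C U (prd C A A) A (pr2 C A A) (Cmp C U X (prd C A A) ?k x) = Cmp C U X A g x"
      using U assms AAo k by (auto simp: Cmp_assoc[symmetric] intro: Cmp_closed)
    have dx: "Cmp C U A (prd C A A) (diagonal C A) h \<in> Hom C U (prd C A A)"
      "Cmp C U (prd C A A) A (pr1 C A A) (Cmp C U A (prd C A A) (diagonal C A) h) = h"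
      "Cmp C U (prd C A A) A (pr2 C A A) (Cmp C U A (prd C A A) (diagonal C A) h) = h"
      if "h \<in> Hom C U A" for h
      using U assms AAo d that by (auto simp: Cmp_assoc[symmetric] Cmp_Id_left intro: Cmp_closed)
    have fx: "Cmp C U X A f x \<in> Hom C U A"
      using U assms by (auto intro: Cmp_closed)
    have "Cmp C U A (prd C A A) (diagonal C A) (Cmp C U X A f x) = Cmp C U X (prd C A A) ?k x"
      if "Cmp C U X A f x = Cmp C U X A g x"
      by (rule product_eqI[OF AA assms(2,2) U(1)]) (use kx dx[OF fx] that in auto)
    then show ?thesis
      using U kx dx fx unfolding mem_reindex mem_generated_sieve by metis
  qed
  then have "{(U, x). U \<in> Obj C \<and> x \<in> Hom C U X \<and> Cmp C U X A f x = Cmp C U X A g x}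
      = reindex C X (prd C A A) ?k ?d"
    by (auto simp: mem_reindex)
  then show ?thesis
    using assms AAo k d by (simp add: reindex_principal generated_sieve_principal)
qed

end

section \<open>The doctrine of principal sieves\<close>

definition sieve_doctrine :: "('o, 'a) cat \<Rightarrow> ('o, 'a, ('o \<times> 'a) set) doctrine" where
  "sieve_doctrine C = \<lparr>base = C, fib = (\<lambda>A. subset_order (principal_sieves C A)), act = reindex C\<rparr>"

lemma sieve_doctrine_simps [simp]:
  "base (sieve_doctrine C) = C" "fib (sieve_doctrine C) A = subset_order (principal_sieves C A)"
  "act (sieve_doctrine C) = reindex C"
  by (simp_all add: sieve_doctrine_def)

context weakly_lex_category
begin

text \<open>
  Arrows with equal components are equal, so substitution is immediate.
\<close>

lemma leibniz_sieve:
  assumes A: "A \<in> Obj C" and W: "is_product C A A (W, p, q)"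
  shows "leibniz_equality (sieve_doctrine C) A W p q
    {(U, w). U \<in> Obj C \<and> w \<in> Hom C U W \<and> Cmp C U W A p w = Cmp C U W A q w}" (is "leibniz_equality _ _ _ _ _ ?d")
proof -
  note Wo = product_cone[OF W]
  have d: "?d \<in> principal_sieves C W"
    using equalizer_sieve_principal[OF Wo(1) A Wo(2,3)] .
  show ?thesis
  proof (rule leibnizI)
    show "?d \<in> carrier (fib (sieve_doctrine C) W)"
      using d by simp
    show "act (sieve_doctrine C) Z W h ?d = \<top>\<^bsub>fib (sieve_doctrine C) Z\<^esub>"
      if "Z \<in> Obj (base (sieve_doctrine C))" "h \<in> Hom (base (sieve_doctrine C)) Z W"
        "Cmp (base (sieve_doctrine C)) Z W A p h = Cmp (base (sieve_doctrine C)) Z W A q h" for Z h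
      using that A Wo
      by (auto simp: principal_sieves_semilattice(2) mem_reindex mem_slice_objs Cmp_closed Cmp_assoc[symmetric])
  next
    fix X V s t Z u u' w \<beta>
    assume "X \<in> Obj (base (sieve_doctrine C))" "is_product (base (sieve_doctrine C)) X A (V, s, t)"
      "Z \<in> Obj (base (sieve_doctrine C))" "u \<in> Hom (base (sieve_doctrine C)) Z V"
      "u' \<in> Hom (base (sieve_doctrine C)) Z V" "w \<in> Hom (base (sieve_doctrine C)) Z W"
      "\<beta> \<in> carrier (fib (sieve_doctrine C) V)"
      "Cmp (base (sieve_doctrine C)) Z V X s u = Cmp (base (sieve_doctrine C)) Z V X s u'"
      "Cmp (base (sieve_doctrine C)) Z V A t u = Cmp (base (sieve_doctrine C)) Z W A p w"
      "Cmp (base (sieve_doctrine C)) Z V A t u' = Cmp (base (sieve_doctrine C)) Z W A q w"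
    then have X: "X \<in> Obj C" and V: "is_product C X A (V, s, t)" and Z: "Z \<in> Obj C"
      and u: "u \<in> Hom C Z V" "u' \<in> Hom C Z V" and w: "w \<in> Hom C Z W" and \<beta>: "\<beta> \<in> principal_sieves C V"
      and e: "Cmp C Z V X s u = Cmp C Z V X s u'"
      "Cmp C Z V A t u = Cmp C Z W A p w" "Cmp C Z V A t u' = Cmp C Z W A q w"
      by simp_all
    note Vo = product_cone[OF V]
    have eq: "Cmp C U Z V u z = Cmp C U Z V u' z"
      if U: "U \<in> Obj C" "z \<in> Hom C U Z"
        and "Cmp C U W A p (Cmp C U Z W w z) = Cmp C U W A q (Cmp C U Z W w z)" for U z
      by (rule product_eqI[OF V X A U(1)])
        (use that e Z u w Vo Wo X A in \<open>simp_all add: Cmp_closed Cmp_assoc[symmetric]\<close>)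
    have "reindex C Z V u \<beta> \<inter> reindex C Z W w ?d \<subseteq> reindex C Z V u' \<beta>"
      using eq by (auto simp: mem_reindex)
    then show "act (sieve_doctrine C) Z V u \<beta> \<sqinter>\<^bsub>fib (sieve_doctrine C) Z\<^esub> act (sieve_doctrine C) Z W w ?d
        \<sqsubseteq>\<^bsub>fib (sieve_doctrine C) Z\<^esub> act (sieve_doctrine C) Z V u' \<beta>"
      using Z Vo Wo u w \<beta> d by (simp add: principal_sieves_semilattice(3) reindex_principal)
  qed
qed

lemma sieve_leibniz_doctrine: "leibniz_doctrine (sieve_doctrine C)"
proof
  show "is_doctrine (sieve_doctrine C)"
    unfolding is_doctrine_def Let_def inf_semilattice_hom_def
    using category_axioms binary_products principal_sieves_semilattice(1) reindex_principal
    by (auto simp: principal_sieves_semilattice(2) principal_sieves_semilattice(3) reindex_top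
        reindex_Int reindex_Id reindex_Cmp principal_sieve_subset)
  show "\<exists>d. leibniz_equality (sieve_doctrine C) A W p q d"
    if "A \<in> Obj (base (sieve_doctrine C))" "is_product (base (sieve_doctrine C)) A A (W, p, q)" for A W p q
    using leibniz_sieve[of A W p q] that by (intro exI) simp
qed

end

section \<open>Principal relations\<close>

definition generated_relation :: "('o, 'a) cat \<Rightarrow> 'o \<Rightarrow> 'o \<Rightarrow> 'a \<Rightarrow> 'a \<Rightarrow> ('o \<times> 'a \<times> 'a) set" where
  "generated_relation C A R r1 r2 = {(U, a, a'). U \<in> Obj C \<and>
    (\<exists>h\<in>Hom C U R. Cmp C U R A r1 h = a \<and> Cmp C U R A r2 h = a')}"

definition principal_relations :: "('o, 'a) cat \<Rightarrow> 'o \<Rightarrow> ('o \<times> 'a \<times> 'a) set set" where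
  "principal_relations C A =
    {E. \<exists>R\<in>Obj C. \<exists>r1\<in>Hom C R A. \<exists>r2\<in>Hom C R A. E = generated_relation C A R r1 r2}"

text \<open>
  These relations are triples \<open>(U, a, a')\<close> with \<open>a, a' : U \<rightarrow> A\<close>, rather than sieves on a product
  \<open>A \<times> A\<close>, so that no chosen product enters the notion of a setoid.
\<close>

definition principal_equivalences :: "('o, 'a) cat \<Rightarrow> 'o \<Rightarrow> ('o \<times> 'a \<times> 'a) set set" where
  "principal_equivalences C A = {E \<in> principal_relations C A.
    (\<forall>U\<in>Obj C. \<forall>a\<in>Hom C U A. (U, a, a) \<in> E) \<and>
    (\<forall>U a a'. (U, a, a') \<in> E \<longrightarrow> (U, a', a) \<in> E) \<and>
    (\<forall>U a a' a''. (U, a, a') \<in> E \<longrightarrow> (U, a', a'') \<in> E \<longrightarrow> (U, a, a'') \<in> E)}"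

lemma principal_equivalenceI:
  assumes "E \<in> principal_relations C A"
    and "\<And>U a. \<lbrakk>U \<in> Obj C; a \<in> Hom C U A\<rbrakk> \<Longrightarrow> (U, a, a) \<in> E"
    and "\<And>U a a'. (U, a, a') \<in> E \<Longrightarrow> (U, a', a) \<in> E"
    and "\<And>U a a' a''. \<lbrakk>(U, a, a') \<in> E; (U, a', a'') \<in> E\<rbrakk> \<Longrightarrow> (U, a, a'') \<in> E"
  shows "E \<in> principal_equivalences C A"
  unfolding principal_equivalences_def mem_Collect_eq
  by (intro conjI ballI allI impI) (fact assms | (rule assms; assumption))+

lemma principal_equivalenceD:
  assumes "E \<in> principal_equivalences C A"
  shows "E \<in> principal_relations C A"
    and "\<lbrakk>U \<in> Obj C; a \<in> Hom C U A\<rbrakk> \<Longrightarrow> (U, a, a) \<in> E"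
    and "(U, a, a') \<in> E \<Longrightarrow> (U, a', a) \<in> E"
    and "\<lbrakk>(U, a, a') \<in> E; (U, a', a'') \<in> E\<rbrakk> \<Longrightarrow> (U, a, a'') \<in> E"
  using assms unfolding principal_equivalences_def mem_Collect_eq by meson+

lemma mem_generated_relation:
  "(U, a, a') \<in> generated_relation C A R r1 r2 \<longleftrightarrow> U \<in> Obj C \<and>
    (\<exists>h\<in>Hom C U R. Cmp C U R A r1 h = a \<and> Cmp C U R A r2 h = a')"
  by (simp add: generated_relation_def)

context category
begin

lemma principal_relationE:
  assumes "E \<in> principal_relations C A"
  obtains R r1 r2 where "R \<in> Obj C" "r1 \<in> Hom C R A" "r2 \<in> Hom C R A" "E = generated_relation C A R r1 r2"
  using assms unfolding principal_relations_def by blast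

lemma generated_relation_principal:
  "\<lbrakk>R \<in> Obj C; r1 \<in> Hom C R A; r2 \<in> Hom C R A\<rbrakk> \<Longrightarrow> generated_relation C A R r1 r2 \<in> principal_relations C A"
  unfolding principal_relations_def by blast

lemma principal_relation_arrow:
  assumes "E \<in> principal_relations C A" "A \<in> Obj C" "(U, a, a') \<in> E"
  shows "U \<in> Obj C" "a \<in> Hom C U A" "a' \<in> Hom C U A"
proof -
  obtain R r1 r2 where "R \<in> Obj C" "r1 \<in> Hom C R A" "r2 \<in> Hom C R A" "E = generated_relation C A R r1 r2"
    using assms(1) by (rule principal_relationE)
  then show "U \<in> Obj C" "a \<in> Hom C U A" "a' \<in> Hom C U A"
    using assms(2,3) Cmp_closed by (auto simp: mem_generated_relation)
qed

lemma principal_relation_precompose: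
  assumes "E \<in> principal_relations C A" "A \<in> Obj C" "(U, a, a') \<in> E" "V \<in> Obj C" "h \<in> Hom C V U"
  shows "(V, Cmp C V U A a h, Cmp C V U A a' h) \<in> E"
proof -
  obtain R r1 r2 where R: "R \<in> Obj C" "r1 \<in> Hom C R A" "r2 \<in> Hom C R A" and E: "E = generated_relation C A R r1 r2"
    using assms(1) by (rule principal_relationE)
  then obtain k where k: "U \<in> Obj C" "k \<in> Hom C U R" "Cmp C U R A r1 k = a" "Cmp C U R A r2 k = a'"
    using assms(3) by (auto simp: mem_generated_relation)
  then have "Cmp C V R A r1 (Cmp C V U R k h) = Cmp C V U A a h" "Cmp C V R A r2 (Cmp C V U R k h) = Cmp C V U A a' h"
    using assms R by (simp_all add: Cmp_assoc[symmetric])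
  then show ?thesis
    using assms(4,5) R k Cmp_closed unfolding E mem_generated_relation by blast
qed

lemma relation_generator_mem:
  "\<lbrakk>R \<in> Obj C; A \<in> Obj C; r1 \<in> Hom C R A; r2 \<in> Hom C R A\<rbrakk> \<Longrightarrow> (R, r1, r2) \<in> generated_relation C A R r1 r2"
  unfolding mem_generated_relation by (intro conjI bexI[of _ "Id C R"]) (simp_all add: Cmp_Id_right Id_closed)

end

context weakly_lex_category
begin

text \<open>
  A substitution instance \<open>E(f x, g x)\<close> of a principal relation is a principal sieve: it is the
  preimage under \<open>\<langle>f, g\<rangle>\<close> of the sieve generated by \<open>\<langle>r\<^sub>1, r\<^sub>2\<rangle>\<close>.
\<close>

lemma principal_relation_sieve:
  assumes "X \<in> Obj C" "A \<in> Obj C" "f \<in> Hom C X A" "g \<in> Hom C X A" "E \<in> principal_relations C A"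
  shows "{(U, x). U \<in> Obj C \<and> x \<in> Hom C U X \<and> (U, Cmp C U X A f x, Cmp C U X A g x) \<in> E} \<in> principal_sieves C X"
proof -
  obtain R r1 r2 where R: "R \<in> Obj C" "r1 \<in> Hom C R A" "r2 \<in> Hom C R A" and E: "E = generated_relation C A R r1 r2"
    using assms(5) by (rule principal_relationE)
  note AA = chosen_product[OF binary_products assms(2,2)]
  note AAo = product_cone[OF AA]
  note k = pairing[OF binary_products assms(2,2,1,3,4)]
  note r = pairing[OF binary_products assms(2,2) R]
  let ?k = "pairing C X A A f g" and ?r = "pairing C R A A r1 r2"
  let ?d = "generated_sieve C (prd C A A) R ?r"
  have "(U, x) \<in> reindex C X (prd C A A) ?k ?d \<longleftrightarrow> (U, Cmp C U X A f x, Cmp C U X A g x) \<in> E"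
    if U: "U \<in> Obj C" "x \<in> Hom C U X" for U x
  proof -
    have kx: "Cmp C U X (prd C A A) ?k x \<in> Hom C U (prd C A A)"
      "Cmp C U (prd C A A) A (pr1 C A A) (Cmp C U X (prd C A A) ?k x) = Cmp C U X A f x"
      "Cmp C U (prd C A A) A (pr2 C A A) (Cmp C U X (prd C A A) ?k x) = Cmp C U X A g x"
      using U assms AAo k by (auto simp: Cmp_assoc[symmetric] intro: Cmp_closed)
    have rh: "Cmp C U R (prd C A A) ?r h \<in> Hom C U (prd C A A)"
      "Cmp C U (prd C A A) A (pr1 C A A) (Cmp C U R (prd C A A) ?r h) = Cmp C U R A r1 h"
      "Cmp C U (prd C A A) A (pr2 C A A) (Cmp C U R (prd C A A) ?r h) = Cmp C U R A r2 h"
      if "h \<in> Hom C U R" for h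
      using U assms AAo R r that by (auto simp: Cmp_assoc[symmetric] intro: Cmp_closed)
    have "Cmp C U R (prd C A A) ?r h = Cmp C U X (prd C A A) ?k x \<longleftrightarrow>
        Cmp C U R A r1 h = Cmp C U X A f x \<and> Cmp C U R A r2 h = Cmp C U X A g x" if h: "h \<in> Hom C U R" for h
      using rh[OF h] kx product_eqI[OF AA assms(2,2) U(1) rh(1)[OF h] kx(1)] by auto
    then show ?thesis
      using U kx unfolding mem_reindex mem_generated_sieve E mem_generated_relation by blast
  qed
  then have "{(U, x). U \<in> Obj C \<and> x \<in> Hom C U X \<and> (U, Cmp C U X A f x, Cmp C U X A g x) \<in> E}
      = reindex C X (prd C A A) ?k ?d"
    by (auto simp: mem_reindex)
  then show ?thesis
    using assms AAo R k r by (simp add: reindex_principal generated_sieve_principal)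
qed

text \<open>
  If \<open>r\<close> generates the sieve that corresponds to \<open>T\<close> on the product, then \<open>p r\<close> and \<open>q r\<close> generate \<open>T\<close>.
\<close>

lemma principal_relation_of_sieve:
  assumes A: "A \<in> Obj C" and W: "is_product C A A (W, p, q)"
    and T: "\<And>U a a'. (U, a, a') \<in> T \<Longrightarrow> U \<in> Obj C \<and> a \<in> Hom C U A \<and> a' \<in> Hom C U A"
    and S: "{(U, w). U \<in> Obj C \<and> w \<in> Hom C U W \<and> (U, Cmp C U W A p w, Cmp C U W A q w) \<in> T} \<in> principal_sieves C W"
  shows "T \<in> principal_relations C A"
proof -
  note Wo = product_cone[OF W]
  obtain R r where R: "R \<in> Obj C" "r \<in> Hom C R W"
    and eq: "{(U, w). U \<in> Obj C \<and> w \<in> Hom C U W \<and> (U, Cmp C U W A p w, Cmp C U W A q w) \<in> T} = generated_sieve C W R r"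
    using S by (rule principal_sieveE)
  have mem: "U \<in> Obj C \<and> w \<in> Hom C U W \<and> (U, Cmp C U W A p w, Cmp C U W A q w) \<in> T
      \<longleftrightarrow> (U, w) \<in> generated_sieve C W R r" for U w
    by (simp add: eq[symmetric])
  have "(U, a, a') \<in> T \<longleftrightarrow> (U, a, a') \<in> generated_relation C A R (Cmp C R W A p r) (Cmp C R W A q r)" for U a a'
  proof
    assume t: "(U, a, a') \<in> T"
    then have U: "U \<in> Obj C" "a \<in> Hom C U A" "a' \<in> Hom C U A" using T by auto
    obtain w where w: "w \<in> Hom C U W" "Cmp C U W A p w = a" "Cmp C U W A q w = a'"
      using product_pair[OF W U] by blast
    then have "(U, w) \<in> generated_sieve C W R r"
      using mem[of U w] U t by simp
    then obtain h where "h \<in> Hom C U R" "Cmp C U R W r h = w"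
      unfolding mem_generated_sieve by blast
    then show "(U, a, a') \<in> generated_relation C A R (Cmp C R W A p r) (Cmp C R W A q r)"
      unfolding mem_generated_relation using w U R Wo A by (auto simp: Cmp_assoc intro!: bexI[of _ h])
  next
    assume "(U, a, a') \<in> generated_relation C A R (Cmp C R W A p r) (Cmp C R W A q r)"
    then obtain h where U: "U \<in> Obj C" and h: "h \<in> Hom C U R"
      "a = Cmp C U W A p (Cmp C U R W r h)" "a' = Cmp C U W A q (Cmp C U R W r h)"
      using R Wo A by (auto simp: mem_generated_relation Cmp_assoc)
    then have "(U, Cmp C U R W r h) \<in> generated_sieve C W R r"
      unfolding mem_generated_sieve by blast
    then show "(U, a, a') \<in> T"
      unfolding h mem[symmetric] by simp
  qed
  then have "T = generated_relation C A R (Cmp C R W A p r) (Cmp C R W A q r)"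
    by auto
  then show ?thesis
    using R Wo A Cmp_closed generated_relation_principal by simp
qed

lemma reindex_relation_principal:
  assumes "X \<in> Obj C" "A \<in> Obj C" "f \<in> Hom C X A" "E \<in> principal_relations C A"
  shows "{(U, x, x'). U \<in> Obj C \<and> x \<in> Hom C U X \<and> x' \<in> Hom C U X \<and>
    (U, Cmp C U X A f x, Cmp C U X A f x') \<in> E} \<in> principal_relations C X" (is "?T \<in> _")
proof -
  note XX = chosen_product[OF binary_products assms(1,1)]
  note XXo = product_cone[OF XX]
  have c: "Cmp C (prd C X X) X A f (pr1 C X X) \<in> Hom C (prd C X X) A"
    "Cmp C (prd C X X) X A f (pr2 C X X) \<in> Hom C (prd C X X) A"
    using assms XXo Cmp_closed by auto
  have "{(U, w). U \<in> Obj C \<and> w \<in> Hom C U (prd C X X) \<and>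
      (U, Cmp C U (prd C X X) X (pr1 C X X) w, Cmp C U (prd C X X) X (pr2 C X X) w) \<in> ?T}
    = {(U, w). U \<in> Obj C \<and> w \<in> Hom C U (prd C X X) \<and>
      (U, Cmp C U (prd C X X) A (Cmp C (prd C X X) X A f (pr1 C X X)) w,
          Cmp C U (prd C X X) A (Cmp C (prd C X X) X A f (pr2 C X X)) w) \<in> E}"
    using assms XXo by (auto simp: Cmp_assoc Cmp_closed)
  also have "\<dots> \<in> principal_sieves C (prd C X X)"
    using principal_relation_sieve[OF XXo(1) assms(2) c assms(4)] .
  finally show ?thesis
    by (intro principal_relation_of_sieve[OF assms(1) XX]) auto
qed

lemma Int_relation_principal:
  assumes A: "A \<in> Obj C" and E: "E \<in> principal_relations C A" "F \<in> principal_relations C A"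
  shows "E \<inter> F \<in> principal_relations C A"
proof -
  note AA = chosen_product[OF binary_products A A]
  note AAo = product_cone[OF AA]
  have "{(U, w). U \<in> Obj C \<and> w \<in> Hom C U (prd C A A) \<and>
      (U, Cmp C U (prd C A A) A (pr1 C A A) w, Cmp C U (prd C A A) A (pr2 C A A) w) \<in> E \<inter> F}
    = {(U, w). U \<in> Obj C \<and> w \<in> Hom C U (prd C A A) \<and>
      (U, Cmp C U (prd C A A) A (pr1 C A A) w, Cmp C U (prd C A A) A (pr2 C A A) w) \<in> E}
    \<inter> {(U, w). U \<in> Obj C \<and> w \<in> Hom C U (prd C A A) \<and>
      (U, Cmp C U (prd C A A) A (pr1 C A A) w, Cmp C U (prd C A A) A (pr2 C A A) w) \<in> F}"
    by auto
  also have "\<dots> \<in> principal_sieves C (prd C A A)"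
    using Int_principal[OF AAo(1)] principal_relation_sieve[OF AAo(1) A AAo(2,3)] E by blast
  finally show ?thesis
    using principal_relation_arrow[OF E(1) A] by (intro principal_relation_of_sieve[OF A AA]) auto
qed

end

section \<open>Setoids\<close>

text \<open>
  Arrows are not identified here: this is the common form of the quotient completion of \<open>\<Psi>\<close> and of
  the category of pseudo-equivalence relations.
\<close>

definition setoid_category :: "('o, 'a) cat \<Rightarrow> ('o \<times> ('o \<times> 'a \<times> 'a) set, 'a) cat" where
  "setoid_category C =
    \<lparr> Obj = {x. fst x \<in> Obj C \<and> snd x \<in> principal_equivalences C (fst x)},
      Hom = (\<lambda>x y. {f \<in> Hom C (fst x) (fst y). \<forall>U a a'. (U, a, a') \<in> snd x \<longrightarrow>
        (U, Cmp C U (fst x) (fst y) f a, Cmp C U (fst x) (fst y) f a') \<in> snd y}),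
      Id = (\<lambda>x. Id C (fst x)),
      Cmp = (\<lambda>x y z. Cmp C (fst x) (fst y) (fst z)) \<rparr>"

definition setoid_equal :: "('o, 'a) cat \<Rightarrow> 'o \<times> ('o \<times> 'a \<times> 'a) set \<Rightarrow> 'o \<times> ('o \<times> 'a \<times> 'a) set \<Rightarrow> ('a \<times> 'a) set" where
  "setoid_equal C x y = {(f, g). f \<in> Hom (setoid_category C) x y \<and> g \<in> Hom (setoid_category C) x y \<and>
    (fst x, f, g) \<in> snd y}"

text \<open>
  The subsets of a setoid that respect its relation, that is, descent data.
\<close>

definition compatible_sieves :: "('o, 'a) cat \<Rightarrow> 'o \<times> ('o \<times> 'a \<times> 'a) set \<Rightarrow> ('o \<times> 'a) set set" where
  "compatible_sieves C x = {\<phi> \<in> principal_sieves C (fst x).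
    \<forall>U a a'. (U, a, a') \<in> snd x \<longrightarrow> (U, a) \<in> \<phi> \<longrightarrow> (U, a') \<in> \<phi>}"

definition setoid_doctrine ::
  "('o, 'a) cat \<Rightarrow> ('o \<times> ('o \<times> 'a \<times> 'a) set, 'a, ('o \<times> 'a) set) doctrine" where
  "setoid_doctrine C = \<lparr> base = setoid_category C,
    fib = (\<lambda>x. subset_order (compatible_sieves C x)),
    act = (\<lambda>x y. reindex C (fst x) (fst y)) \<rparr>"

text \<open>
  The action of a class of arrows is written as a union over its representatives, which all act in
  the same way on compatible sieves; this avoids choosing one.
\<close>

definition setoid_class_doctrine ::
  "('o, 'a) cat \<Rightarrow> ('o \<times> ('o \<times> 'a \<times> 'a) set, 'a set, ('o \<times> 'a) set) doctrine" where
  "setoid_class_doctrine C = \<lparr> base = quotient_category (setoid_category C) (setoid_equal C),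
    fib = (\<lambda>x. subset_order (compatible_sieves C x)),
    act = (\<lambda>x y F \<phi>. \<Union>f\<in>F. reindex C (fst x) (fst y) f \<phi>) \<rparr>"

lemma setoid_category_simps [simp]:
  "x \<in> Obj (setoid_category C) \<longleftrightarrow> fst x \<in> Obj C \<and> snd x \<in> principal_equivalences C (fst x)"
  "Id (setoid_category C) x = Id C (fst x)"
  "Cmp (setoid_category C) x y z = Cmp C (fst x) (fst y) (fst z)"
  by (simp_all add: setoid_category_def)

lemma mem_setoid_Hom:
  "f \<in> Hom (setoid_category C) x y \<longleftrightarrow> f \<in> Hom C (fst x) (fst y) \<and> (\<forall>U a a'. (U, a, a') \<in> snd x \<longrightarrow>
        (U, Cmp C U (fst x) (fst y) f a, Cmp C U (fst x) (fst y) f a') \<in> snd y)"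
  by (simp add: setoid_category_def)

text \<open>
  Generalized elements \<open>U \<rightarrow> A\<close> are arrows of setoids from the discrete setoid on \<open>U\<close>. Probing with
  these objects turns statements about arrows of setoids into statements about related elements.
\<close>

definition discrete_setoid :: "('o, 'a) cat \<Rightarrow> 'o \<Rightarrow> 'o \<times> ('o \<times> 'a \<times> 'a) set" where
  "discrete_setoid C U = (U, {(V, u, u'). V \<in> Obj C \<and> u \<in> Hom C V U \<and> u' = u})"

lemma fst_discrete_setoid [simp]: "fst (discrete_setoid C U) = U"
  by (simp add: discrete_setoid_def)

lemma mem_discrete_setoid: "(V, u, u') \<in> snd (discrete_setoid C U) \<longleftrightarrow> V \<in> Obj C \<and> u \<in> Hom C V U \<and> u' = u"
  by (simp add: discrete_setoid_def)

abbreviation (in weakly_lex_category) "Setoids \<equiv> setoid_category C"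

locale setoid = weakly_lex_category C for C :: "('o, 'a) cat" +
  fixes x
  assumes setoid: "x \<in> Obj (setoid_category C)"
begin

lemma carrier_obj: "fst x \<in> Obj C"
  using setoid by simp

lemma equivalence: "snd x \<in> principal_equivalences C (fst x)"
  using setoid by simp

lemmas principal = principal_equivalenceD(1)[OF equivalence]
  and refl = principal_equivalenceD(2)[OF equivalence]
  and sym = principal_equivalenceD(3)[OF equivalence]
  and trans = principal_equivalenceD(4)[OF equivalence]

lemmas arrow = principal_relation_arrow[OF principal carrier_obj]

lemmas precompose = principal_relation_precompose[OF principal carrier_obj]

lemma compatible_sieves_semilattice:
  shows "inf_semilattice (subset_order (compatible_sieves C x))"
    and "\<top>\<^bsub>subset_order (compatible_sieves C x)\<^esub> = slice_objs C (fst x)"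
    and "\<lbrakk>\<phi> \<in> compatible_sieves C x; \<psi> \<in> compatible_sieves C x\<rbrakk> \<Longrightarrow>
      \<phi> \<sqinter>\<^bsub>subset_order (compatible_sieves C x)\<^esub> \<psi> = \<phi> \<inter> \<psi>"
proof -
  have 1: "\<phi> \<inter> \<psi> \<in> compatible_sieves C x" if "\<phi> \<in> compatible_sieves C x" "\<psi> \<in> compatible_sieves C x" for \<phi> \<psi>
    using that Int_principal carrier_obj unfolding compatible_sieves_def by blast
  have 2: "slice_objs C (fst x) \<in> compatible_sieves C x"
    using top_sieve_principal[OF carrier_obj] arrow unfolding compatible_sieves_def
    by (auto simp: mem_slice_objs)
  have 3: "\<phi> \<subseteq> slice_objs C (fst x)" if "\<phi> \<in> compatible_sieves C x" for \<phi>
    using that principal_sieve_subset carrier_obj unfolding compatible_sieves_def by blast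
  show "inf_semilattice (subset_order (compatible_sieves C x))"
    "\<top>\<^bsub>subset_order (compatible_sieves C x)\<^esub> = slice_objs C (fst x)"
    "\<lbrakk>\<phi> \<in> compatible_sieves C x; \<psi> \<in> compatible_sieves C x\<rbrakk> \<Longrightarrow>
      \<phi> \<sqinter>\<^bsub>subset_order (compatible_sieves C x)\<^esub> \<psi> = \<phi> \<inter> \<psi>"
    by (rule subset_order_semilattice[OF 1 2 3]; assumption)+
qed

end

lemma compatible_sieve_principal: "\<phi> \<in> compatible_sieves C x \<Longrightarrow> \<phi> \<in> principal_sieves C (fst x)"
  by (simp add: compatible_sieves_def)

lemma compatible_sieveD: "\<lbrakk>\<phi> \<in> compatible_sieves C x; (U, a, a') \<in> snd x; (U, a) \<in> \<phi>\<rbrakk> \<Longrightarrow> (U, a') \<in> \<phi>"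
  unfolding compatible_sieves_def by blast

lemma setoid_HomD:
  assumes "f \<in> Hom (setoid_category C) x y"
  shows "f \<in> Hom C (fst x) (fst y)"
    and "(U, a, a') \<in> snd x \<Longrightarrow> (U, Cmp C U (fst x) (fst y) f a, Cmp C U (fst x) (fst y) f a') \<in> snd y"
  using assms by (auto simp: mem_setoid_Hom)

context weakly_lex_category
begin

lemma setoidI: "x \<in> Obj Setoids \<Longrightarrow> setoid C x"
  by unfold_locales

lemma setoid_category: "category Setoids"
proof
  fix x y z f g
  assume o: "x \<in> Obj Setoids" "y \<in> Obj Setoids" "z \<in> Obj Setoids"
    and f: "f \<in> Hom Setoids x y" and g: "g \<in> Hom Setoids y z"
  interpret x: setoid C x using o(1) by (rule setoidI)
  note fD = setoid_HomD[OF f] and gD = setoid_HomD[OF g]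
  have "(U, Cmp C U (fst x) (fst z) (Cmp C (fst x) (fst y) (fst z) g f) a,
      Cmp C U (fst x) (fst z) (Cmp C (fst x) (fst y) (fst z) g f) a') \<in> snd z" if "(U, a, a') \<in> snd x" for U a a'
    using gD(2)[OF fD(2)[OF that]] x.arrow[OF that] fD(1) gD(1) o by (simp add: Cmp_assoc)
  then show "Cmp Setoids x y z g f \<in> Hom Setoids x z"
    using fD(1) gD(1) o Cmp_closed by (simp add: mem_setoid_Hom)
next
  fix x assume o: "x \<in> Obj Setoids"
  interpret x: setoid C x using o by (rule setoidI)
  show "Id Setoids x \<in> Hom Setoids x x"
    using x.arrow o by (simp add: mem_setoid_Hom Id_closed Cmp_Id_left)
qed (simp_all add: mem_setoid_Hom Cmp_Id_left Cmp_Id_right Cmp_assoc)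

lemma discrete_setoid_obj: "U \<in> Obj C \<Longrightarrow> discrete_setoid C U \<in> Obj Setoids"
proof -
  assume U: "U \<in> Obj C"
  have "snd (discrete_setoid C U) = generated_relation C U U (Id C U) (Id C U)"
    using U Cmp_Id_left by (auto simp: discrete_setoid_def generated_relation_def)
  then have "snd (discrete_setoid C U) \<in> principal_relations C U"
    using U Id_closed generated_relation_principal by simp
  then have "snd (discrete_setoid C U) \<in> principal_equivalences C U"
    by (rule principal_equivalenceI) (simp_all add: mem_discrete_setoid)
  then show ?thesis
    using U by simp
qed

lemma discrete_setoid_Hom:
  assumes U: "U \<in> Obj C" and y: "y \<in> Obj Setoids"
  shows "Hom Setoids (discrete_setoid C U) y = Hom C U (fst y)"
proof -
  interpret y: setoid C y using y by (rule setoidI)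
  show ?thesis
    using U y.refl y.carrier_obj Cmp_closed by (auto simp: mem_setoid_Hom mem_discrete_setoid)
qed

lemma reindex_compatible:
  assumes x: "x \<in> Obj Setoids" and y: "y \<in> Obj Setoids"
    and f: "f \<in> Hom Setoids x y" and \<phi>: "\<phi> \<in> compatible_sieves C y"
  shows "reindex C (fst x) (fst y) f \<phi> \<in> compatible_sieves C x"
proof -
  interpret x: setoid C x using x by (rule setoidI)
  have "reindex C (fst x) (fst y) f \<phi> \<in> principal_sieves C (fst x)"
    using x y setoid_HomD(1)[OF f] compatible_sieve_principal[OF \<phi>] by (simp add: reindex_principal)
  then show ?thesis
    using setoid_HomD(2)[OF f] compatible_sieveD[OF \<phi>] x.arrow
    by (simp add: compatible_sieves_def mem_reindex) blast
qed

text \<open>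
  The product carries the componentwise relation.
\<close>

lemma setoid_product:
  assumes x: "x \<in> Obj Setoids" and y: "y \<in> Obj Setoids"
  obtains w p q where "is_product Setoids x y (w, p, q)" "is_product C (fst x) (fst y) (fst w, p, q)"
    "\<And>U a a'. (U, a, a') \<in> snd w \<longleftrightarrow> U \<in> Obj C \<and> a \<in> Hom C U (fst w) \<and> a' \<in> Hom C U (fst w) \<and>
      (U, Cmp C U (fst w) (fst x) p a, Cmp C U (fst w) (fst x) p a') \<in> snd x \<and>
      (U, Cmp C U (fst w) (fst y) q a, Cmp C U (fst w) (fst y) q a') \<in> snd y"
proof -
  interpret x: setoid C x using x by (rule setoidI)
  interpret y: setoid C y using y by (rule setoidI)
  obtain W p q where W: "is_product C (fst x) (fst y) (W, p, q)"
    using chosen_product[OF binary_products x.carrier_obj y.carrier_obj] by blast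
  note Wo = product_cone[OF W]
  define T where "T = {(U, a, a'). U \<in> Obj C \<and> a \<in> Hom C U W \<and> a' \<in> Hom C U W \<and>
      (U, Cmp C U W (fst x) p a, Cmp C U W (fst x) p a') \<in> snd x} \<inter>
    {(U, a, a'). U \<in> Obj C \<and> a \<in> Hom C U W \<and> a' \<in> Hom C U W \<and>
      (U, Cmp C U W (fst y) q a, Cmp C U W (fst y) q a') \<in> snd y}"
  have T: "(U, a, a') \<in> T \<longleftrightarrow> U \<in> Obj C \<and> a \<in> Hom C U W \<and> a' \<in> Hom C U W \<and>
      (U, Cmp C U W (fst x) p a, Cmp C U W (fst x) p a') \<in> snd x \<and>
      (U, Cmp C U W (fst y) q a, Cmp C U W (fst y) q a') \<in> snd y" for U a a'
    unfolding T_def by auto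
  have "T \<in> principal_relations C W"
    unfolding T_def
    by (rule Int_relation_principal[OF Wo(1)]
        reindex_relation_principal[OF Wo(1) x.carrier_obj Wo(2) x.principal]
        reindex_relation_principal[OF Wo(1) y.carrier_obj Wo(3) y.principal])+
  then have "T \<in> principal_equivalences C W"
  proof (rule principal_equivalenceI)
    show "(U, a, a) \<in> T" if "U \<in> Obj C" "a \<in> Hom C U W" for U a
    using that Wo x.carrier_obj y.carrier_obj unfolding T by (simp add: x.refl y.refl Cmp_closed)
    show "(U, a', a) \<in> T" if "(U, a, a') \<in> T" for U a a'
    using that x.sym y.sym unfolding T by simp
    show "(U, a, a'') \<in> T" if "(U, a, a') \<in> T" "(U, a', a'') \<in> T" for U a a' a''
    using that unfolding T by (meson x.trans y.trans)
  qed
  then have w: "(W, T) \<in> Obj Setoids"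
    using Wo by simp
  have "is_product Setoids x y ((W, T), p, q)"
    unfolding is_product_def case_prod_conv
  proof (intro conjI ballI w)
    show "p \<in> Hom Setoids (W, T) x" "q \<in> Hom Setoids (W, T) y"
      using Wo by (simp_all add: mem_setoid_Hom T)
    fix z f g assume z: "z \<in> Obj Setoids" and f: "f \<in> Hom Setoids z x"
      and g: "g \<in> Hom Setoids z y"
    interpret z: setoid C z using z by (rule setoidI)
    obtain h where h: "h \<in> Hom C (fst z) W" "Cmp C (fst z) W (fst x) p h = f" "Cmp C (fst z) W (fst y) q h = g"
      using product_pair[OF W z.carrier_obj setoid_HomD(1)[OF f] setoid_HomD(1)[OF g]] by blast
    have "(U, Cmp C U (fst z) W h a, Cmp C U (fst z) W h a') \<in> T" if "(U, a, a') \<in> snd z" for U a a'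
      using setoid_HomD(2)[OF f that] setoid_HomD(2)[OF g that] z.arrow[OF that] h Wo
        x.carrier_obj y.carrier_obj z.carrier_obj
      unfolding T by (simp add: Cmp_closed Cmp_assoc[symmetric])
    then have hH: "h \<in> Hom Setoids z (W, T)"
      using h by (simp add: mem_setoid_Hom)
    show "\<exists>!h. h \<in> Hom Setoids z (W, T) \<and> Cmp Setoids z (W, T) x p h = f \<and>
        Cmp Setoids z (W, T) y q h = g"
    proof (rule ex1I)
      show "h \<in> Hom Setoids z (W, T) \<and> Cmp Setoids z (W, T) x p h = f \<and>
        Cmp Setoids z (W, T) y q h = g"
        using hH h by simp
      show "h' = h" if h': "h' \<in> Hom Setoids z (W, T) \<and> Cmp Setoids z (W, T) x p h' = f \<and>
        Cmp Setoids z (W, T) y q h' = g" for h'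
        by (rule product_eqI[OF W x.carrier_obj y.carrier_obj z.carrier_obj])
          (use h h' in \<open>simp_all add: mem_setoid_Hom\<close>)
    qed
  qed
  then show thesis
    using that[of "(W, T)" p q] W T by simp
qed

text \<open>
  Any product is isomorphic to the one with the componentwise relation, through arrows that
  preserve relations.
\<close>

lemma setoid_product_relation:
  assumes x: "x \<in> Obj Setoids" and y: "y \<in> Obj Setoids"
    and w: "is_product Setoids x y (w, p, q)"
    and U: "U \<in> Obj C" "a \<in> Hom C U (fst w)" "a' \<in> Hom C U (fst w)"
    and a: "(U, Cmp C U (fst w) (fst x) p a, Cmp C U (fst w) (fst x) p a') \<in> snd x"
      "(U, Cmp C U (fst w) (fst y) q a, Cmp C U (fst w) (fst y) q a') \<in> snd y"
  shows "(U, a, a') \<in> snd w"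
proof -
  interpret S: category "Setoids" by (rule setoid_category)
  note wo = S.product_cone[OF w]
  note pD = setoid_HomD[OF wo(2)] and qD = setoid_HomD[OF wo(3)]
  obtain v r s where v: "is_product Setoids x y (v, r, s)" and V: "is_product C (fst x) (fst y) (fst v, r, s)"
    and T: "\<And>U a a'. (U, a, a') \<in> snd v \<longleftrightarrow> U \<in> Obj C \<and> a \<in> Hom C U (fst v) \<and> a' \<in> Hom C U (fst v) \<and>
      (U, Cmp C U (fst v) (fst x) r a, Cmp C U (fst v) (fst x) r a') \<in> snd x \<and>
      (U, Cmp C U (fst v) (fst y) s a, Cmp C U (fst v) (fst y) s a') \<in> snd y"
    using setoid_product[OF x y] by metis
  note vo = S.product_cone[OF v]
  note rD = setoid_HomD[OF vo(2)] and sD = setoid_HomD[OF vo(3)]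
  obtain k where k: "k \<in> Hom Setoids w v" "Cmp Setoids w v x r k = p"
    "Cmp Setoids w v y s k = q"
    using S.product_pair[OF v wo] by blast
  obtain h where h: "h \<in> Hom Setoids v w" "Cmp Setoids v w x p h = r"
    "Cmp Setoids v w y q h = s"
    using S.product_pair[OF w vo] by blast
  \<comment> \<open>Elements of \<open>w\<close> are compared in \<open>v\<close>, where the relation is componentwise, and sent back by \<open>h\<close>.\<close>
  have hk: "Cmp Setoids w v w h k = Id Setoids w"
  proof (rule S.product_eqI[OF w x y wo(1)])
    show "Cmp Setoids w w x p (Cmp Setoids w v w h k)
        = Cmp Setoids w w x p (Id Setoids w)"
      using S.Cmp_assoc[OF wo(1) vo(1) wo(1) x k(1) h(1) wo(2)] h(2) k(2) S.Cmp_Id_right[OF wo(1) x wo(2)] by simp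
    show "Cmp Setoids w w y q (Cmp Setoids w v w h k)
        = Cmp Setoids w w y q (Id Setoids w)"
      using S.Cmp_assoc[OF wo(1) vo(1) wo(1) y k(1) h(1) wo(3)] h(3) k(3) S.Cmp_Id_right[OF wo(1) y wo(3)] by simp
  qed (rule S.Cmp_closed[OF wo(1) vo(1) wo(1) k(1) h(1)] S.Id_closed[OF wo(1)])+
  note kD = setoid_HomD(1)[OF k(1)] and hD = setoid_HomD[OF h(1)]
  have "(U, Cmp C U (fst w) (fst v) k a, Cmp C U (fst w) (fst v) k a') \<in> snd v"
    using a U x y wo(1) vo(1) kD k(2,3) rD(1) sD(1) unfolding T by (simp add: Cmp_closed Cmp_assoc[symmetric])
  from hD(2)[OF this] show ?thesis
    using U wo(1) vo(1) kD hD(1) hk by (simp add: Cmp_assoc[symmetric] Cmp_Id_left)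
qed

end

section \<open>Equality of setoids\<close>

text \<open>
  For the projections \<open>p, q\<close> of a product diagram for \<open>x \<times> x\<close>, this is the equality predicate of the
  setoid \<open>x\<close>: its elements have related components.
\<close>

definition equality_sieve :: "('o, 'a) cat \<Rightarrow> 'o \<times> ('o \<times> 'a \<times> 'a) set \<Rightarrow> 'o \<Rightarrow> 'a \<Rightarrow> 'a \<Rightarrow> ('o \<times> 'a) set" where
  "equality_sieve C x W p q = {(U, a). U \<in> Obj C \<and> a \<in> Hom C U W \<and>
    (U, Cmp C U W (fst x) p a, Cmp C U W (fst x) q a) \<in> snd x}"

lemma mem_equality_sieve: "(U, a) \<in> equality_sieve C x W p q \<longleftrightarrow> U \<in> Obj C \<and> a \<in> Hom C U W \<and>
    (U, Cmp C U W (fst x) p a, Cmp C U W (fst x) q a) \<in> snd x"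
  by (simp add: equality_sieve_def)

context setoid
begin

lemma equality_sieve_compatible:
  assumes w: "w \<in> Obj Setoids"
    and p: "p \<in> Hom Setoids w x" and q: "q \<in> Hom Setoids w x"
  shows "equality_sieve C x (fst w) p q \<in> compatible_sieves C w"
  unfolding compatible_sieves_def mem_Collect_eq
proof (intro conjI allI impI)
  interpret w: setoid C w using w by (rule setoidI)
  show "equality_sieve C x (fst w) p q \<in> principal_sieves C (fst w)"
    unfolding equality_sieve_def
    using principal_relation_sieve[OF w.carrier_obj carrier_obj setoid_HomD(1)[OF p] setoid_HomD(1)[OF q] principal] .
  show "(U, a') \<in> equality_sieve C x (fst w) p q"
    if "(U, a, a') \<in> snd w" "(U, a) \<in> equality_sieve C x (fst w) p q" for U a a'
    using that w.arrow[OF that(1)]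
      trans[OF trans[OF sym[OF setoid_HomD(2)[OF p that(1)]]] setoid_HomD(2)[OF q that(1)]]
    unfolding mem_equality_sieve by blast
qed

text \<open>
  Reflexivity holds already when the two components of \<open>h\<close> are related rather than equal. This form
  serves setoids with and without identification of arrows.
\<close>

lemma equality_sieve_refl:
  assumes z: "z \<in> Obj Setoids" and w: "w \<in> Obj Setoids"
    and h: "h \<in> Hom Setoids z w"
    and p: "p \<in> Hom Setoids w x" and q: "q \<in> Hom Setoids w x"
    and eq: "(fst z, Cmp C (fst z) (fst w) (fst x) p h, Cmp C (fst z) (fst w) (fst x) q h) \<in> snd x"
  shows "reindex C (fst z) (fst w) h (equality_sieve C x (fst w) p q) = slice_objs C (fst z)"
proof -
  have "(U, Cmp C U (fst w) (fst x) p (Cmp C U (fst z) (fst w) h a),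
      Cmp C U (fst w) (fst x) q (Cmp C U (fst z) (fst w) h a)) \<in> snd x"
    if "U \<in> Obj C" "a \<in> Hom C U (fst z)" for U a
    using precompose[OF eq that] that z w setoid_HomD(1)[OF h] setoid_HomD(1)[OF p] setoid_HomD(1)[OF q]
      carrier_obj by (simp add: Cmp_assoc)
  then show ?thesis
    using z w setoid_HomD(1)[OF h]
    by (auto simp: mem_reindex mem_slice_objs mem_equality_sieve Cmp_closed)
qed

text \<open>
  The hypotheses on components are relations, not equations, and \<open>sep\<close> says that the relation of \<open>v\<close>
  is componentwise. Then \<open>u a\<close> and \<open>u' a\<close> are related whenever \<open>k a\<close> has related components, and
  \<open>\<beta>\<close> is compatible.
\<close>

lemma equality_sieve_subst:
  assumes z: "z \<in> Obj Setoids" and w: "w \<in> Obj Setoids"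
    and v: "v \<in> Obj Setoids" and y: "y \<in> Obj Setoids"
    and p: "p \<in> Hom Setoids w x" and q: "q \<in> Hom Setoids w x"
    and s: "s \<in> Hom Setoids v y" and t: "t \<in> Hom Setoids v x"
    and sep: "\<And>U a a'. \<lbrakk>U \<in> Obj C; a \<in> Hom C U (fst v); a' \<in> Hom C U (fst v);
      (U, Cmp C U (fst v) (fst y) s a, Cmp C U (fst v) (fst y) s a') \<in> snd y;
      (U, Cmp C U (fst v) (fst x) t a, Cmp C U (fst v) (fst x) t a') \<in> snd x\<rbrakk> \<Longrightarrow> (U, a, a') \<in> snd v"
    and u: "u \<in> Hom Setoids z v" and u': "u' \<in> Hom Setoids z v"
    and k: "k \<in> Hom Setoids z w" and \<beta>: "\<beta> \<in> compatible_sieves C v"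
    and e1: "(fst z, Cmp C (fst z) (fst v) (fst y) s u, Cmp C (fst z) (fst v) (fst y) s u') \<in> snd y"
    and e2: "(fst z, Cmp C (fst z) (fst v) (fst x) t u, Cmp C (fst z) (fst w) (fst x) p k) \<in> snd x"
    and e3: "(fst z, Cmp C (fst z) (fst v) (fst x) t u', Cmp C (fst z) (fst w) (fst x) q k) \<in> snd x"
  shows "reindex C (fst z) (fst v) u \<beta> \<inter> reindex C (fst z) (fst w) k (equality_sieve C x (fst w) p q)
    \<subseteq> reindex C (fst z) (fst v) u' \<beta>"
proof clarify
  fix U a
  assume "(U, a) \<in> reindex C (fst z) (fst v) u \<beta>"
    and "(U, a) \<in> reindex C (fst z) (fst w) k (equality_sieve C x (fst w) p q)"
  then have U: "U \<in> Obj C" "a \<in> Hom C U (fst z)" and ua: "(U, Cmp C U (fst z) (fst v) u a) \<in> \<beta>"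
    and pq: "(U, Cmp C U (fst w) (fst x) p (Cmp C U (fst z) (fst w) k a),
      Cmp C U (fst w) (fst x) q (Cmp C U (fst z) (fst w) k a)) \<in> snd x"
    by (auto simp: mem_reindex mem_equality_sieve)
  interpret y: setoid C y using y by (rule setoidI)
  note D = setoid_HomD(1)[OF p] setoid_HomD(1)[OF q] setoid_HomD(1)[OF s] setoid_HomD(1)[OF t]
    setoid_HomD(1)[OF u] setoid_HomD(1)[OF u'] setoid_HomD(1)[OF k]
  have zwv: "fst z \<in> Obj C" "fst w \<in> Obj C" "fst v \<in> Obj C" using z w v by simp_all
  have sy: "(U, Cmp C U (fst v) (fst y) s (Cmp C U (fst z) (fst v) u a),
      Cmp C U (fst v) (fst y) s (Cmp C U (fst z) (fst v) u' a)) \<in> snd y"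
    using y.precompose[OF e1 U] U D zwv y.carrier_obj by (simp add: Cmp_assoc)
  have tp: "(U, Cmp C U (fst v) (fst x) t (Cmp C U (fst z) (fst v) u a),
      Cmp C U (fst w) (fst x) p (Cmp C U (fst z) (fst w) k a)) \<in> snd x"
    using precompose[OF e2 U] U D zwv carrier_obj by (simp add: Cmp_assoc)
  have tq: "(U, Cmp C U (fst v) (fst x) t (Cmp C U (fst z) (fst v) u' a),
      Cmp C U (fst w) (fst x) q (Cmp C U (fst z) (fst w) k a)) \<in> snd x"
    using precompose[OF e3 U] U D zwv carrier_obj by (simp add: Cmp_assoc)
  have "(U, Cmp C U (fst z) (fst v) u a, Cmp C U (fst z) (fst v) u' a) \<in> snd v"
    by (rule sep[OF U(1) _ _ sy trans[OF trans[OF tp pq] sym[OF tq]]]) (use U D zwv Cmp_closed in auto)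
  then show "(U, a) \<in> reindex C (fst z) (fst v) u' \<beta>"
    using compatible_sieveD[OF \<beta> _ ua] U by (simp add: mem_reindex)
qed

end

section \<open>The doctrine of setoids\<close>

lemma setoid_doctrine_simps [simp]:
  "base (setoid_doctrine C) = setoid_category C"
  "fib (setoid_doctrine C) x = subset_order (compatible_sieves C x)"
  "act (setoid_doctrine C) x y = reindex C (fst x) (fst y)"
  by (simp_all add: setoid_doctrine_def)

context weakly_lex_category
begin

lemma setoid_binary_products: "has_binary_products Setoids"
  unfolding has_binary_products_def
proof (intro ballI)
  fix x y assume "x \<in> Obj Setoids" "y \<in> Obj Setoids"
  then show "\<exists>w. is_product Setoids x y w"
    by (rule setoid_product) blast
qed

lemma setoid_leibniz:
  assumes x: "x \<in> Obj Setoids" and w: "is_product Setoids x x (w, p, q)"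
  shows "leibniz_equality (setoid_doctrine C) x w p q (equality_sieve C x (fst w) p q)"
proof (rule leibnizI, unfold setoid_doctrine_simps subset_order_simps)
  interpret S: category "Setoids" by (rule setoid_category)
  interpret x: setoid C x using x by (rule setoidI)
  note wo = S.product_cone[OF w]
  note d = x.equality_sieve_compatible[OF wo]
  show "equality_sieve C x (fst w) p q \<in> compatible_sieves C w"
    by (rule d)
  show "reindex C (fst z) (fst w) h (equality_sieve C x (fst w) p q) = \<top>\<^bsub>subset_order (compatible_sieves C z)\<^esub>"
    if z: "z \<in> Obj Setoids" and h: "h \<in> Hom Setoids z w"
      and eq: "Cmp Setoids z w x p h = Cmp Setoids z w x q h" for z h
  proof -
    interpret z: setoid C z using z by (rule setoidI)
    have "(fst z, Cmp C (fst z) (fst w) (fst x) p h, Cmp C (fst z) (fst w) (fst x) q h) \<in> snd x"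
      using eq x.refl[OF z.carrier_obj setoid_HomD(1)[OF S.Cmp_closed[OF z wo(1) x h wo(2)]]] by simp
    then show ?thesis
      using x.equality_sieve_refl[OF z wo(1) h wo(2,3)] z.compatible_sieves_semilattice(2) by simp
  qed
  fix y v s t z u u' k \<beta>
  assume y: "y \<in> Obj Setoids" and v: "is_product Setoids y x (v, s, t)"
    and z: "z \<in> Obj Setoids" and u: "u \<in> Hom Setoids z v"
    and u': "u' \<in> Hom Setoids z v" and k: "k \<in> Hom Setoids z w"
    and \<beta>: "\<beta> \<in> compatible_sieves C v"
    and e: "Cmp Setoids z v y s u = Cmp Setoids z v y s u'"
      "Cmp Setoids z v x t u = Cmp Setoids z w x p k"
      "Cmp Setoids z v x t u' = Cmp Setoids z w x q k"
  interpret y: setoid C y using y by (rule setoidI)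
  interpret z: setoid C z using z by (rule setoidI)
  note vo = S.product_cone[OF v]
  have "reindex C (fst z) (fst v) u \<beta> \<inter> reindex C (fst z) (fst w) k (equality_sieve C x (fst w) p q)
    \<subseteq> reindex C (fst z) (fst v) u' \<beta>"
  proof (rule x.equality_sieve_subst[OF z wo(1) vo(1) y wo(2,3) vo(2,3) _ u u' k \<beta>])
    show "(U, a, a') \<in> snd v" if "U \<in> Obj C" "a \<in> Hom C U (fst v)" "a' \<in> Hom C U (fst v)"
      "(U, Cmp C U (fst v) (fst y) s a, Cmp C U (fst v) (fst y) s a') \<in> snd y"
      "(U, Cmp C U (fst v) (fst x) t a, Cmp C U (fst v) (fst x) t a') \<in> snd x" for U a a'
      using setoid_product_relation[OF y x v that] .
    show "(fst z, Cmp C (fst z) (fst v) (fst y) s u, Cmp C (fst z) (fst v) (fst y) s u') \<in> snd y"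
      "(fst z, Cmp C (fst z) (fst v) (fst x) t u, Cmp C (fst z) (fst w) (fst x) p k) \<in> snd x"
      "(fst z, Cmp C (fst z) (fst v) (fst x) t u', Cmp C (fst z) (fst w) (fst x) q k) \<in> snd x"
      using e y.refl[OF z.carrier_obj setoid_HomD(1)[OF S.Cmp_closed[OF z vo(1) y u' vo(2)]]]
        x.refl[OF z.carrier_obj setoid_HomD(1)[OF S.Cmp_closed[OF z wo(1) x k wo(2)]]]
        x.refl[OF z.carrier_obj setoid_HomD(1)[OF S.Cmp_closed[OF z wo(1) x k wo(3)]]]
      by simp_all
  qed
  then show "reindex C (fst z) (fst v) u \<beta> \<sqinter>\<^bsub>subset_order (compatible_sieves C z)\<^esub>
      reindex C (fst z) (fst w) k (equality_sieve C x (fst w) p q) \<subseteq> reindex C (fst z) (fst v) u' \<beta>"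
    using z.compatible_sieves_semilattice(3) reindex_compatible[OF z vo(1) u \<beta>]
      reindex_compatible[OF z wo(1) k d] by simp
qed

lemma setoid_leibniz_doctrine: "leibniz_doctrine (setoid_doctrine C)"
proof
  have "inf_semilattice_hom (subset_order (compatible_sieves C y)) (subset_order (compatible_sieves C x))
      (reindex C (fst x) (fst y) f)"
    if x: "x \<in> Obj Setoids" and y: "y \<in> Obj Setoids"
      and f: "f \<in> Hom Setoids x y" for x y f
  proof -
    interpret x: setoid C x using x by (rule setoidI)
    interpret y: setoid C y using y by (rule setoidI)
    note r = reindex_compatible[OF x y f]
    show ?thesis
      unfolding inf_semilattice_hom_def
      using r x.compatible_sieves_semilattice(2) y.compatible_sieves_semilattice(2)
        x.compatible_sieves_semilattice(3)[OF r r] y.compatible_sieves_semilattice(3)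
        reindex_top[OF x.carrier_obj y.carrier_obj setoid_HomD(1)[OF f]] reindex_Int by auto
  qed
  moreover have "reindex C (fst x) (fst x) (Id C (fst x)) \<phi> = \<phi>"
    if "x \<in> Obj Setoids" "\<phi> \<in> compatible_sieves C x" for x \<phi>
    using that principal_sieve_subset[OF compatible_sieve_principal] by (simp add: reindex_Id)
  moreover have "reindex C (fst x) (fst z) (Cmp C (fst x) (fst y) (fst z) g f) \<phi>
      = reindex C (fst x) (fst y) f (reindex C (fst y) (fst z) g \<phi>)"
    if "x \<in> Obj Setoids" "y \<in> Obj Setoids" "z \<in> Obj Setoids"
      "f \<in> Hom Setoids x y" "g \<in> Hom Setoids y z" for x y z f g \<phi>
    using that setoid_HomD(1)[OF that(4)] setoid_HomD(1)[OF that(5)] by (simp add: reindex_Cmp)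
  ultimately show "is_doctrine (setoid_doctrine C)"
    unfolding is_doctrine_def Let_def setoid_doctrine_simps subset_order_simps
    using setoid_category setoid_binary_products setoid.compatible_sieves_semilattice(1)[OF setoidI]
    by simp
  show "\<exists>d. leibniz_equality (setoid_doctrine C) x w p q d"
    if "x \<in> Obj (base (setoid_doctrine C))" "is_product (base (setoid_doctrine C)) x x (w, p, q)" for x w p q
    using setoid_leibniz[of x w p q] that by (intro exI) simp
qed

end

section \<open>Quotients of categories\<close>

locale category_congruence = category D for D :: "('o, 'a) cat" +
  fixes E :: "'o \<Rightarrow> 'o \<Rightarrow> ('a \<times> 'a) set"
  assumes equivalence: "\<lbrakk>X \<in> Obj D; Y \<in> Obj D\<rbrakk> \<Longrightarrow> equiv (Hom D X Y) (E X Y)"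
    and cong: "\<lbrakk>X \<in> Obj D; Y \<in> Obj D; Z \<in> Obj D; (f, f') \<in> E X Y; (g, g') \<in> E Y Z\<rbrakk> \<Longrightarrow>
      (Cmp D X Y Z g f, Cmp D X Y Z g' f') \<in> E X Z"
begin

abbreviation "Q \<equiv> quotient_category D E"
abbreviation "cls X Y f \<equiv> E X Y `` {f}"

lemma Obj_Q [simp]: "Obj Q = Obj D"
  by (simp add: quotient_category_def)

lemma Id_Q: "Id Q X = cls X X (Id D X)"
  by (simp add: quotient_category_def)

lemma cls_closed: "f \<in> Hom D X Y \<Longrightarrow> cls X Y f \<in> Hom Q X Y"
  by (simp add: quotient_category_def quotientI)

lemma Hom_Q_E:
  assumes "F \<in> Hom Q X Y"
  obtains f where "f \<in> Hom D X Y" "F = cls X Y f"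
  using assms unfolding quotient_category_def by (auto elim: quotientE)

lemma cls_eq_iff:
  "\<lbrakk>X \<in> Obj D; Y \<in> Obj D; f \<in> Hom D X Y; g \<in> Hom D X Y\<rbrakk> \<Longrightarrow> cls X Y f = cls X Y g \<longleftrightarrow> (f, g) \<in> E X Y"
  using eq_equiv_class_iff[OF equivalence] by blast

lemma cls_self: "\<lbrakk>X \<in> Obj D; Y \<in> Obj D; f \<in> Hom D X Y\<rbrakk> \<Longrightarrow> f \<in> cls X Y f"
  using equiv_class_self[OF equivalence] by blast

lemma cls_memD: "\<lbrakk>X \<in> Obj D; Y \<in> Obj D; f' \<in> cls X Y f\<rbrakk> \<Longrightarrow> (f, f') \<in> E X Y"
  by blast

lemma Cmp_cls:
  assumes "X \<in> Obj D" "Y \<in> Obj D" "Z \<in> Obj D" "f \<in> Hom D X Y" "g \<in> Hom D Y Z"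
  shows "Cmp Q X Y Z (cls Y Z g) (cls X Y f) = cls X Z (Cmp D X Y Z g f)"
proof -
  have "E X Z `` {Cmp D X Y Z g' f' | g' f'. g' \<in> cls Y Z g \<and> f' \<in> cls X Y f} = cls X Z (Cmp D X Y Z g f)"
    (is "E X Z `` ?M = _")
  proof
    show "E X Z `` ?M \<subseteq> cls X Z (Cmp D X Y Z g f)"
    proof
      fix k assume "k \<in> E X Z `` ?M"
      then obtain g' f' where gf: "(g, g') \<in> E Y Z" "(f, f') \<in> E X Y" and k: "(Cmp D X Y Z g' f', k) \<in> E X Z"
        by auto
      have "(Cmp D X Y Z g f, Cmp D X Y Z g' f') \<in> E X Z"
        using cong[OF assms(1-3) gf(2,1)] .
      then show "k \<in> cls X Z (Cmp D X Y Z g f)"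
        using k equivalence[OF assms(1,3)] unfolding equiv_def trans_def by blast
    qed
    show "cls X Z (Cmp D X Y Z g f) \<subseteq> E X Z `` ?M"
      using cls_self[OF assms(1,2,4)] cls_self[OF assms(2,3,5)] by blast
  qed
  then show ?thesis
    by (simp add: quotient_category_def)
qed

lemma quotient_category: "category Q"
proof
  show "Id Q X \<in> Hom Q X X" if "X \<in> Obj Q" for X
    using that Id_closed by (simp add: Id_Q cls_closed)
  show "Cmp Q X Y Z G F \<in> Hom Q X Z"
    if "X \<in> Obj Q" "Y \<in> Obj Q" "Z \<in> Obj Q" "F \<in> Hom Q X Y" "G \<in> Hom Q Y Z" for X Y Z F G
    using that Cmp_closed by (auto elim!: Hom_Q_E simp: Cmp_cls cls_closed)
  show "Cmp Q X X Y F (Id Q X) = F" if "X \<in> Obj Q" "Y \<in> Obj Q" "F \<in> Hom Q X Y" for X Y F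
    using that by (auto elim!: Hom_Q_E simp: Id_Q Cmp_cls Id_closed Cmp_Id_right)
  show "Cmp Q X Y Y (Id Q Y) F = F" if "X \<in> Obj Q" "Y \<in> Obj Q" "F \<in> Hom Q X Y" for X Y F
    using that by (auto elim!: Hom_Q_E simp: Id_Q Cmp_cls Id_closed Cmp_Id_left)
  show "Cmp Q W X Z (Cmp Q X Y Z H G) F = Cmp Q W Y Z H (Cmp Q W X Y G F)"
    if "W \<in> Obj Q" "X \<in> Obj Q" "Y \<in> Obj Q" "Z \<in> Obj Q" "F \<in> Hom Q W X" "G \<in> Hom Q X Y" "H \<in> Hom Q Y Z" for W X Y Z F G H
    using that by (auto elim!: Hom_Q_E simp: Cmp_cls Cmp_closed Cmp_assoc)
qed

end

section \<open>Setoids with arrows up to pointwise equality\<close>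

context weakly_lex_category
begin

text \<open>
  The last claim extends \<open>f \<sim> g\<close>, which compares values at the generic element, to values at related
  elements.
\<close>

lemma setoid_equalD:
  assumes x: "x \<in> Obj Setoids" and y: "y \<in> Obj Setoids"
    and fg: "(f, g) \<in> setoid_equal C x y"
  shows "f \<in> Hom Setoids x y" "g \<in> Hom Setoids x y" "(fst x, f, g) \<in> snd y"
    and "(U, a, a') \<in> snd x \<Longrightarrow> (U, Cmp C U (fst x) (fst y) f a, Cmp C U (fst x) (fst y) g a') \<in> snd y"
proof -
  interpret x: setoid C x using x by (rule setoidI)
  interpret y: setoid C y using y by (rule setoidI)
  show f: "f \<in> Hom Setoids x y" "g \<in> Hom Setoids x y" "(fst x, f, g) \<in> snd y"
    using fg by (auto simp: setoid_equal_def)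
  show "(U, Cmp C U (fst x) (fst y) f a, Cmp C U (fst x) (fst y) g a') \<in> snd y" if "(U, a, a') \<in> snd x"
    using y.trans[OF setoid_HomD(2)[OF f(1) that] y.precompose[OF f(3)]] x.arrow[OF that] by blast
qed

lemma setoid_congruence: "category_congruence Setoids (setoid_equal C)"
proof -
  interpret S: category "Setoids" by (rule setoid_category)
  show ?thesis
  proof
    fix x y assume x: "x \<in> Obj Setoids" and y: "y \<in> Obj Setoids"
    interpret x: setoid C x using x by (rule setoidI)
    interpret y: setoid C y using y by (rule setoidI)
    show "equiv (Hom Setoids x y) (setoid_equal C x y)"
    proof (rule equivI)
      show "setoid_equal C x y \<subseteq> Hom Setoids x y \<times> Hom Setoids x y"
        by (auto simp: setoid_equal_def)
      show "refl_on (Hom Setoids x y) (setoid_equal C x y)"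
        using y.refl[OF x.carrier_obj setoid_HomD(1)] by (auto simp: setoid_equal_def refl_on_def)
      show "Relation.sym (setoid_equal C x y)"
        using y.sym by (auto simp only: setoid_equal_def sym_def mem_Collect_eq case_prod_conv)
      show "Relation.trans (setoid_equal C x y)"
        unfolding setoid_equal_def trans_def using y.trans by blast
    qed
  next
    fix x y z f f' g g'
    assume x: "x \<in> Obj Setoids" and y: "y \<in> Obj Setoids" and z: "z \<in> Obj Setoids"
      and f: "(f, f') \<in> setoid_equal C x y" and g: "(g, g') \<in> setoid_equal C y z"
    note f = setoid_equalD[OF x y f] and g = setoid_equalD[OF y z g]
    show "(Cmp Setoids x y z g f, Cmp Setoids x y z g' f') \<in> setoid_equal C x z"
      using S.Cmp_closed[OF x y z f(1) g(1)] S.Cmp_closed[OF x y z f(2) g(2)] g(4)[OF f(3)]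
      by (simp add: setoid_equal_def)
  qed
qed

end

sublocale weakly_lex_category \<subseteq> classes: category_congruence "setoid_category C" "setoid_equal C"
  by (rule setoid_congruence)

lemma setoid_class_doctrine_simps [simp]:
  "base (setoid_class_doctrine C) = quotient_category (setoid_category C) (setoid_equal C)"
  "fib (setoid_class_doctrine C) x = subset_order (compatible_sieves C x)"
  "act (setoid_class_doctrine C) x y F \<phi> = (\<Union>f\<in>F. reindex C (fst x) (fst y) f \<phi>)"
  by (simp_all add: setoid_class_doctrine_def)

context weakly_lex_category
begin

text \<open>
  Equal arrows send each element to related elements, which a compatible sieve does not separate.
\<close>

lemma Union_reindex_class:
  assumes x: "x \<in> Obj Setoids" and y: "y \<in> Obj Setoids"
    and f: "f \<in> Hom Setoids x y" and \<phi>: "\<phi> \<in> compatible_sieves C y"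
  shows "(\<Union>f'\<in>classes.cls x y f. reindex C (fst x) (fst y) f' \<phi>) = reindex C (fst x) (fst y) f \<phi>"
proof -
  interpret x: setoid C x using x by (rule setoidI)
  interpret y: setoid C y using y by (rule setoidI)
  have "reindex C (fst x) (fst y) f' \<phi> \<subseteq> reindex C (fst x) (fst y) f \<phi>" if "f' \<in> classes.cls x y f" for f'
  proof -
    have f': "(f, f') \<in> setoid_equal C x y" using that by simp
    have "(U, Cmp C U (fst x) (fst y) f' a, Cmp C U (fst x) (fst y) f a) \<in> snd y"
      if "U \<in> Obj C" "a \<in> Hom C U (fst x)" for U a
      using y.sym[OF setoid_equalD(4)[OF x y f' x.refl[OF that]]] .
    from compatible_sieveD[OF \<phi> this] show ?thesis
      by (auto simp: mem_reindex)
  qed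
  then show ?thesis
    using classes.cls_self[OF x y f] by blast
qed

text \<open>
  The elements \<open>a\<close> and \<open>a'\<close> are arrows from the discrete setoid on \<open>U\<close>. If their components are
  related, the components are equal arrows, so \<open>a\<close> and \<open>a'\<close> are equal arrows by uniqueness.
\<close>

lemma class_product_relation:
  assumes x: "x \<in> Obj Setoids" and y: "y \<in> Obj Setoids"
    and w: "is_product classes.Q x y (w, classes.cls w x p, classes.cls w y q)"
    and p: "p \<in> Hom Setoids w x" and q: "q \<in> Hom Setoids w y"
    and U: "U \<in> Obj C" "a \<in> Hom C U (fst w)" "a' \<in> Hom C U (fst w)"
    and a: "(U, Cmp C U (fst w) (fst x) p a, Cmp C U (fst w) (fst x) p a') \<in> snd x"
      "(U, Cmp C U (fst w) (fst y) q a, Cmp C U (fst w) (fst y) q a') \<in> snd y"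
  shows "(U, a, a') \<in> snd w"
proof -
  interpret Q: category classes.Q by (rule classes.quotient_category)
  have wo: "w \<in> Obj Setoids"
    using Q.product_cone(1)[OF w] by simp
  let ?u = "discrete_setoid C U"
  note u = discrete_setoid_obj[OF U(1)]
  have aH: "a \<in> Hom Setoids ?u w" "a' \<in> Hom Setoids ?u w"
    using U by (simp_all only: discrete_setoid_Hom[OF U(1) wo])
  have H: "Cmp Setoids ?u w x p a \<in> Hom Setoids ?u x"
     "Cmp Setoids ?u w x p a' \<in> Hom Setoids ?u x"
     "Cmp Setoids ?u w y q a \<in> Hom Setoids ?u y"
     "Cmp Setoids ?u w y q a' \<in> Hom Setoids ?u y"
    using aH p q u wo x y classes.Cmp_closed by blast+
  have "classes.cls ?u w a = classes.cls ?u w a'"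
  proof (rule Q.product_eqI[OF w])
    show "Cmp classes.Q ?u w x (classes.cls w x p) (classes.cls ?u w a)
        = Cmp classes.Q ?u w x (classes.cls w x p) (classes.cls ?u w a')"
      using H a(1) by (simp only: classes.Cmp_cls[OF u wo x _ p] aH classes.cls_eq_iff[OF u x])
        (simp add: setoid_equal_def)
    show "Cmp classes.Q ?u w y (classes.cls w y q) (classes.cls ?u w a)
        = Cmp classes.Q ?u w y (classes.cls w y q) (classes.cls ?u w a')"
      using H a(2) by (simp only: classes.Cmp_cls[OF u wo y _ q] aH classes.cls_eq_iff[OF u y])
        (simp add: setoid_equal_def)
  qed (use x y u aH classes.cls_closed in \<open>simp_all only: classes.Obj_Q\<close>)
  then have "(a, a') \<in> setoid_equal C ?u w"
    using classes.cls_eq_iff[OF u wo aH] by simp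
  then show ?thesis
    by (simp add: setoid_equal_def)
qed

text \<open>
  Pairings are unique up to identification because the relation of \<open>w\<close> is componentwise.
\<close>

lemma class_product:
  assumes x: "x \<in> Obj Setoids" and y: "y \<in> Obj Setoids"
    and w: "is_product Setoids x y (w, p, q)"
  shows "is_product classes.Q x y (w, classes.cls w x p, classes.cls w y q)"
  unfolding is_product_def case_prod_conv classes.Obj_Q
proof (intro conjI ballI)
  note wo = classes.product_cone[OF w]
  show "w \<in> Obj Setoids" "classes.cls w x p \<in> Hom classes.Q w x" "classes.cls w y q \<in> Hom classes.Q w y"
    using wo classes.cls_closed by blast+
  fix z F G assume z: "z \<in> Obj Setoids" and "F \<in> Hom classes.Q z x" "G \<in> Hom classes.Q z y"
  then obtain f g where f: "f \<in> Hom Setoids z x" "F = classes.cls z x f"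
    and g: "g \<in> Hom Setoids z y" "G = classes.cls z y g"
    by (elim classes.Hom_Q_E)
  interpret z: setoid C z using z by (rule setoidI)
  obtain h where h: "h \<in> Hom Setoids z w" "Cmp Setoids z w x p h = f"
      "Cmp Setoids z w y q h = g"
    using classes.product_pair[OF w z f(1) g(1)] by blast
  show "\<exists>!H. H \<in> Hom classes.Q z w \<and> Cmp classes.Q z w x (classes.cls w x p) H = F \<and>
      Cmp classes.Q z w y (classes.cls w y q) H = G"
  proof (rule ex1I)
    show "classes.cls z w h \<in> Hom classes.Q z w \<and> Cmp classes.Q z w x (classes.cls w x p) (classes.cls z w h) = F \<and>
      Cmp classes.Q z w y (classes.cls w y q) (classes.cls z w h) = G"
      using classes.cls_closed[OF h(1)] f(2) g(2) h(2,3)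
        classes.Cmp_cls[OF z wo(1) x h(1) wo(2)] classes.Cmp_cls[OF z wo(1) y h(1) wo(3)] by simp
    fix K assume K: "K \<in> Hom classes.Q z w \<and> Cmp classes.Q z w x (classes.cls w x p) K = F \<and>
      Cmp classes.Q z w y (classes.cls w y q) K = G"
    then obtain k where k: "k \<in> Hom Setoids z w" "K = classes.cls z w k"
      using classes.Hom_Q_E by blast
    have "classes.cls z x (Cmp Setoids z w x p k) = classes.cls z x f"
      "classes.cls z y (Cmp Setoids z w y q k) = classes.cls z y g"
      using K k f g classes.Cmp_cls[OF z wo(1) x k(1) wo(2)] classes.Cmp_cls[OF z wo(1) y k(1) wo(3)] by simp_all
    then have "(Cmp Setoids z w x p k, f) \<in> setoid_equal C z x"
      "(Cmp Setoids z w y q k, g) \<in> setoid_equal C z y"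
      using classes.cls_eq_iff[OF z x classes.Cmp_closed[OF z wo(1) x k(1) wo(2)] f(1)]
        classes.cls_eq_iff[OF z y classes.Cmp_closed[OF z wo(1) y k(1) wo(3)] g(1)] by blast+
    then have "(fst z, Cmp C (fst z) (fst w) (fst x) p k, Cmp C (fst z) (fst w) (fst x) p h) \<in> snd x"
      "(fst z, Cmp C (fst z) (fst w) (fst y) q k, Cmp C (fst z) (fst w) (fst y) q h) \<in> snd y"
      using h by (simp_all add: setoid_equal_def)
    then have "(fst z, k, h) \<in> snd w"
      by (intro setoid_product_relation[OF x y w z.carrier_obj setoid_HomD(1)[OF k(1)] setoid_HomD(1)[OF h(1)]])
    then have "(k, h) \<in> setoid_equal C z w"
      using k h by (simp add: setoid_equal_def)
    then show "K = classes.cls z w h"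
      using classes.cls_eq_iff[OF z wo(1) k(1) h(1)] k(2) by blast
  qed
qed

lemma class_binary_products: "has_binary_products classes.Q"
  unfolding has_binary_products_def classes.Obj_Q
proof (intro ballI)
  fix x y assume xy: "x \<in> Obj Setoids" "y \<in> Obj Setoids"
  obtain w p q where "is_product Setoids x y (w, p, q)"
    by (rule setoid_product[OF xy])
  then show "\<exists>w. is_product classes.Q x y w"
    using class_product[OF xy] by blast
qed

lemma class_leibniz:
  assumes x: "x \<in> Obj Setoids"
    and w: "is_product classes.Q x x (w, classes.cls w x p, classes.cls w x q)"
    and p: "p \<in> Hom Setoids w x" and q: "q \<in> Hom Setoids w x"
  shows "leibniz_equality (setoid_class_doctrine C) x w (classes.cls w x p) (classes.cls w x q)
    (equality_sieve C x (fst w) p q)"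
proof (rule leibnizI, unfold setoid_class_doctrine_simps subset_order_simps classes.Obj_Q)
  interpret Q: category classes.Q by (rule classes.quotient_category)
  interpret x: setoid C x using x by (rule setoidI)
  have wo: "w \<in> Obj Setoids"
    using Q.product_cone(1)[OF w] by simp
  note d = x.equality_sieve_compatible[OF wo p q]
  show "equality_sieve C x (fst w) p q \<in> compatible_sieves C w"
    by (rule d)
  show "(\<Union>h\<in>H. reindex C (fst z) (fst w) h (equality_sieve C x (fst w) p q)) = \<top>\<^bsub>subset_order (compatible_sieves C z)\<^esub>"
    if z: "z \<in> Obj Setoids" and H: "H \<in> Hom classes.Q z w"
      and eq: "Cmp classes.Q z w x (classes.cls w x p) H = Cmp classes.Q z w x (classes.cls w x q) H" for z H
  proof -
    interpret z: setoid C z using z by (rule setoidI)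
    obtain h where h: "h \<in> Hom Setoids z w" "H = classes.cls z w h"
      using H by (rule classes.Hom_Q_E)
    have "classes.cls z x (Cmp Setoids z w x p h) = classes.cls z x (Cmp Setoids z w x q h)"
      using eq classes.Cmp_cls[OF z wo x h(1) p] classes.Cmp_cls[OF z wo x h(1) q] h(2) by simp
    then have "(Cmp Setoids z w x p h, Cmp Setoids z w x q h) \<in> setoid_equal C z x"
      using classes.cls_eq_iff[OF z x classes.Cmp_closed[OF z wo x h(1) p] classes.Cmp_closed[OF z wo x h(1) q]] by blast
    then have "(fst z, Cmp C (fst z) (fst w) (fst x) p h, Cmp C (fst z) (fst w) (fst x) q h) \<in> snd x"
      by (simp add: setoid_equal_def)
    then show ?thesis
      using x.equality_sieve_refl[OF z wo h(1) p q] z.compatible_sieves_semilattice(2)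
        Union_reindex_class[OF z wo h(1) d] h(2) by simp
  qed
  fix y v S T z U U' K \<beta>
  assume y: "y \<in> Obj Setoids" and v: "is_product classes.Q y x (v, S, T)"
    and z: "z \<in> Obj Setoids" and U: "U \<in> Hom classes.Q z v"
    and U': "U' \<in> Hom classes.Q z v" and K: "K \<in> Hom classes.Q z w"
    and \<beta>: "\<beta> \<in> compatible_sieves C v"
    and e: "Cmp classes.Q z v y S U = Cmp classes.Q z v y S U'"
      "Cmp classes.Q z v x T U = Cmp classes.Q z w x (classes.cls w x p) K"
      "Cmp classes.Q z v x T U' = Cmp classes.Q z w x (classes.cls w x q) K"
  interpret y: setoid C y using y by (rule setoidI)
  interpret z: setoid C z using z by (rule setoidI)
  have vo: "v \<in> Obj Setoids"
    using Q.product_cone(1)[OF v] by simp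
  obtain s where s: "s \<in> Hom Setoids v y" "S = classes.cls v y s"
    using Q.product_cone(2)[OF v] by (rule classes.Hom_Q_E)
  obtain t where t: "t \<in> Hom Setoids v x" "T = classes.cls v x t"
    using Q.product_cone(3)[OF v] by (rule classes.Hom_Q_E)
  obtain u where u: "u \<in> Hom Setoids z v" "U = classes.cls z v u"
    using U by (rule classes.Hom_Q_E)
  obtain u' where u': "u' \<in> Hom Setoids z v" "U' = classes.cls z v u'"
    using U' by (rule classes.Hom_Q_E)
  obtain k where k: "k \<in> Hom Setoids z w" "K = classes.cls z w k"
    using K by (rule classes.Hom_Q_E)
  note S = classes.Cmp_cls[OF z vo y _ s(1)] classes.Cmp_closed[OF z vo y _ s(1)]
  note T = classes.Cmp_cls[OF z vo x _ t(1)] classes.Cmp_closed[OF z vo x _ t(1)]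
  note p' = classes.Cmp_cls[OF z wo x k(1) p] classes.Cmp_closed[OF z wo x k(1) p]
  note q' = classes.Cmp_cls[OF z wo x k(1) q] classes.Cmp_closed[OF z wo x k(1) q]
  have e1: "(Cmp Setoids z v y s u, Cmp Setoids z v y s u') \<in> setoid_equal C z y"
    using e(1) S(1)[OF u(1)] S(1)[OF u'(1)] classes.cls_eq_iff[OF z y S(2)[OF u(1)] S(2)[OF u'(1)]] s u u' by simp
  have e2: "(Cmp Setoids z v x t u, Cmp Setoids z w x p k) \<in> setoid_equal C z x"
    using e(2) T(1)[OF u(1)] p' classes.cls_eq_iff[OF z x T(2)[OF u(1)] p'(2)] t u k by simp
  have e3: "(Cmp Setoids z v x t u', Cmp Setoids z w x q k) \<in> setoid_equal C z x"
    using e(3) T(1)[OF u'(1)] q' classes.cls_eq_iff[OF z x T(2)[OF u'(1)] q'(2)] t u' k by simp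
  have "reindex C (fst z) (fst v) u \<beta> \<inter> reindex C (fst z) (fst w) k (equality_sieve C x (fst w) p q)
    \<subseteq> reindex C (fst z) (fst v) u' \<beta>"
  proof (rule x.equality_sieve_subst[OF z wo vo y p q s(1) t(1) _ u(1) u'(1) k(1) \<beta>])
    show "(V, a, a') \<in> snd v" if "V \<in> Obj C" "a \<in> Hom C V (fst v)" "a' \<in> Hom C V (fst v)"
      "(V, Cmp C V (fst v) (fst y) s a, Cmp C V (fst v) (fst y) s a') \<in> snd y"
      "(V, Cmp C V (fst v) (fst x) t a, Cmp C V (fst v) (fst x) t a') \<in> snd x" for V a a'
      using class_product_relation[OF y x v[unfolded s(2) t(2)] s(1) t(1) that] .
  qed (use e1 e2 e3 in \<open>simp_all add: setoid_equal_def\<close>)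
  then show "(\<Union>u\<in>U. reindex C (fst z) (fst v) u \<beta>) \<sqinter>\<^bsub>subset_order (compatible_sieves C z)\<^esub>
      (\<Union>k\<in>K. reindex C (fst z) (fst w) k (equality_sieve C x (fst w) p q)) \<subseteq> (\<Union>u\<in>U'. reindex C (fst z) (fst v) u \<beta>)"
    using z.compatible_sieves_semilattice(3) reindex_compatible[OF z vo u(1) \<beta>]
      reindex_compatible[OF z wo k(1) d] Union_reindex_class[OF z vo u(1) \<beta>] Union_reindex_class[OF z vo u'(1) \<beta>]
      Union_reindex_class[OF z wo k(1) d] u(2) u'(2) k(2) by simp
qed

lemma class_leibniz_doctrine: "leibniz_doctrine (setoid_class_doctrine C)"
proof
  interpret S: leibniz_doctrine "setoid_doctrine C" by (rule setoid_leibniz_doctrine)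
  have act: "act (setoid_class_doctrine C) x y (classes.cls x y f) \<phi> = act (setoid_doctrine C) x y f \<phi>"
    if "x \<in> Obj Setoids" "y \<in> Obj Setoids" "f \<in> Hom Setoids x y"
      "\<phi> \<in> compatible_sieves C y" for x y f \<phi>
    using Union_reindex_class[OF that] by simp
  have "inf_semilattice_hom (fib (setoid_class_doctrine C) y) (fib (setoid_class_doctrine C) x)
      (act (setoid_class_doctrine C) x y F)"
    if x: "x \<in> Obj Setoids" and y: "y \<in> Obj Setoids" and "F \<in> Hom classes.Q x y" for x y F
  proof -
    obtain f where f: "f \<in> Hom Setoids x y" "F = classes.cls x y f"
      using \<open>F \<in> _\<close> by (rule classes.Hom_Q_E)
    interpret y: meet_semilattice "subset_order (compatible_sieves C y)"
      using S.fib_semilattice[of y] y by simp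
    have fib: "fib (setoid_class_doctrine C) = fib (setoid_doctrine C)"
      by (simp add: setoid_class_doctrine_def setoid_doctrine_def)
    have c: "\<top>\<^bsub>fib (setoid_doctrine C) y\<^esub> \<in> compatible_sieves C y"
      "\<And>\<phi> \<psi>. \<lbrakk>\<phi> \<in> compatible_sieves C y; \<psi> \<in> compatible_sieves C y\<rbrakk> \<Longrightarrow>
        \<phi> \<sqinter>\<^bsub>fib (setoid_doctrine C) y\<^esub> \<psi> \<in> compatible_sieves C y"
      using y.top_closed y.meet_closed by simp_all
    have hom: "inf_semilattice_hom (fib (setoid_doctrine C) y) (fib (setoid_doctrine C) x) (act (setoid_doctrine C) x y f)"
      using S.act_hom[of x y f] x y f(1) by simp
    have car: "carrier (fib (setoid_doctrine C) y) = compatible_sieves C y" by simp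
    note hom' = hom[unfolded inf_semilattice_hom_def car Pi_iff]
    show ?thesis
      unfolding fib f(2) inf_semilattice_hom_def car Pi_iff
    proof (intro conjI ballI)
      fix \<phi> assume \<phi>: "\<phi> \<in> compatible_sieves C y"
      then show "act (setoid_class_doctrine C) x y (classes.cls x y f) \<phi> \<in> carrier (fib (setoid_doctrine C) x)"
        unfolding act[OF x y f(1) \<phi>] using hom' by blast
      fix \<psi> assume \<psi>: "\<psi> \<in> compatible_sieves C y"
      show "act (setoid_class_doctrine C) x y (classes.cls x y f) (\<phi> \<sqinter>\<^bsub>fib (setoid_doctrine C) y\<^esub> \<psi>) =
        act (setoid_class_doctrine C) x y (classes.cls x y f) \<phi> \<sqinter>\<^bsub>fib (setoid_doctrine C) x\<^esub>
        act (setoid_class_doctrine C) x y (classes.cls x y f) \<psi>"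
        unfolding act[OF x y f(1) \<phi>] act[OF x y f(1) \<psi>] act[OF x y f(1) c(2)[OF \<phi> \<psi>]]
        using hom' \<phi> \<psi> by blast
    next
      show "act (setoid_class_doctrine C) x y (classes.cls x y f) \<top>\<^bsub>fib (setoid_doctrine C) y\<^esub>
        = \<top>\<^bsub>fib (setoid_doctrine C) x\<^esub>"
        unfolding act[OF x y f(1) c(1)] using hom' by blast
    qed
  qed
  moreover have "act (setoid_class_doctrine C) x x (Id classes.Q x) \<phi> = \<phi>"
    if x: "x \<in> Obj Setoids" and \<phi>: "\<phi> \<in> compatible_sieves C x" for x \<phi>
    using act[OF x x classes.Id_closed[OF x] \<phi>] S.act_Id[of x \<phi>] x \<phi> unfolding classes.Id_Q by simp
  moreover have "act (setoid_class_doctrine C) x z (Cmp classes.Q x y z G F) \<phi>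
      = act (setoid_class_doctrine C) x y F (act (setoid_class_doctrine C) y z G \<phi>)"
    if x: "x \<in> Obj Setoids" and y: "y \<in> Obj Setoids" and z: "z \<in> Obj Setoids"
      and "F \<in> Hom classes.Q x y" "G \<in> Hom classes.Q y z" and \<phi>: "\<phi> \<in> compatible_sieves C z" for x y z F G \<phi>
  proof -
    obtain f where f: "f \<in> Hom Setoids x y" "F = classes.cls x y f"
      using \<open>F \<in> _\<close> by (rule classes.Hom_Q_E)
    obtain g where g: "g \<in> Hom Setoids y z" "G = classes.cls y z g"
      using \<open>G \<in> _\<close> by (rule classes.Hom_Q_E)
    have c: "act (setoid_doctrine C) y z g \<phi> \<in> compatible_sieves C y"
      using reindex_compatible[OF y z g(1) \<phi>] by simp
    show ?thesis
      unfolding f(2) g(2) classes.Cmp_cls[OF x y z f(1) g(1)] act[OF x z classes.Cmp_closed[OF x y z f(1) g(1)] \<phi>]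
        act[OF y z g(1) \<phi>] act[OF x y f(1) c]
      using S.act_Cmp[of x y z f g \<phi>] x y z f(1) g(1) \<phi> by simp
  qed
  moreover have "inf_semilattice (fib (setoid_class_doctrine C) x)" if "x \<in> Obj Setoids" for x
    using setoid.compatible_sieves_semilattice(1)[OF setoidI[OF that]] by simp
  ultimately show "is_doctrine (setoid_class_doctrine C)"
    unfolding is_doctrine_def Let_def
    using classes.quotient_category class_binary_products by simp
  show "\<exists>d. leibniz_equality (setoid_class_doctrine C) x w P Q d"
    if xb: "x \<in> Obj (base (setoid_class_doctrine C))" and w: "is_product (base (setoid_class_doctrine C)) x x (w, P, Q)" for x w P Q
  proof -
    interpret Q: category classes.Q by (rule classes.quotient_category)
    have x: "x \<in> Obj Setoids" and w: "is_product classes.Q x x (w, P, Q)"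
      using xb w by simp_all
    obtain p where p: "p \<in> Hom Setoids w x" "P = classes.cls w x p"
      using Q.product_cone(2)[OF w] by (rule classes.Hom_Q_E)
    obtain q where q: "q \<in> Hom Setoids w x" "Q = classes.cls w x q"
      using Q.product_cone(3)[OF w] by (rule classes.Hom_Q_E)
    show ?thesis
      using class_leibniz[OF x w[unfolded p(2) q(2)] p(1) q(1)] unfolding p(2) q(2) by blast
  qed
qed

end

section \<open>Weak subobjects as principal sieves\<close>

text \<open>
  A preorder that is pulled back from inclusion along \<open>s\<close>. Its poset reflection is the image of \<open>s\<close>,
  a class corresponding to the common value of \<open>s\<close> on its members.
\<close>

locale sieve_reflection =
  fixes M :: "'x set" and R :: "'x \<Rightarrow> 'x \<Rightarrow> bool" and s :: "'x \<Rightarrow> 'y set"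
  assumes le_iff: "\<lbrakk>x \<in> M; y \<in> M\<rbrakk> \<Longrightarrow> R x y \<longleftrightarrow> s x \<subseteq> s y"
begin

lemma carrier_iff: "\<alpha> \<in> carrier (poset_reflection M R) \<longleftrightarrow> (\<exists>\<phi>\<in>s ` M. \<alpha> = {x \<in> M. s x = \<phi>})"
proof -
  have "{(x, y). x \<in> M \<and> y \<in> M \<and> R x y \<and> R y x} `` {x} = {y \<in> M. s y = s x}" if "x \<in> M" for x
    using that le_iff by auto
  then show ?thesis
    unfolding poset_reflection_def quotient_def by auto
qed

lemma fibre_carrier: "\<phi> \<in> s ` M \<Longrightarrow> {x \<in> M. s x = \<phi>} \<in> carrier (poset_reflection M R)"
  using carrier_iff by blast

lemma fibre_Union: "\<phi> \<in> s ` M \<Longrightarrow> (\<Union>x\<in>{x \<in> M. s x = \<phi>}. s x) = \<phi>"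
  by auto

lemma Union_closed: "\<alpha> \<in> carrier (poset_reflection M R) \<Longrightarrow> (\<Union>x\<in>\<alpha>. s x) \<in> s ` M"
  unfolding carrier_iff by (elim bexE) (simp only: fibre_Union)

lemma eq_fibre: "\<alpha> \<in> carrier (poset_reflection M R) \<Longrightarrow> {x \<in> M. s x = (\<Union>x\<in>\<alpha>. s x)} = \<alpha>"
  unfolding carrier_iff by (elim bexE) (simp only: fibre_Union)

lemma member: "\<alpha> \<in> carrier (poset_reflection M R) \<Longrightarrow> x \<in> \<alpha> \<longleftrightarrow> x \<in> M \<and> s x = (\<Union>x\<in>\<alpha>. s x)"
  using eq_fibre by blast

lemma nonempty: "\<alpha> \<in> carrier (poset_reflection M R) \<Longrightarrow> \<exists>x. x \<in> \<alpha>"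
  unfolding carrier_iff by auto

lemma isomorphism: "order_isomorphism (poset_reflection M R) (subset_order (s ` M)) (\<lambda>\<alpha>. \<Union>x\<in>\<alpha>. s x)"
  unfolding order_isomorphism_def
proof (intro conjI ballI)
  show "eq (poset_reflection M R) = (=)"
    by (simp add: poset_reflection_def)
  show "bij_betw (\<lambda>\<alpha>. \<Union>x\<in>\<alpha>. s x) (carrier (poset_reflection M R)) (carrier (subset_order (s ` M)))"
  proof (rule bij_betwI')
    show "((\<Union>x\<in>\<alpha>. s x) = (\<Union>x\<in>\<beta>. s x)) = (\<alpha> = \<beta>)"
      if "\<alpha> \<in> carrier (poset_reflection M R)" "\<beta> \<in> carrier (poset_reflection M R)" for \<alpha> \<beta>
      using that by (metis eq_fibre)
    show "(\<Union>x\<in>\<alpha>. s x) \<in> carrier (subset_order (s ` M))" if "\<alpha> \<in> carrier (poset_reflection M R)" for \<alpha>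
      using that by (simp only: Union_closed subset_order_simps)
    show "\<exists>\<alpha>\<in>carrier (poset_reflection M R). \<phi> = (\<Union>x\<in>\<alpha>. s x)" if "\<phi> \<in> carrier (subset_order (s ` M))" for \<phi>
      using that fibre_carrier[of \<phi>] fibre_Union[of \<phi>] by (intro bexI[of _ "{x \<in> M. s x = \<phi>}"]) simp_all
  qed
  fix \<alpha> \<beta> assume \<alpha>: "\<alpha> \<in> carrier (poset_reflection M R)" and \<beta>: "\<beta> \<in> carrier (poset_reflection M R)"
  have "\<alpha> \<sqsubseteq>\<^bsub>poset_reflection M R\<^esub> \<beta> \<longleftrightarrow> (\<exists>x\<in>\<alpha>. \<exists>y\<in>\<beta>. R x y)"
    by (simp add: poset_reflection_def)
  also have "\<dots> \<longleftrightarrow> (\<exists>x\<in>\<alpha>. \<exists>y\<in>\<beta>. (\<Union>x\<in>\<alpha>. s x) \<subseteq> (\<Union>x\<in>\<beta>. s x))"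
    using member[OF \<alpha>] member[OF \<beta>] le_iff by metis
  also have "\<dots> \<longleftrightarrow> (\<Union>x\<in>\<alpha>. s x) \<subseteq> (\<Union>x\<in>\<beta>. s x)"
    using nonempty[OF \<alpha>] nonempty[OF \<beta>] by metis
  finally show "\<alpha> \<sqsubseteq>\<^bsub>poset_reflection M R\<^esub> \<beta> \<longleftrightarrow> (\<Union>x\<in>\<alpha>. s x) \<sqsubseteq>\<^bsub>subset_order (s ` M)\<^esub> (\<Union>x\<in>\<beta>. s x)"
    by simp
qed

end

definition weak_subobject_sieve :: "('o, 'a) cat \<Rightarrow> 'o \<Rightarrow> ('o \<times> 'a) set \<Rightarrow> ('o \<times> 'a) set" where
  "weak_subobject_sieve C A \<alpha> = (\<Union>(X, x)\<in>\<alpha>. generated_sieve C A X x)"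

context weakly_lex_category
begin

lemma slice_reflection:
  assumes "A \<in> Obj C"
  shows "sieve_reflection (slice_objs C A) (slice_le C A) (\<lambda>(X, x). generated_sieve C A X x)"
proof
  fix x y assume "x \<in> slice_objs C A" "y \<in> slice_objs C A"
  moreover have "x \<in> generated_sieve C A (fst y) (snd y) \<longleftrightarrow> fst x \<in> Obj C \<and>
      (\<exists>h\<in>Hom C (fst x) (fst y). Cmp C (fst x) (fst y) A (snd y) h = snd x)"
    using mem_generated_sieve[of "fst x" "snd x"] by simp
  ultimately show "slice_le C A x y \<longleftrightarrow> (\<lambda>(X, x). generated_sieve C A X x) x \<subseteq> (\<lambda>(X, x). generated_sieve C A X x) y"
    using assms generated_sieve_subset_iff[of "fst x" "snd x" A "generated_sieve C A (fst y) (snd y)"]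
      generated_sieve_principal[of "fst y" "snd y" A]
    by (simp add: slice_objs_def slice_le_def case_prod_beta mem_generated_sieve)
qed

lemma generated_sieve_image: "(\<lambda>(X, x). generated_sieve C A X x) ` slice_objs C A = principal_sieves C A"
  by (auto simp: slice_objs_def principal_sieves_def)

text \<open>
  Here objects keep their names. The sieve generated by a weak pullback of \<open>g\<close> is the preimage of the
  sieve generated by \<open>g\<close>, whichever weak pullback and whichever representative is taken; so the
  action of \<open>\<Psi>\<close> is the fibre of \<open>generated_sieve\<close> over that preimage.
\<close>

lemma weak_subobjects_relabel:
  "doctrine_relabels (weak_subobjects C) (\<lambda>A. A) (weak_subobject_sieve C) (sieve_doctrine C)"
proof -
  have act: "act (weak_subobjects C) A B f \<beta> =
      {x \<in> slice_objs C A. (\<lambda>(X, x). generated_sieve C A X x) x = reindex C A B f (weak_subobject_sieve C B \<beta>)}"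
    if A: "A \<in> Obj C" and B: "B \<in> Obj C" and f: "f \<in> Hom C A B"
      and \<beta>: "\<beta> \<in> carrier (fib (weak_subobjects C) B)" for A B f \<beta>
  proof -
    interpret A: sieve_reflection "slice_objs C A" "slice_le C A" "\<lambda>(X, x). generated_sieve C A X x"
      using A by (rule slice_reflection)
    interpret B: sieve_reflection "slice_objs C B" "slice_le C B" "\<lambda>(X, x). generated_sieve C B X x"
      using B by (rule slice_reflection)
    have \<beta>': "\<beta> \<in> carrier (poset_reflection (slice_objs C B) (slice_le C B))"
      using \<beta> by (simp add: weak_subobjects_def)
    have mem: "(Y, g) \<in> \<beta> \<longleftrightarrow> Y \<in> Obj C \<and> g \<in> Hom C Y B \<and> generated_sieve C B Y g = weak_subobject_sieve C B \<beta>" for Y g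
      using B.member[OF \<beta>', of "(Y, g)"] by (simp add: mem_slice_objs weak_subobject_sieve_def)
    obtain Y g where Y: "(Y, g) \<in> \<beta>"
      using B.nonempty[OF \<beta>'] by (metis surj_pair)
    then obtain W p q where W: "is_weak_pullback C A Y B f g W p q"
      using mem weak_pullbacks A B f unfolding has_weak_pullbacks_def by meson
    have pb: "slice_equiv C A x (W, p) \<longleftrightarrow> (\<lambda>(X, x). generated_sieve C A X x) x = reindex C A B f (weak_subobject_sieve C B \<beta>)"
      if x: "x \<in> slice_objs C A" and Yg: "(Y, g) \<in> \<beta>" and W: "is_weak_pullback C A Y B f g W p q" for x Y g W p q
    proof -
      have "(W, p) \<in> slice_objs C A"
        using W unfolding is_weak_pullback_def mem_slice_objs by blast
      then have "slice_equiv C A x (W, p) \<longleftrightarrow> (\<lambda>(X, x). generated_sieve C A X x) x = generated_sieve C A W p"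
        using A.le_iff[OF x] A.le_iff[OF _ x] unfolding slice_equiv_def by auto
      also have "generated_sieve C A W p = reindex C A B f (weak_subobject_sieve C B \<beta>)"
        using reindex_generated_sieve[OF A B f _ _ W] Yg mem by metis
      finally show ?thesis .
    qed
    have "(\<exists>(Y, g)\<in>\<beta>. \<exists>W p q. is_weak_pullback C A Y B f g W p q \<and> slice_equiv C A x (W, p)) \<longleftrightarrow>
        (\<lambda>(X, x). generated_sieve C A X x) x = reindex C A B f (weak_subobject_sieve C B \<beta>)" (is "?L \<longleftrightarrow> ?R")
      if x: "x \<in> slice_objs C A" for x
    proof
      show ?R if ?L
        using that pb[OF x] by blast
      show ?L if ?R
        using that pb[OF x Y W] W by (intro bexI[OF _ Y]) auto
    qed
    then show ?thesis
      unfolding weak_subobjects_def doctrine.select_convs by (intro Collect_cong conj_cong refl)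
  qed
  have closed: "reindex C A B f (weak_subobject_sieve C B \<beta>) \<in> (\<lambda>(X, x). generated_sieve C A X x) ` slice_objs C A"
    if A: "A \<in> Obj C" and B: "B \<in> Obj C" and f: "f \<in> Hom C A B"
      and \<beta>: "\<beta> \<in> carrier (fib (weak_subobjects C) B)" for A B f \<beta>
  proof -
    interpret B: sieve_reflection "slice_objs C B" "slice_le C B" "\<lambda>(X, x). generated_sieve C B X x"
      using B by (rule slice_reflection)
    have "\<beta> \<in> carrier (poset_reflection (slice_objs C B) (slice_le C B))"
      using \<beta> by (simp add: weak_subobjects_def)
    then have "weak_subobject_sieve C B \<beta> \<in> principal_sieves C B"
      unfolding weak_subobject_sieve_def generated_sieve_image[symmetric] by (rule B.Union_closed)
    then show ?thesis
      unfolding generated_sieve_image using reindex_principal[OF A B f] by blast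
  qed
  have "relabels C (\<lambda>A. A) C"
    by (simp add: relabels_def)
  moreover have "order_isomorphism (fib (weak_subobjects C) A) (subset_order (principal_sieves C A)) (weak_subobject_sieve C A)"
    if "A \<in> Obj C" for A
    using sieve_reflection.isomorphism[OF slice_reflection[OF that]]
    unfolding generated_sieve_image by (simp add: weak_subobjects_def weak_subobject_sieve_def[abs_def])
  moreover have "act (weak_subobjects C) A B f \<beta> \<in> carrier (fib (weak_subobjects C) A)"
    "weak_subobject_sieve C A (act (weak_subobjects C) A B f \<beta>) = reindex C A B f (weak_subobject_sieve C B \<beta>)"
    if A: "A \<in> Obj C" and "B \<in> Obj C" "f \<in> Hom C A B" "\<beta> \<in> carrier (fib (weak_subobjects C) B)" for A B f \<beta>
    unfolding act[OF that] weak_subobject_sieve_def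
    using sieve_reflection.fibre_carrier[OF slice_reflection[OF A] closed[OF that]]
      sieve_reflection.fibre_Union[OF slice_reflection[OF A] closed[OF that]]
    by (simp_all add: weak_subobjects_def weak_subobject_sieve_def)
  moreover have "base (weak_subobjects C) = C"
    by (simp add: weak_subobjects_def)
  ultimately show ?thesis
    unfolding doctrine_relabels_def Let_def by simp
qed

end

sublocale weakly_lex_category \<subseteq>
  weak: doctrine_relabeling "weak_subobjects C" "\<lambda>A. A" "weak_subobject_sieve C" "sieve_doctrine C"
  using sieve_leibniz_doctrine weak_subobjects_relabel
  by (simp add: doctrine_relabeling_def doctrine_relabeling_axioms_def)

lemma base_weak_subobjects [simp]: "base (weak_subobjects C) = C"
  by (simp add: weak_subobjects_def)

abbreviation (in weakly_lex_category) "\<Psi> \<equiv> weak_subobjects C"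

section \<open>Sieves on a square as relations\<close>

definition sieve_relation :: "('o, 'a) cat \<Rightarrow> 'o \<Rightarrow> ('o \<times> 'a) set \<Rightarrow> ('o \<times> 'a \<times> 'a) set" where
  "sieve_relation C A \<phi> = {(U, a, a'). U \<in> Obj C \<and> a \<in> Hom C U A \<and> a' \<in> Hom C U A \<and>
    (U, pairing C U A A a a') \<in> \<phi>}"

context weakly_lex_category
begin

lemma pairing_Cmp:
  assumes "A \<in> Obj C" "B \<in> Obj C" "X \<in> Obj C" "f \<in> Hom C X A" "g \<in> Hom C X B" "U \<in> Obj C" "z \<in> Hom C U X"
  shows "Cmp C U X (prd C A B) (pairing C X A B f g) z = pairing C U A B (Cmp C U X A f z) (Cmp C U X B g z)"
proof -
  note AB = chosen_product[OF binary_products assms(1,2)]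
  note ABo = product_cone[OF AB]
  note k = pairing[OF binary_products assms(1-5)]
  have fz: "Cmp C U X A f z \<in> Hom C U A" "Cmp C U X B g z \<in> Hom C U B"
    using assms Cmp_closed by auto
  note l = pairing[OF binary_products assms(1,2,6) fz]
  show ?thesis
    by (rule product_eqI[OF AB assms(1,2,6)])
      (use assms ABo k l Cmp_closed in \<open>simp_all add: Cmp_assoc[symmetric]\<close>)
qed

lemma pairing_eta:
  assumes "A \<in> Obj C" "B \<in> Obj C" "U \<in> Obj C" "w \<in> Hom C U (prd C A B)"
  shows "pairing C U A B (Cmp C U (prd C A B) A (pr1 C A B) w) (Cmp C U (prd C A B) B (pr2 C A B) w) = w"
proof -
  note AB = chosen_product[OF binary_products assms(1,2)]
  note ABo = product_cone[OF AB]
  have fz: "Cmp C U (prd C A B) A (pr1 C A B) w \<in> Hom C U A" "Cmp C U (prd C A B) B (pr2 C A B) w \<in> Hom C U B"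
    using assms ABo Cmp_closed by auto
  note l = pairing[OF binary_products assms(1-3) fz]
  show ?thesis
    by (rule product_eqI[OF AB assms(1,2,3)]) (use assms l in simp_all)
qed

lemma mem_sieve_relation:
  "(U, a, a') \<in> sieve_relation C A \<phi> \<longleftrightarrow> U \<in> Obj C \<and> a \<in> Hom C U A \<and> a' \<in> Hom C U A \<and>
    (U, pairing C U A A a a') \<in> \<phi>"
  by (simp add: sieve_relation_def)

lemma mem_reindex_pairing:
  assumes "A \<in> Obj C" "X \<in> Obj C" "f \<in> Hom C X A" "g \<in> Hom C X A" "U \<in> Obj C" "z \<in> Hom C U X"
  shows "(U, z) \<in> reindex C X (prd C A A) (pairing C X A A f g) \<phi> \<longleftrightarrow>
    (U, Cmp C U X A f z, Cmp C U X A g z) \<in> sieve_relation C A \<phi>"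
  using assms Cmp_closed by (auto simp: mem_reindex mem_sieve_relation pairing_Cmp)

lemma mem_square_sieve:
  assumes "A \<in> Obj C" "\<phi> \<in> principal_sieves C (prd C A A)" "U \<in> Obj C" "w \<in> Hom C U (prd C A A)"
  shows "(U, w) \<in> \<phi> \<longleftrightarrow> (U, Cmp C U (prd C A A) A (pr1 C A A) w, Cmp C U (prd C A A) A (pr2 C A A) w) \<in> sieve_relation C A \<phi>"
  using assms product_cone[OF chosen_product[OF binary_products assms(1,1)]] Cmp_closed
  by (auto simp: mem_sieve_relation pairing_eta)

lemma sieve_relation_principal:
  assumes A: "A \<in> Obj C" and \<phi>: "\<phi> \<in> principal_sieves C (prd C A A)"
  shows "sieve_relation C A \<phi> \<in> principal_relations C A"
proof -
  note AA = chosen_product[OF binary_products A A]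
  have "{(U, w). U \<in> Obj C \<and> w \<in> Hom C U (prd C A A) \<and>
      (U, Cmp C U (prd C A A) A (pr1 C A A) w, Cmp C U (prd C A A) A (pr2 C A A) w) \<in> sieve_relation C A \<phi>} = \<phi>"
    using principal_sieve_arrow[OF \<phi> product_cone(1)[OF AA]] by (auto simp: mem_square_sieve[OF A \<phi>, symmetric])
  then show ?thesis
    using \<phi> by (intro principal_relation_of_sieve[OF A AA]) (auto simp: mem_sieve_relation)
qed

lemma principal_relation_of_square_sieve:
  assumes A: "A \<in> Obj C" and E: "E \<in> principal_relations C A"
  shows "\<exists>\<phi>\<in>principal_sieves C (prd C A A). sieve_relation C A \<phi> = E"
proof -
  note AA = chosen_product[OF binary_products A A]
  note AAo = product_cone[OF AA]
  let ?\<phi> = "{(U, w). U \<in> Obj C \<and> w \<in> Hom C U (prd C A A) \<and>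
    (U, Cmp C U (prd C A A) A (pr1 C A A) w, Cmp C U (prd C A A) A (pr2 C A A) w) \<in> E}"
  have "(U, a, a') \<in> sieve_relation C A ?\<phi> \<longleftrightarrow> (U, a, a') \<in> E" for U a a'
    using principal_relation_arrow[OF E A, of U a a'] pairing[OF binary_products A A, of U a a']
    by (auto simp: mem_sieve_relation)
  then have "sieve_relation C A ?\<phi> = E"
    by auto
  then show ?thesis
    using principal_relation_sieve[OF AAo(1) A AAo(2,3) E] by blast
qed

text \<open>
  Every arrow into \<open>A \<times> A\<close> is the pairing of its components.
\<close>

lemma square_sieve_subset_iff:
  assumes A: "A \<in> Obj C" and \<phi>: "\<phi> \<in> principal_sieves C (prd C A A)"
  shows "\<phi> \<subseteq> \<psi> \<longleftrightarrow> (\<forall>U a a'. (U, a, a') \<in> sieve_relation C A \<phi> \<longrightarrow> (U, pairing C U A A a a') \<in> \<psi>)"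
proof
  assume "\<phi> \<subseteq> \<psi>"
  then show "\<forall>U a a'. (U, a, a') \<in> sieve_relation C A \<phi> \<longrightarrow> (U, pairing C U A A a a') \<in> \<psi>"
    by (auto simp: mem_sieve_relation)
next
  assume *: "\<forall>U a a'. (U, a, a') \<in> sieve_relation C A \<phi> \<longrightarrow> (U, pairing C U A A a a') \<in> \<psi>"
  show "\<phi> \<subseteq> \<psi>"
  proof clarify
    fix U w assume w: "(U, w) \<in> \<phi>"
    note wo = principal_sieve_arrow[OF \<phi> product_cone(1)[OF chosen_product[OF binary_products A A]] w]
    show "(U, w) \<in> \<psi>"
      using * w mem_square_sieve[OF A \<phi> wo] pairing_eta[OF A A wo] by metis
  qed
qed

end

section \<open>The quotient completion of weak subobjects\<close>

definition equivalence_setoid :: "('o, 'a) cat \<Rightarrow> 'o \<times> ('o \<times> 'a) set \<Rightarrow> 'o \<times> ('o \<times> 'a \<times> 'a) set" where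
  "equivalence_setoid C = (\<lambda>(A, \<rho>). (A, sieve_relation C A (weak_subobject_sieve C (prd C A A) \<rho>)))"

lemma fst_equivalence_setoid [simp]: "fst (equivalence_setoid C x) = fst x"
  by (simp add: equivalence_setoid_def case_prod_beta)

context weakly_lex_category
begin

lemma weak_carrier_principal:
  "\<lbrakk>A \<in> Obj C; \<alpha> \<in> carrier (fib \<Psi> A)\<rbrakk> \<Longrightarrow> weak_subobject_sieve C A \<alpha> \<in> principal_sieves C A"
  using weak.fib_closed[of A \<alpha>] by simp

lemma weak_le_iff:
  "\<lbrakk>A \<in> Obj C; \<alpha> \<in> carrier (fib \<Psi> A); \<beta> \<in> carrier (fib \<Psi> A)\<rbrakk> \<Longrightarrow>
    \<alpha> \<sqsubseteq>\<^bsub>fib \<Psi> A\<^esub> \<beta> \<longleftrightarrow> weak_subobject_sieve C A \<alpha> \<subseteq> weak_subobject_sieve C A \<beta>"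
  using weak.fib_le_iff[of A \<alpha> \<beta>] by simp

lemma weak_act:
  assumes "A \<in> Obj C" "B \<in> Obj C" "f \<in> Hom C A B" "\<beta> \<in> carrier (fib \<Psi> B)"
  shows "act \<Psi> A B f \<beta> \<in> carrier (fib \<Psi> A)"
    and "weak_subobject_sieve C A (act \<Psi> A B f \<beta>) = reindex C A B f (weak_subobject_sieve C B \<beta>)"
  using assms weak.act_closed[of A B f \<beta>] weak.fib_act[of A B f \<beta>] by simp_all

lemma weak_meet:
  assumes "A \<in> Obj C" "\<alpha> \<in> carrier (fib \<Psi> A)" "\<beta> \<in> carrier (fib \<Psi> A)"
  shows "\<alpha> \<sqinter>\<^bsub>fib \<Psi> A\<^esub> \<beta> \<in> carrier (fib \<Psi> A)"
    and "weak_subobject_sieve C A (\<alpha> \<sqinter>\<^bsub>fib \<Psi> A\<^esub> \<beta>) = weak_subobject_sieve C A \<alpha> \<inter> weak_subobject_sieve C A \<beta>"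
proof -
  interpret meet_semilattice "fib \<Psi> A"
    using weak.source_fib[of A] assms(1) by simp
  show "\<alpha> \<sqinter>\<^bsub>fib \<Psi> A\<^esub> \<beta> \<in> carrier (fib \<Psi> A)"
    using assms by simp
  show "weak_subobject_sieve C A (\<alpha> \<sqinter>\<^bsub>fib \<Psi> A\<^esub> \<beta>) = weak_subobject_sieve C A \<alpha> \<inter> weak_subobject_sieve C A \<beta>"
    using assms weak.fib_meet[of A \<alpha> \<beta>] principal_sieves_semilattice(3)[of A] weak_carrier_principal by simp
qed

text \<open>
  The equality predicate of \<open>\<Psi>\<close> is transported from the Leibniz equality of sieves.
\<close>

lemma weak_delta:
  assumes A: "A \<in> Obj C"
  shows "\<delta> \<Psi> A \<in> carrier (fib \<Psi> (prd C A A))"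
    and "sieve_relation C A (weak_subobject_sieve C (prd C A A) (\<delta> \<Psi> A)) =
      {(U, a, a'). U \<in> Obj C \<and> a \<in> Hom C U A \<and> a' = a}"
proof -
  note AA = chosen_product[OF binary_products A A]
  have d: "leibniz_equality \<Psi> A (prd C A A) (pr1 C A A) (pr2 C A A) (\<delta> \<Psi> A)"
    using weak.source.leibniz_\<delta>[of A] A by simp
  then show "\<delta> \<Psi> A \<in> carrier (fib \<Psi> (prd C A A))"
    by (rule weak.source.leibniz_closed)
  have "weak_subobject_sieve C (prd C A A) (\<delta> \<Psi> A) = {(U, w). U \<in> Obj C \<and> w \<in> Hom C U (prd C A A) \<and>
      Cmp C U (prd C A A) A (pr1 C A A) w = Cmp C U (prd C A A) A (pr2 C A A) w}"
    using weak.target.leibniz_unique[of A "prd C A A" "pr1 C A A" "pr2 C A A"] weak.leibniz_preserved[of A _ _ _ "\<delta> \<Psi> A"]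
      leibniz_sieve[OF A AA] AA A d by simp
  then show "sieve_relation C A (weak_subobject_sieve C (prd C A A) (\<delta> \<Psi> A)) =
      {(U, a, a'). U \<in> Obj C \<and> a \<in> Hom C U A \<and> a' = a}"
    using pairing[OF binary_products A A] by (auto simp: mem_sieve_relation)
qed

text \<open>
  Each of the three axioms is an inclusion of sieves, on \<open>A \<times> A\<close> or on \<open>A \<times> A \<times> A\<close>, and arrows into
  these products are pairs and triples of generalized elements of \<open>A\<close>.
\<close>

lemma P_equivalence_iff:
  assumes A: "A \<in> Obj C"
  shows "P_equivalence \<Psi> A \<rho> \<longleftrightarrow> \<rho> \<in> carrier (fib \<Psi> (prd C A A)) \<and>
    sieve_relation C A (weak_subobject_sieve C (prd C A A) \<rho>) \<in> principal_equivalences C A"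
proof (cases "\<rho> \<in> carrier (fib \<Psi> (prd C A A))")
  case False
  then show ?thesis
    by (simp add: P_equivalence_def Let_def)
next
  case \<rho>: True
  note bp = binary_products
  note AA = chosen_product[OF bp A A]
  note AAo = product_cone[OF AA]
  let ?AA = "prd C A A"
  define \<phi> where "\<phi> = weak_subobject_sieve C ?AA \<rho>"
  define E where "E = sieve_relation C A \<phi>"
  have \<phi>: "\<phi> \<in> principal_sieves C ?AA"
    unfolding \<phi>_def by (rule weak_carrier_principal[OF AAo(1) \<rho>])
  have E: "E \<in> principal_relations C A"
    unfolding E_def by (rule sieve_relation_principal[OF A \<phi>])
  have 1: "\<delta> \<Psi> A \<sqsubseteq>\<^bsub>fib \<Psi> ?AA\<^esub> \<rho> \<longleftrightarrow>
      (\<forall>U\<in>Obj C. \<forall>a\<in>Hom C U A. (U, a, a) \<in> E)"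
  proof -
    have "\<delta> \<Psi> A \<sqsubseteq>\<^bsub>fib \<Psi> ?AA\<^esub> \<rho> \<longleftrightarrow>
        weak_subobject_sieve C ?AA (\<delta> \<Psi> A) \<subseteq> \<phi>"
      unfolding \<phi>_def by (rule weak_le_iff[OF AAo(1) weak_delta(1)[OF A] \<rho>])
    also have "\<dots> \<longleftrightarrow> (\<forall>U\<in>Obj C. \<forall>a\<in>Hom C U A. (U, a, a) \<in> E)"
      unfolding square_sieve_subset_iff[OF A weak_carrier_principal[OF AAo(1) weak_delta(1)[OF A]]]
        weak_delta(2)[OF A] E_def by (auto simp: mem_sieve_relation)
    finally show ?thesis .
  qed
  have 2: "\<rho> \<sqsubseteq>\<^bsub>fib \<Psi> ?AA\<^esub>
      act \<Psi> ?AA ?AA (pairing C ?AA A A (pr2 C A A) (pr1 C A A)) \<rho> \<longleftrightarrow>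
      (\<forall>U a a'. (U, a, a') \<in> E \<longrightarrow> (U, a', a) \<in> E)"
  proof -
    note k = pairing(1)[OF bp A A AAo(1,3,2)]
    have "(U, pairing C U A A a a') \<in> reindex C ?AA ?AA (pairing C ?AA A A (pr2 C A A) (pr1 C A A)) \<phi> \<longleftrightarrow> (U, a', a) \<in> E"
      if "(U, a, a') \<in> E" for U a a'
    proof -
      have U: "U \<in> Obj C" "a \<in> Hom C U A" "a' \<in> Hom C U A" using principal_relation_arrow[OF E A that] by auto
      show ?thesis
        using mem_reindex_pairing[OF A AAo(1,3,2) U(1) pairing(1)[OF bp A A U]] pairing(2,3)[OF bp A A U]
        by (simp add: E_def)
    qed
    then show ?thesis
      unfolding weak_le_iff[OF AAo(1) \<rho> weak_act(1)[OF AAo(1) AAo(1) k \<rho>]] weak_act(2)[OF AAo(1) AAo(1) k \<rho>]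
        \<phi>_def[symmetric] square_sieve_subset_iff[OF A \<phi>] E_def[symmetric] by blast
  qed
  let ?AAA = "prd3 C A A A" and ?p1 = "pr13 C A A A" and ?p2 = "pr23 C A A A" and ?p3 = "pr33 C A A A"
  have 3: "act \<Psi> ?AAA ?AA (pairing C ?AAA A A ?p1 ?p2) \<rho> \<sqinter>\<^bsub>fib \<Psi> ?AAA\<^esub>
        act \<Psi> ?AAA ?AA (pairing C ?AAA A A ?p2 ?p3) \<rho>
      \<sqsubseteq>\<^bsub>fib \<Psi> ?AAA\<^esub> act \<Psi> ?AAA ?AA (pairing C ?AAA A A ?p1 ?p3) \<rho> \<longleftrightarrow>
      (\<forall>U a a' a''. (U, a, a') \<in> E \<longrightarrow> (U, a', a'') \<in> E \<longrightarrow> (U, a, a'') \<in> E)"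
  proof -
    have AAA: "is_product C ?AA A (?AAA, pr1 C ?AA A, pr2 C ?AA A)"
      unfolding prd3_def by (rule chosen_product[OF bp AAo(1) A])
    note AAAo = product_cone[OF AAA]
    have p: "?p1 \<in> Hom C ?AAA A" "?p2 \<in> Hom C ?AAA A" "?p3 \<in> Hom C ?AAA A"
      using AAo AAAo A unfolding pr13_def pr23_def pr33_def by (auto intro: Cmp_closed)
    note k12 = pairing(1)[OF bp A A AAAo(1) p(1,2)] and k23 = pairing(1)[OF bp A A AAAo(1) p(2,3)]
      and k13 = pairing(1)[OF bp A A AAAo(1) p(1,3)]
    note act12 = weak_act[OF AAAo(1) AAo(1) k12 \<rho>] and act23 = weak_act[OF AAAo(1) AAo(1) k23 \<rho>]
      and act13 = weak_act[OF AAAo(1) AAo(1) k13 \<rho>]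
    have "reindex C ?AAA ?AA (pairing C ?AAA A A ?p1 ?p2) \<phi> \<inter> reindex C ?AAA ?AA (pairing C ?AAA A A ?p2 ?p3) \<phi>
        \<subseteq> reindex C ?AAA ?AA (pairing C ?AAA A A ?p1 ?p3) \<phi> \<longleftrightarrow>
      (\<forall>U\<in>Obj C. \<forall>z\<in>Hom C U ?AAA. (U, Cmp C U ?AAA A ?p1 z, Cmp C U ?AAA A ?p2 z) \<in> E \<longrightarrow>
        (U, Cmp C U ?AAA A ?p2 z, Cmp C U ?AAA A ?p3 z) \<in> E \<longrightarrow> (U, Cmp C U ?AAA A ?p1 z, Cmp C U ?AAA A ?p3 z) \<in> E)"
      (is "?L \<longleftrightarrow> ?R")
    proof
      assume L: ?L
      show ?R
      proof (intro ballI impI)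
        fix U z assume U: "U \<in> Obj C" "z \<in> Hom C U ?AAA"
        note m = mem_reindex_pairing[OF A AAAo(1) p(1,2) U, of \<phi>, folded E_def]
          mem_reindex_pairing[OF A AAAo(1) p(2,3) U, of \<phi>, folded E_def]
          mem_reindex_pairing[OF A AAAo(1) p(1,3) U, of \<phi>, folded E_def]
        assume "(U, Cmp C U ?AAA A ?p1 z, Cmp C U ?AAA A ?p2 z) \<in> E" "(U, Cmp C U ?AAA A ?p2 z, Cmp C U ?AAA A ?p3 z) \<in> E"
        then show "(U, Cmp C U ?AAA A ?p1 z, Cmp C U ?AAA A ?p3 z) \<in> E"
          unfolding m[symmetric] using L by blast
      qed
    next
      assume R: ?R
      show ?L
      proof clarify
        fix U z assume z: "(U, z) \<in> reindex C ?AAA ?AA (pairing C ?AAA A A ?p1 ?p2) \<phi>"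
          "(U, z) \<in> reindex C ?AAA ?AA (pairing C ?AAA A A ?p2 ?p3) \<phi>"
        then have U: "U \<in> Obj C" "z \<in> Hom C U ?AAA" by (auto simp: mem_reindex)
        note m = mem_reindex_pairing[OF A AAAo(1) p(1,2) U, of \<phi>, folded E_def]
          mem_reindex_pairing[OF A AAAo(1) p(2,3) U, of \<phi>, folded E_def]
          mem_reindex_pairing[OF A AAAo(1) p(1,3) U, of \<phi>, folded E_def]
        show "(U, z) \<in> reindex C ?AAA ?AA (pairing C ?AAA A A ?p1 ?p3) \<phi>"
          using z R U unfolding m by blast
      qed
    qed
    also have "\<dots> \<longleftrightarrow> (\<forall>U a a' a''. (U, a, a') \<in> E \<longrightarrow> (U, a', a'') \<in> E \<longrightarrow> (U, a, a'') \<in> E)" (is "?L \<longleftrightarrow> ?R")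
    proof
      assume L: ?L
      show ?R
      proof (intro allI impI)
        fix U a a' a'' assume e: "(U, a, a') \<in> E" "(U, a', a'') \<in> E"
        have U: "U \<in> Obj C" "a \<in> Hom C U A" "a' \<in> Hom C U A" "a'' \<in> Hom C U A"
          using principal_relation_arrow[OF E A e(1)] principal_relation_arrow[OF E A e(2)] by auto
        obtain v where v: "v \<in> Hom C U ?AA" "Cmp C U ?AA A (pr1 C A A) v = a" "Cmp C U ?AA A (pr2 C A A) v = a'"
          using product_pair[OF AA U(1,2,3)] by blast
        obtain z where z: "z \<in> Hom C U ?AAA" "Cmp C U ?AAA ?AA (pr1 C ?AA A) z = v" "Cmp C U ?AAA A (pr2 C ?AA A) z = a''"
          using product_pair[OF AAA U(1) v(1) U(4)] by blast
        have "Cmp C U ?AAA A ?p1 z = a" "Cmp C U ?AAA A ?p2 z = a'" "Cmp C U ?AAA A ?p3 z = a''"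
          using z v U AAo AAAo A unfolding pr13_def pr23_def pr33_def by (simp_all add: Cmp_assoc)
        then show "(U, a, a'') \<in> E"
          using L U(1) z(1) e by metis
      qed
    qed blast
    finally show ?thesis
      unfolding weak_le_iff[OF AAAo(1) weak_meet(1)[OF AAAo(1) act12(1) act23(1)] act13(1)]
        weak_meet(2)[OF AAAo(1) act12(1) act23(1)] act12(2) act23(2) act13(2) \<phi>_def[symmetric] .
  qed
  show ?thesis
    unfolding P_equivalence_def Let_def base_weak_subobjects 1 2 3 principal_equivalences_def mem_Collect_eq
      \<phi>_def[symmetric] E_def[symmetric]
    using \<rho> E by blast
qed

lemma equivalence_category_relabels:
  "relabels (equivalence_category \<Psi>) (equivalence_setoid C) Setoids"
  unfolding relabels_def
proof (intro conjI ballI)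
  let ?R = "equivalence_category \<Psi>"
  have obj: "x \<in> Obj ?R \<longleftrightarrow> fst x \<in> Obj C \<and> snd x \<in> carrier (fib \<Psi> (prd C (fst x) (fst x))) \<and>
      equivalence_setoid C x \<in> Obj Setoids" for x
    using P_equivalence_iff[of "fst x" "snd x"]
    by (auto simp: equivalence_category_def equivalence_setoid_def case_prod_beta)
  show "equivalence_setoid C ` Obj ?R = Obj Setoids"
  proof
    show "equivalence_setoid C ` Obj ?R \<subseteq> Obj Setoids"
      using obj by blast
    show "Obj Setoids \<subseteq> equivalence_setoid C ` Obj ?R"
    proof
      fix y assume y: "y \<in> Obj Setoids"
      interpret y: setoid C y using y by (rule setoidI)
      note AAo = product_cone[OF chosen_product[OF binary_products y.carrier_obj y.carrier_obj]]
      obtain \<phi> where \<phi>: "\<phi> \<in> principal_sieves C (prd C (fst y) (fst y))" "sieve_relation C (fst y) \<phi> = snd y"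
        using principal_relation_of_square_sieve[OF y.carrier_obj y.principal] by blast
      obtain \<rho> where \<rho>: "\<rho> \<in> carrier (fib \<Psi> (prd C (fst y) (fst y)))"
        "weak_subobject_sieve C (prd C (fst y) (fst y)) \<rho> = \<phi>"
        using weak.fib_surj[of "prd C (fst y) (fst y)" \<phi>] AAo(1) \<phi>(1) by auto
      have "equivalence_setoid C (fst y, \<rho>) = y"
        using \<phi> \<rho> by (simp add: equivalence_setoid_def)
      moreover have "(fst y, \<rho>) \<in> Obj ?R"
        unfolding obj \<open>equivalence_setoid C (fst y, \<rho>) = y\<close> using y \<rho> y.carrier_obj by simp
      ultimately show "y \<in> equivalence_setoid C ` Obj ?R"
        by (metis image_eqI)
    qed
  qed
  show "Id ?R x = Id Setoids (equivalence_setoid C x)" for x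
    by (simp add: equivalence_category_def Let_def case_prod_beta)
  show "Cmp ?R x y z g f = Cmp Setoids (equivalence_setoid C x) (equivalence_setoid C y) (equivalence_setoid C z) g f" for x y z f g
    by (simp add: equivalence_category_def Let_def case_prod_beta)
  fix x y assume "x \<in> Obj ?R" "y \<in> Obj ?R"
  then have A: "fst x \<in> Obj C" and B: "fst y \<in> Obj C"
    and \<rho>: "snd x \<in> carrier (fib \<Psi> (prd C (fst x) (fst x)))"
    and \<sigma>: "snd y \<in> carrier (fib \<Psi> (prd C (fst y) (fst y)))"
    by (simp_all add: obj)
  note AAo = product_cone[OF chosen_product[OF binary_products A A]]
  note BBo = product_cone[OF chosen_product[OF binary_products B B]]
  let ?AA = "prd C (fst x) (fst x)" and ?BB = "prd C (fst y) (fst y)"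
  have "snd x \<sqsubseteq>\<^bsub>fib \<Psi> ?AA\<^esub> act \<Psi> ?AA ?BB (prd_map C (fst x) (fst y) f f) (snd y)
      \<longleftrightarrow> (\<forall>U a a'. (U, a, a') \<in> snd (equivalence_setoid C x) \<longrightarrow>
        (U, Cmp C U (fst x) (fst y) f a, Cmp C U (fst x) (fst y) f a') \<in> snd (equivalence_setoid C y))"
    if f: "f \<in> Hom C (fst x) (fst y)" for f
  proof -
    have fp: "Cmp C ?AA (fst x) (fst y) f (pr1 C (fst x) (fst x)) \<in> Hom C ?AA (fst y)"
      "Cmp C ?AA (fst x) (fst y) f (pr2 C (fst x) (fst x)) \<in> Hom C ?AA (fst y)"
      using f A B AAo Cmp_closed by auto
    have k: "prd_map C (fst x) (fst y) f f \<in> Hom C ?AA ?BB"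
      unfolding prd_map_def by (rule pairing(1)[OF binary_products B B AAo(1) fp])
    have "(U, pairing C U (fst x) (fst x) a a') \<in> reindex C ?AA ?BB (prd_map C (fst x) (fst y) f f) (weak_subobject_sieve C ?BB (snd y))
      \<longleftrightarrow> (U, Cmp C U (fst x) (fst y) f a, Cmp C U (fst x) (fst y) f a') \<in> snd (equivalence_setoid C y)"
      if U: "U \<in> Obj C" "a \<in> Hom C U (fst x)" "a' \<in> Hom C U (fst x)" for U a a'
      using mem_reindex_pairing[OF B AAo(1) fp U(1) pairing(1)[OF binary_products A A U]]
        pairing[OF binary_products A A U] A B AAo U f
      by (simp add: prd_map_def equivalence_setoid_def case_prod_beta Cmp_assoc)
    then show ?thesis
      unfolding weak_le_iff[OF AAo(1) \<rho> weak_act(1)[OF AAo(1) BBo(1) k \<sigma>]] weak_act(2)[OF AAo(1) BBo(1) k \<sigma>]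
        square_sieve_subset_iff[OF A weak_carrier_principal[OF AAo(1) \<rho>]]
      by (auto simp: equivalence_setoid_def[of C] case_prod_beta mem_sieve_relation[of _ _ _ "fst x"])
  qed
  then show "Hom ?R x y = Hom Setoids (equivalence_setoid C x) (equivalence_setoid C y)"
    by (auto simp: equivalence_category_def Let_def case_prod_beta mem_setoid_Hom)
qed

text \<open>
  The descent condition \<open>P\<^bsub>pr\<^sub>1\<^esub>(\<alpha>) \<and> \<rho> \<le> P\<^bsub>pr\<^sub>2\<^esub>(\<alpha>)\<close>, read on pairs of elements, is compatibility of the
  sieve of \<open>\<alpha>\<close> with the relation of \<open>\<rho>\<close>.
\<close>

lemma quotient_completion_relabels:
  "doctrine_relabels (quotient_completion \<Psi>) (equivalence_setoid C)
    (\<lambda>x. weak_subobject_sieve C (fst x)) (setoid_doctrine C)"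
proof -
  let ?R = "equivalence_category \<Psi>"
  interpret R: relabeling ?R "equivalence_setoid C" "Setoids"
    using setoid_category equivalence_category_relabels
    by (simp add: relabeling_def relabeling_axioms_def)
  have obj: "fst x \<in> Obj C" "snd x \<in> carrier (fib \<Psi> (prd C (fst x) (fst x)))"
    if "x \<in> Obj ?R" for x
    using that P_equivalence_iff[of "fst x" "snd x"] by (auto simp: equivalence_category_def)
  have Des: "\<alpha> \<in> carrier (Des \<Psi> (fst x) (snd x)) \<longleftrightarrow> \<alpha> \<in> carrier (fib \<Psi> (fst x)) \<and>
      weak_subobject_sieve C (fst x) \<alpha> \<in> compatible_sieves C (equivalence_setoid C x)" if x: "x \<in> Obj ?R" for x \<alpha>
  proof (cases "\<alpha> \<in> carrier (fib \<Psi> (fst x))")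
    case \<alpha>: True
    note A = obj(1)[OF x] and \<rho> = obj(2)[OF x]
    note AAo = product_cone[OF chosen_product[OF binary_products A A]]
    let ?AA = "prd C (fst x) (fst x)"
    note act1 = weak_act[OF AAo(1) A AAo(2) \<alpha>] and act2 = weak_act[OF AAo(1) A AAo(3) \<alpha>]
    let ?\<phi> = "weak_subobject_sieve C (fst x) \<alpha>"
    have mem: "(U, a, a') \<in> snd (equivalence_setoid C x) \<longleftrightarrow> U \<in> Obj C \<and> a \<in> Hom C U (fst x) \<and> a' \<in> Hom C U (fst x) \<and>
        (U, pairing C U (fst x) (fst x) a a') \<in> weak_subobject_sieve C ?AA (snd x)" for U a a'
      by (simp add: equivalence_setoid_def case_prod_beta mem_sieve_relation)
    have "\<alpha> \<in> carrier (Des \<Psi> (fst x) (snd x)) \<longleftrightarrow>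
        act \<Psi> ?AA (fst x) (pr1 C (fst x) (fst x)) \<alpha> \<sqinter>\<^bsub>fib \<Psi> ?AA\<^esub> snd x
          \<sqsubseteq>\<^bsub>fib \<Psi> ?AA\<^esub> act \<Psi> ?AA (fst x) (pr2 C (fst x) (fst x)) \<alpha>"
      using \<alpha> by (simp add: Des_def Let_def)
    also have "\<dots> \<longleftrightarrow> reindex C ?AA (fst x) (pr1 C (fst x) (fst x)) ?\<phi> \<inter> weak_subobject_sieve C ?AA (snd x)
        \<subseteq> reindex C ?AA (fst x) (pr2 C (fst x) (fst x)) ?\<phi>"
      unfolding weak_le_iff[OF AAo(1) weak_meet(1)[OF AAo(1) act1(1) \<rho>] act2(1)] weak_meet(2)[OF AAo(1) act1(1) \<rho>]
        act1(2) act2(2) ..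
    also have "\<dots> \<longleftrightarrow> (\<forall>U a a'. (U, a, a') \<in> snd (equivalence_setoid C x) \<longrightarrow> (U, a) \<in> ?\<phi> \<longrightarrow> (U, a') \<in> ?\<phi>)" (is "?L \<longleftrightarrow> ?R")
    proof
      assume L: ?L
      show ?R
      proof (intro allI impI)
        fix U a a' assume aa: "(U, a, a') \<in> snd (equivalence_setoid C x)" and a: "(U, a) \<in> ?\<phi>"
        have U: "U \<in> Obj C" "a \<in> Hom C U (fst x)" "a' \<in> Hom C U (fst x)"
          and w: "(U, pairing C U (fst x) (fst x) a a') \<in> weak_subobject_sieve C ?AA (snd x)"
          using aa unfolding mem by auto
        note k = pairing[OF binary_products A A U]
        have "(U, pairing C U (fst x) (fst x) a a') \<in> reindex C ?AA (fst x) (pr1 C (fst x) (fst x)) ?\<phi>"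
          using U k a by (simp add: mem_reindex)
        then have "(U, pairing C U (fst x) (fst x) a a') \<in> reindex C ?AA (fst x) (pr2 C (fst x) (fst x)) ?\<phi>"
          using L w by blast
        then show "(U, a') \<in> ?\<phi>"
          using k by (simp add: mem_reindex)
      qed
    next
      assume R: ?R
      show ?L
      proof clarify
        fix U w assume w1: "(U, w) \<in> reindex C ?AA (fst x) (pr1 C (fst x) (fst x)) ?\<phi>"
          and w: "(U, w) \<in> weak_subobject_sieve C ?AA (snd x)"
        have U: "U \<in> Obj C" "w \<in> Hom C U ?AA" using w1 by (auto simp: mem_reindex)
        have "(U, Cmp C U ?AA (fst x) (pr1 C (fst x) (fst x)) w, Cmp C U ?AA (fst x) (pr2 C (fst x) (fst x)) w)
            \<in> snd (equivalence_setoid C x)"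
          unfolding mem pairing_eta[OF A A U] using U w A AAo Cmp_closed by auto
        then show "(U, w) \<in> reindex C ?AA (fst x) (pr2 C (fst x) (fst x)) ?\<phi>"
          using R w1 by (auto simp: mem_reindex)
      qed
    qed
    also have "\<dots> \<longleftrightarrow> ?\<phi> \<in> compatible_sieves C (equivalence_setoid C x)"
      using weak_carrier_principal[OF A \<alpha>] by (simp add: compatible_sieves_def)
    finally show ?thesis using \<alpha> by simp
  qed (simp add: Des_def Let_def)
  have le: "\<alpha> \<sqsubseteq>\<^bsub>Des \<Psi> A \<rho>\<^esub> \<beta> \<longleftrightarrow> \<alpha> \<sqsubseteq>\<^bsub>fib \<Psi> A\<^esub> \<beta>" for A \<rho> \<alpha> \<beta>
    by (simp add: Des_def Let_def)
  have iso: "order_isomorphism (Des \<Psi> (fst x) (snd x)) (subset_order (compatible_sieves C (equivalence_setoid C x)))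
      (weak_subobject_sieve C (fst x))" if x: "x \<in> Obj ?R" for x
    unfolding order_isomorphism_def
  proof (intro conjI ballI)
    note A = obj(1)[OF x]
    show "eq (Des \<Psi> (fst x) (snd x)) = (=)"
      by (simp add: Des_def Let_def weak_subobjects_def poset_reflection_def)
    show "bij_betw (weak_subobject_sieve C (fst x)) (carrier (Des \<Psi> (fst x) (snd x)))
        (carrier (subset_order (compatible_sieves C (equivalence_setoid C x))))"
    proof (rule bij_betwI')
      show "(weak_subobject_sieve C (fst x) \<alpha> = weak_subobject_sieve C (fst x) \<beta>) = (\<alpha> = \<beta>)"
        if "\<alpha> \<in> carrier (Des \<Psi> (fst x) (snd x))" "\<beta> \<in> carrier (Des \<Psi> (fst x) (snd x))" for \<alpha> \<beta>
        using that weak.fib_inj[of "fst x" \<alpha> \<beta>] A unfolding Des[OF x] by auto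
      show "weak_subobject_sieve C (fst x) \<alpha> \<in> carrier (subset_order (compatible_sieves C (equivalence_setoid C x)))"
        if "\<alpha> \<in> carrier (Des \<Psi> (fst x) (snd x))" for \<alpha>
        using that unfolding Des[OF x] by simp
      show "\<exists>\<alpha>\<in>carrier (Des \<Psi> (fst x) (snd x)). \<phi> = weak_subobject_sieve C (fst x) \<alpha>"
        if "\<phi> \<in> carrier (subset_order (compatible_sieves C (equivalence_setoid C x)))" for \<phi>
        using that weak.fib_surj[of "fst x" \<phi>] A compatible_sieve_principal[of \<phi> C "equivalence_setoid C x"] Des[OF x] by auto
    qed
    show "(\<alpha> \<sqsubseteq>\<^bsub>Des \<Psi> (fst x) (snd x)\<^esub> \<beta>) = (weak_subobject_sieve C (fst x) \<alpha>
        \<sqsubseteq>\<^bsub>subset_order (compatible_sieves C (equivalence_setoid C x))\<^esub> weak_subobject_sieve C (fst x) \<beta>)"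
      if "\<alpha> \<in> carrier (Des \<Psi> (fst x) (snd x))" "\<beta> \<in> carrier (Des \<Psi> (fst x) (snd x))" for \<alpha> \<beta>
      using that weak_le_iff[OF A, of \<alpha> \<beta>] unfolding Des[OF x] by (simp add: le)
  qed
  have act: "act \<Psi> (fst x) (fst y) f \<beta> \<in> carrier (Des \<Psi> (fst x) (snd x))"
    "weak_subobject_sieve C (fst x) (act \<Psi> (fst x) (fst y) f \<beta>)
      = reindex C (fst x) (fst y) f (weak_subobject_sieve C (fst y) \<beta>)"
    if x: "x \<in> Obj ?R" and y: "y \<in> Obj ?R" and f: "f \<in> Hom ?R x y"
      and \<beta>: "\<beta> \<in> carrier (Des \<Psi> (fst y) (snd y))" for x y f \<beta>
  proof -
    have fH: "f \<in> Hom Setoids (equivalence_setoid C x) (equivalence_setoid C y)"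
      using f x y R.hom by blast
    have f': "f \<in> Hom C (fst x) (fst y)"
      using setoid_HomD(1)[OF fH] by simp
    note act = weak_act[OF obj(1)[OF x] obj(1)[OF y] f']
    show "weak_subobject_sieve C (fst x) (act \<Psi> (fst x) (fst y) f \<beta>)
      = reindex C (fst x) (fst y) f (weak_subobject_sieve C (fst y) \<beta>)"
      using act(2) \<beta> unfolding Des[OF y] by blast
    then show "act \<Psi> (fst x) (fst y) f \<beta> \<in> carrier (Des \<Psi> (fst x) (snd x))"
      using act(1) \<beta> reindex_compatible[OF R.obj[OF x] R.obj[OF y] fH, of "weak_subobject_sieve C (fst y) \<beta>"]
      unfolding Des[OF y] Des[OF x] by simp
  qed
  show ?thesis
    unfolding doctrine_relabels_def Let_def
    using equivalence_category_relabels iso act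
    by (simp add: quotient_completion_def case_prod_beta)
qed

end

section \<open>The extensional collapse\<close>

lemma relabels_quotient_category:
  assumes "category_congruence D E'" and "relabels C s D"
    and E: "\<And>X Y. \<lbrakk>X \<in> Obj C; Y \<in> Obj C\<rbrakk> \<Longrightarrow> E X Y = E' (s X) (s Y)"
  shows "relabels (quotient_category C E) s (quotient_category D E')"
proof -
  interpret D: category_congruence D E' by fact
  interpret relabeling C s D
    using assms(2) by unfold_locales
  have "Cmp C X Y Z g f = Cmp D (s X) (s Y) (s Z) g f"
    if o: "X \<in> Obj C" "Y \<in> Obj C" "Z \<in> Obj C"
      and FG: "F \<in> Hom D (s X) (s Y) // E' (s X) (s Y)" "G \<in> Hom D (s Y) (s Z) // E' (s Y) (s Z)"
      and fg: "f \<in> F" "g \<in> G" for X Y Z F G f g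
  proof (rule cmp[OF o])
    show "f \<in> Hom D (s X) (s Y)"
      using in_quotient_imp_subset[OF D.equivalence[OF obj[OF o(1)] obj[OF o(2)]] FG(1)] fg by blast
    show "g \<in> Hom D (s Y) (s Z)"
      using in_quotient_imp_subset[OF D.equivalence[OF obj[OF o(2)] obj[OF o(3)]] FG(2)] fg by blast
  qed
  then have "{Cmp C X Y Z g f | g f. g \<in> G \<and> f \<in> F} = {Cmp D (s X) (s Y) (s Z) g f | g f. g \<in> G \<and> f \<in> F}"
    if "X \<in> Obj C" "Y \<in> Obj C" "Z \<in> Obj C"
      and "F \<in> Hom D (s X) (s Y) // E' (s X) (s Y)" "G \<in> Hom D (s Y) (s Z) // E' (s Y) (s Z)" for X Y Z F G
    using that by (intro Collect_cong ex_cong1) metis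
  then show ?thesis
    unfolding relabels_def using obj_image by (simp add: quotient_category_def E id hom)
qed

context weakly_lex_category
begin

text \<open>
  The equality predicates of \<open>x\<close> and \<open>y\<close> are their relations, so the condition of the extensional
  collapse reads: if \<open>a\<close> and \<open>a'\<close> are related, then so are \<open>f a\<close> and \<open>f' a'\<close>. As \<open>f\<close> preserves the
  relation, it is enough to have this at the generic element, where it says that \<open>f\<close> and \<open>f'\<close> are
  related.
\<close>

lemma ext_le_iff:
  assumes P: "doctrine_relabeling P s b (setoid_doctrine C)"
    and x: "x \<in> Obj (base P)" and y: "y \<in> Obj (base P)"
    and f: "f \<in> Hom Setoids (s x) (s y)" and f': "f' \<in> Hom Setoids (s x) (s y)"
  shows "ext_le P x y f f' \<longleftrightarrow> (f, f') \<in> setoid_equal C (s x) (s y)"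
proof -
  interpret P: doctrine_relabeling P s b "setoid_doctrine C" by (rule P)
  have sobj: "s z \<in> Obj Setoids" if "z \<in> Obj (base P)" for z
    using P.obj[OF that] by simp
  have hom: "Hom (base P) z z' = Hom Setoids (s z) (s z')" if "z \<in> Obj (base P)" "z' \<in> Obj (base P)" for z z'
    using P.hom[OF that] by simp
  define w where "w = prd (base P) x x"
  define v where "v = prd (base P) y y"
  define p where "p = pr1 (base P) x x"
  define q where "q = pr2 (base P) x x"
  define p' where "p' = pr1 (base P) y y"
  define q' where "q' = pr2 (base P) y y"
  note bp = P.source.binary_products
  have w: "is_product (base P) x x (w, p, q)"
    unfolding w_def p_def q_def by (rule P.source.chosen_product[OF bp x x])
  have v: "is_product (base P) y y (v, p', q')"
    unfolding v_def p'_def q'_def by (rule P.source.chosen_product[OF bp y y])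
  note wo = P.source.product_cone[OF w] and vo = P.source.product_cone[OF v]
  have delta: "\<delta> P z \<in> carrier (fib P u)" "b u (\<delta> P z) = equality_sieve C (s z) (fst (s u)) r t"
    if z: "z \<in> Obj (base P)" and u: "u = prd (base P) z z" "r = pr1 (base P) z z" "t = pr2 (base P) z z" for z u r t
  proof -
    have U: "is_product (base P) z z (u, r, t)"
      unfolding u by (rule P.source.chosen_product[OF bp z z])
    have SU: "is_product Setoids (s z) (s z) (s u, r, t)"
      using P.is_product_iff[OF z z P.source.product_cone(1)[OF U]] U by simp
    have d: "leibniz_equality P z u r t (\<delta> P z)"
      unfolding u by (rule P.source.leibniz_\<delta>[OF z])
    then show "\<delta> P z \<in> carrier (fib P u)"
      by (rule P.source.leibniz_closed)
    show "b u (\<delta> P z) = equality_sieve C (s z) (fst (s u)) r t"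
      using P.target.leibniz_unique[of "s z" "s u" r t, OF _ _ P.leibniz_preserved[OF z U d] setoid_leibniz[OF sobj[OF z] SU]]
        SU sobj[OF z] by simp
  qed
  note dx = delta[OF x w_def p_def q_def] and dy = delta[OF y v_def p'_def q'_def]
  interpret sx: setoid C "s x" using sobj[OF x] by (rule setoidI)
  interpret sy: setoid C "s y" using sobj[OF y] by (rule setoidI)
  have pH: "p \<in> Hom Setoids (s w) (s x)" "q \<in> Hom Setoids (s w) (s x)"
    "p' \<in> Hom Setoids (s v) (s y)" "q' \<in> Hom Setoids (s v) (s y)"
    using wo vo x y hom by simp_all
  have w': "fst (s w) \<in> Obj C" and v': "fst (s v) \<in> Obj C"
    using sobj[OF wo(1)] sobj[OF vo(1)] by simp_all
  have pC: "p \<in> Hom C (fst (s w)) (fst (s x))" "q \<in> Hom C (fst (s w)) (fst (s x))"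
    "p' \<in> Hom C (fst (s v)) (fst (s y))" "q' \<in> Hom C (fst (s v)) (fst (s y))"
    "f \<in> Hom C (fst (s x)) (fst (s y))" "f' \<in> Hom C (fst (s x)) (fst (s y))"
    by (rule setoid_HomD(1), rule pH f f')+
  have fp: "Cmp (base P) w x y f p \<in> Hom (base P) w y" "Cmp (base P) w x y f' q \<in> Hom (base P) w y"
    using P.source.Cmp_closed[OF wo(1) x y] wo f f' hom[OF x y] by auto
  have fpC: "Cmp (base P) w x y f p = Cmp C (fst (s w)) (fst (s x)) (fst (s y)) f p"
    "Cmp (base P) w x y f' q = Cmp C (fst (s w)) (fst (s x)) (fst (s y)) f' q"
    using P.cmp[OF wo(1) x y] pH f f' by simp_all
  define k where "k = prd_map (base P) x y f f'"
  note k = P.source.pairing[OF bp y y wo(1) fp, folded v_def p'_def q'_def w_def p_def q_def,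
      folded prd_map_def[of "base P" x y f f', folded w_def p_def q_def] k_def]
  have kH: "k \<in> Hom Setoids (s w) (s v)"
    using k(1) hom[OF wo(1) vo(1)] by simp
  have kC: "k \<in> Hom C (fst (s w)) (fst (s v))"
    "Cmp C (fst (s w)) (fst (s v)) (fst (s y)) p' k = Cmp C (fst (s w)) (fst (s x)) (fst (s y)) f p"
    "Cmp C (fst (s w)) (fst (s v)) (fst (s y)) q' k = Cmp C (fst (s w)) (fst (s x)) (fst (s y)) f' q"
    using setoid_HomD(1)[OF kH] k(2,3) fpC P.cmp[OF wo(1) vo(1) y] kH pH by simp_all
  have "ext_le P x y f f' \<longleftrightarrow> \<delta> P x \<sqsubseteq>\<^bsub>fib P w\<^esub> act P w v k (\<delta> P y)"
    unfolding ext_le_def Let_def w_def v_def k_def ..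
  also have "\<dots> \<longleftrightarrow> equality_sieve C (s x) (fst (s w)) p q \<subseteq>
      reindex C (fst (s w)) (fst (s v)) k (equality_sieve C (s y) (fst (s v)) p' q')"
    using P.fib_le_iff[OF wo(1) dx(1) P.act_closed[OF wo(1) vo(1) _ dy(1)], of k]
      P.fib_act[OF wo(1) vo(1) _ dy(1), of k] kH dx(2) dy(2) by simp
  also have "\<dots> \<longleftrightarrow> (f, f') \<in> setoid_equal C (s x) (s y)"
  proof
    assume L: "equality_sieve C (s x) (fst (s w)) p q \<subseteq>
      reindex C (fst (s w)) (fst (s v)) k (equality_sieve C (s y) (fst (s v)) p' q')"
    \<comment> \<open>Along the diagonal the inclusion specializes to the pair \<open>(f, f')\<close>.\<close>
    obtain d where d: "d \<in> Hom (base P) x w" "Cmp (base P) x w x p d = Id (base P) x" "Cmp (base P) x w x q d = Id (base P) x"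
      using P.source.product_pair[OF w x P.source.Id_closed[OF x] P.source.Id_closed[OF x]] by blast
    have dH: "d \<in> Hom Setoids (s x) (s w)"
      using d(1) hom[OF x wo(1)] by simp
    have dC: "d \<in> Hom C (fst (s x)) (fst (s w))" "Cmp C (fst (s x)) (fst (s w)) (fst (s x)) p d = Id C (fst (s x))"
      "Cmp C (fst (s x)) (fst (s w)) (fst (s x)) q d = Id C (fst (s x))"
      using setoid_HomD(1)[OF dH] d(2,3) P.cmp[OF x wo(1) x] P.id[OF x] dH pH by simp_all
    have "(fst (s x), d) \<in> equality_sieve C (s x) (fst (s w)) p q"
      using dC sx.carrier_obj sx.refl Id_closed by (simp add: mem_equality_sieve)
    then have "(fst (s x), d) \<in> reindex C (fst (s w)) (fst (s v)) k (equality_sieve C (s y) (fst (s v)) p' q')"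
      using L by blast
    then have "(fst (s x), Cmp C (fst (s x)) (fst (s v)) (fst (s y)) p' (Cmp C (fst (s x)) (fst (s w)) (fst (s v)) k d),
        Cmp C (fst (s x)) (fst (s v)) (fst (s y)) q' (Cmp C (fst (s x)) (fst (s w)) (fst (s v)) k d)) \<in> snd (s y)"
      by (simp add: mem_reindex mem_equality_sieve)
    then have "(fst (s x), Cmp C (fst (s x)) (fst (s w)) (fst (s y)) (Cmp C (fst (s w)) (fst (s x)) (fst (s y)) f p) d,
        Cmp C (fst (s x)) (fst (s w)) (fst (s y)) (Cmp C (fst (s w)) (fst (s x)) (fst (s y)) f' q) d) \<in> snd (s y)"
      using sx.carrier_obj sy.carrier_obj w' v' dC(1) kC pC by (simp add: Cmp_assoc[symmetric])
    then have "(fst (s x), f, f') \<in> snd (s y)"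
      using sx.carrier_obj sy.carrier_obj w' dC pC by (simp add: Cmp_assoc Cmp_Id_right)
    then show "(f, f') \<in> setoid_equal C (s x) (s y)"
      using f f' by (simp add: setoid_equal_def)
  next
    assume eq: "(f, f') \<in> setoid_equal C (s x) (s y)"
    show "equality_sieve C (s x) (fst (s w)) p q \<subseteq>
      reindex C (fst (s w)) (fst (s v)) k (equality_sieve C (s y) (fst (s v)) p' q')"
    proof clarify
      fix U a assume "(U, a) \<in> equality_sieve C (s x) (fst (s w)) p q"
      then have U: "U \<in> Obj C" "a \<in> Hom C U (fst (s w))"
        and e: "(U, Cmp C U (fst (s w)) (fst (s x)) p a, Cmp C U (fst (s w)) (fst (s x)) q a) \<in> snd (s x)"
        by (simp_all add: mem_equality_sieve)
      have "Cmp C U (fst (s x)) (fst (s y)) f (Cmp C U (fst (s w)) (fst (s x)) p a)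
          = Cmp C U (fst (s v)) (fst (s y)) p' (Cmp C U (fst (s w)) (fst (s v)) k a)"
        "Cmp C U (fst (s x)) (fst (s y)) f' (Cmp C U (fst (s w)) (fst (s x)) q a)
          = Cmp C U (fst (s v)) (fst (s y)) q' (Cmp C U (fst (s w)) (fst (s v)) k a)"
        using sx.carrier_obj sy.carrier_obj w' v' U kC pC by (simp_all add: Cmp_assoc[symmetric])
      then show "(U, a) \<in> reindex C (fst (s w)) (fst (s v)) k (equality_sieve C (s y) (fst (s v)) p' q')"
        using setoid_equalD(4)[OF sobj[OF x] sobj[OF y] eq e] U kC(1) w' v' Cmp_closed
        by (simp add: mem_reindex mem_equality_sieve)
    qed
  qed
  finally show ?thesis .
qed

text \<open>
  Since each arrow of setoids is related to itself, the restriction to extensional arrows changes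
  nothing, and only the identification of arrows remains.
\<close>

lemma extensional_collapse_relabels:
  assumes P: "doctrine_relabeling P s b (setoid_doctrine C)"
  shows "doctrine_relabels (extensional_collapse P) s b (setoid_class_doctrine C)"
proof -
  interpret P: doctrine_relabeling P s b "setoid_doctrine C" by (rule P)
  let ?D = "(base P)\<lparr>Hom := \<lambda>x y. {f \<in> Hom (base P) x y. ext_le P x y f f}\<rparr>"
  have sobj: "s z \<in> Obj Setoids" if "z \<in> Obj (base P)" for z
    using P.obj[OF that] by simp
  have hom: "Hom (base P) x y = Hom Setoids (s x) (s y)" if "x \<in> Obj (base P)" "y \<in> Obj (base P)" for x y
    using P.hom[OF that] by simp
  have Hom: "{f \<in> Hom (base P) x y. ext_le P x y f f} = Hom Setoids (s x) (s y)"
    if x: "x \<in> Obj (base P)" and y: "y \<in> Obj (base P)" for x y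
  proof -
    interpret sx: setoid C "s x" using sobj[OF x] by (rule setoidI)
    interpret sy: setoid C "s y" using sobj[OF y] by (rule setoidI)
    have "(f, f) \<in> setoid_equal C (s x) (s y)" if "f \<in> Hom Setoids (s x) (s y)" for f
      using that sy.refl[OF sx.carrier_obj setoid_HomD(1)[OF that]] by (simp add: setoid_equal_def)
    then show ?thesis
      using ext_le_iff[OF P x y] hom[OF x y] by blast
  qed
  have rel: "relabels (base P) s Setoids"
    using P.relabels by simp
  have relD: "relabels ?D s Setoids"
    using rel unfolding relabels_def by (simp add: Hom hom[symmetric])
  have "{(f, f'). f \<in> Hom ?D x y \<and> f' \<in> Hom ?D x y \<and> ext_le P x y f f'} = setoid_equal C (s x) (s y)"
    if x: "x \<in> Obj ?D" and y: "y \<in> Obj ?D" for x y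
    using x y ext_le_iff[OF P, of x y] by (auto simp: Hom setoid_equal_def)
  then have coll: "relabels (collapse_category P) s classes.Q"
    unfolding collapse_category_def Let_def
    by (intro relabels_quotient_category[OF setoid_congruence relD]) 
  have base: "Obj (collapse_category P) = Obj (base P)"
    by (simp add: collapse_category_def quotient_category_def Let_def)
  have act: "act P x y (SOME f. f \<in> F) \<beta> \<in> carrier (fib P x)"
    "b x (act P x y (SOME f. f \<in> F) \<beta>) = (\<Union>f\<in>F. reindex C (fst (s x)) (fst (s y)) f (b y \<beta>))"
    if x: "x \<in> Obj (base P)" and y: "y \<in> Obj (base P)" and F: "F \<in> Hom classes.Q (s x) (s y)"
      and \<beta>: "\<beta> \<in> carrier (fib P y)" for x y F \<beta>
  proof -
    obtain g where g: "g \<in> Hom Setoids (s x) (s y)" "F = classes.cls (s x) (s y) g"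
      using F by (rule classes.Hom_Q_E)
    define f where "f = (SOME f. f \<in> F)"
    have "f \<in> F"
      unfolding f_def by (rule someI[of _ g]) (simp only: g(2) classes.cls_self[OF sobj[OF x] sobj[OF y] g(1)])
    then have gf: "(g, f) \<in> setoid_equal C (s x) (s y)"
      using g(2) by simp
    have fH: "f \<in> Hom Setoids (s x) (s y)"
      using setoid_equalD(2)[OF sobj[OF x] sobj[OF y] gf] .
    have F': "F = classes.cls (s x) (s y) f"
      using gf classes.cls_eq_iff[OF sobj[OF x] sobj[OF y] g(1) fH] g(2) by simp
    show "act P x y (SOME f. f \<in> F) \<beta> \<in> carrier (fib P x)"
      using P.act_closed[OF x y _ \<beta>, of f] fH unfolding f_def[symmetric] by simp
    show "b x (act P x y (SOME f. f \<in> F) \<beta>) = (\<Union>f\<in>F. reindex C (fst (s x)) (fst (s y)) f (b y \<beta>))"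
      using P.fib_act[OF x y _ \<beta>, of f] fH P.fib_closed[OF y \<beta>]
        Union_reindex_class[OF sobj[OF x] sobj[OF y] fH, of "b y \<beta>"]
      unfolding f_def[symmetric] unfolding F' by simp
  qed
  interpret coll: relabeling "collapse_category P" s classes.Q
    using classes.quotient_category coll by (simp add: relabeling_def relabeling_axioms_def)
  show ?thesis
    using coll act coll.hom P.doctrine_relabels
    unfolding doctrine_relabels_def Let_def by (simp add: extensional_collapse_def base)
qed

end

section \<open>Subobjects of setoids as compatible sieves\<close>

text \<open>
  For a subobject \<open>M\<close> of \<open>y\<close> this is the sieve that represents it. All representatives of \<open>M\<close> give
  the same elements, and ranging over them avoids a choice.
\<close>

definition image_sieve ::
  "('o, 'a) cat \<Rightarrow> 'o \<times> ('o \<times> 'a \<times> 'a) set \<Rightarrow> 'o \<times> ('o \<times> 'a \<times> 'a) set \<Rightarrow> 'a set \<Rightarrow> ('o \<times> 'a) set" where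
  "image_sieve C x y M = {(U, a). U \<in> Obj C \<and> a \<in> Hom C U (fst y) \<and>
    (\<exists>m\<in>M. \<exists>c\<in>Hom C U (fst x). (U, Cmp C U (fst x) (fst y) m c, a) \<in> snd y)}"

context weakly_lex_category
begin

lemma mem_image_sieve:
  assumes x: "x \<in> Obj Setoids" and y: "y \<in> Obj Setoids"
    and m: "m \<in> Hom Setoids x y"
  shows "(U, a) \<in> image_sieve C x y (classes.cls x y m) \<longleftrightarrow> U \<in> Obj C \<and> a \<in> Hom C U (fst y) \<and>
    (\<exists>c\<in>Hom C U (fst x). (U, Cmp C U (fst x) (fst y) m c, a) \<in> snd y)"
proof -
  interpret x: setoid C x using x by (rule setoidI)
  interpret y: setoid C y using y by (rule setoidI)
  have "(U, Cmp C U (fst x) (fst y) m c, a) \<in> snd y"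
    if "U \<in> Obj C" "c \<in> Hom C U (fst x)" "m' \<in> classes.cls x y m" "(U, Cmp C U (fst x) (fst y) m' c, a) \<in> snd y" for m' c
    using y.trans[OF setoid_equalD(4)[OF x y classes.cls_memD[OF x y that(3)] x.refl[OF that(1,2)]] that(4)] .
  then show ?thesis
    unfolding image_sieve_def using classes.cls_self[OF x y m] by blast
qed

text \<open>
  Monic arrows are the ones that reflect the relation; testing against discrete setoids shows
  necessity.
\<close>

lemma class_mono_iff:
  assumes x: "x \<in> Obj Setoids" and y: "y \<in> Obj Setoids"
    and m: "m \<in> Hom Setoids x y"
  shows "is_mono classes.Q x y (classes.cls x y m) \<longleftrightarrow>
    (\<forall>U\<in>Obj C. \<forall>c\<in>Hom C U (fst x). \<forall>c'\<in>Hom C U (fst x).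
      (U, Cmp C U (fst x) (fst y) m c, Cmp C U (fst x) (fst y) m c') \<in> snd y \<longrightarrow> (U, c, c') \<in> snd x)"
    (is "?L \<longleftrightarrow> ?R")
proof
  assume L: ?L
  show ?R
  proof (intro ballI impI)
    fix U c c' assume U: "U \<in> Obj C" "c \<in> Hom C U (fst x)" "c' \<in> Hom C U (fst x)"
      and e: "(U, Cmp C U (fst x) (fst y) m c, Cmp C U (fst x) (fst y) m c') \<in> snd y"
    let ?u = "discrete_setoid C U"
    note u = discrete_setoid_obj[OF U(1)]
    have c: "c \<in> Hom Setoids ?u x" "c' \<in> Hom Setoids ?u x"
      using U by (simp_all only: discrete_setoid_Hom[OF U(1) x])
    have "(Cmp Setoids ?u x y m c, Cmp Setoids ?u x y m c') \<in> setoid_equal C ?u y"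
      using e classes.Cmp_closed[OF u x y c(1) m] classes.Cmp_closed[OF u x y c(2) m] by (simp add: setoid_equal_def)
    then have "Cmp classes.Q ?u x y (classes.cls x y m) (classes.cls ?u x c)
        = Cmp classes.Q ?u x y (classes.cls x y m) (classes.cls ?u x c')"
      unfolding classes.Cmp_cls[OF u x y c(1) m] classes.Cmp_cls[OF u x y c(2) m]
      using classes.cls_eq_iff[OF u y classes.Cmp_closed[OF u x y c(1) m] classes.Cmp_closed[OF u x y c(2) m]] by blast
    then have "classes.cls ?u x c = classes.cls ?u x c'"
      using L u classes.cls_closed[OF c(1)] classes.cls_closed[OF c(2)] unfolding is_mono_def classes.Obj_Q by blast
    then have "(c, c') \<in> setoid_equal C ?u x"
      using classes.cls_eq_iff[OF u x c] by blast
    then show "(U, c, c') \<in> snd x"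
      by (simp add: setoid_equal_def)
  qed
next
  assume R: ?R
  show ?L
    unfolding is_mono_def classes.Obj_Q
  proof (intro conjI ballI impI classes.cls_closed[OF m])
    fix z G H assume z: "z \<in> Obj Setoids" and "G \<in> Hom classes.Q z x" "H \<in> Hom classes.Q z x"
      and eq: "Cmp classes.Q z x y (classes.cls x y m) G = Cmp classes.Q z x y (classes.cls x y m) H"
    then obtain g h where g: "g \<in> Hom Setoids z x" "G = classes.cls z x g"
      and h: "h \<in> Hom Setoids z x" "H = classes.cls z x h"
      by (elim classes.Hom_Q_E)
    have "(Cmp Setoids z x y m g, Cmp Setoids z x y m h) \<in> setoid_equal C z y"
      using eq classes.Cmp_cls[OF z x y g(1) m] classes.Cmp_cls[OF z x y h(1) m] g(2) h(2)
        classes.cls_eq_iff[OF z y classes.Cmp_closed[OF z x y g(1) m] classes.Cmp_closed[OF z x y h(1) m]] by simp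
    then have "(fst z, Cmp C (fst z) (fst x) (fst y) m g, Cmp C (fst z) (fst x) (fst y) m h) \<in> snd y"
      by (simp add: setoid_equal_def)
    moreover have "fst z \<in> Obj C"
      using z by simp
    ultimately have "(fst z, g, h) \<in> snd x"
      using R setoid_HomD(1)[OF g(1)] setoid_HomD(1)[OF h(1)] by blast
    then have "(g, h) \<in> setoid_equal C z x"
      using g h by (simp add: setoid_equal_def)
    then show "G = H"
      using classes.cls_eq_iff[OF z x g(1) h(1)] g(2) h(2) by blast
  qed
qed

text \<open>
  Membership provides an arrow \<open>c\<close> of the underlying category with \<open>m c\<close> related to \<open>g\<close>. It preserves
  the relation because \<open>g\<close> does and \<open>m\<close> reflects it.
\<close>

lemma factors_through_mono_iff:
  assumes x: "x \<in> Obj Setoids" and y: "y \<in> Obj Setoids" and z: "z \<in> Obj Setoids"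
    and mono: "is_mono classes.Q x y M" and g: "g \<in> Hom Setoids z y"
  shows "(\<exists>H\<in>Hom classes.Q z x. Cmp classes.Q z x y M H = classes.cls z y g) \<longleftrightarrow> (fst z, g) \<in> image_sieve C x y M"
    (is "?L \<longleftrightarrow> ?R")
proof -
  interpret x: setoid C x using x by (rule setoidI)
  interpret y: setoid C y using y by (rule setoidI)
  interpret z: setoid C z using z by (rule setoidI)
  have "M \<in> Hom classes.Q x y"
    using mono unfolding is_mono_def by blast
  then obtain m where m: "m \<in> Hom Setoids x y" "M = classes.cls x y m"
    by (rule classes.Hom_Q_E)
  note mono_m = mono[unfolded m(2) class_mono_iff[OF x y m(1)]]
  show ?thesis
  proof
    assume ?L
    then obtain H where H: "H \<in> Hom classes.Q z x" "Cmp classes.Q z x y M H = classes.cls z y g"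
      by blast
    obtain h where h: "h \<in> Hom Setoids z x" "H = classes.cls z x h"
      using H(1) by (rule classes.Hom_Q_E)
    have "(Cmp Setoids z x y m h, g) \<in> setoid_equal C z y"
      using H(2) classes.Cmp_cls[OF z x y h(1) m(1)] h(2) m(2)
        classes.cls_eq_iff[OF z y classes.Cmp_closed[OF z x y h(1) m(1)] g] by simp
    then show ?R
      unfolding m(2) mem_image_sieve[OF x y m(1)] using z.carrier_obj setoid_HomD(1)[OF h(1)] setoid_HomD(1)[OF g]
      by (auto simp: setoid_equal_def)
  next
    assume ?R
    then obtain c where c: "c \<in> Hom C (fst z) (fst x)" "(fst z, Cmp C (fst z) (fst x) (fst y) m c, g) \<in> snd y"
      unfolding m(2) mem_image_sieve[OF x y m(1)] by blast
    have "(U, Cmp C U (fst z) (fst x) c a, Cmp C U (fst z) (fst x) c a') \<in> snd x" if a: "(U, a, a') \<in> snd z" for U a a'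
    proof -
      note U = z.arrow[OF a]
      have mg: "(U, Cmp C U (fst x) (fst y) m (Cmp C U (fst z) (fst x) c b), Cmp C U (fst z) (fst y) g b) \<in> snd y"
        if "b \<in> Hom C U (fst z)" for b
        using y.precompose[OF c(2) U(1) that] that U(1) c(1) x.carrier_obj y.carrier_obj z.carrier_obj setoid_HomD(1)[OF m(1)]
        by (simp add: Cmp_assoc)
      have "(U, Cmp C U (fst x) (fst y) m (Cmp C U (fst z) (fst x) c a), Cmp C U (fst x) (fst y) m (Cmp C U (fst z) (fst x) c a')) \<in> snd y"
        using y.trans[OF y.trans[OF mg[OF U(2)] setoid_HomD(2)[OF g a]] y.sym[OF mg[OF U(3)]]] .
      then show ?thesis
        using mono_m U Cmp_closed[OF U(1) z.carrier_obj x.carrier_obj _ c(1)] by blast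
    qed
    then have cH: "c \<in> Hom Setoids z x"
      using c(1) by (simp add: mem_setoid_Hom)
    have "(Cmp Setoids z x y m c, g) \<in> setoid_equal C z y"
      using c(2) g classes.Cmp_closed[OF z x y cH m(1)] by (simp add: setoid_equal_def)
    then have "Cmp classes.Q z x y M (classes.cls z x c) = classes.cls z y g"
      unfolding m(2) classes.Cmp_cls[OF z x y cH m(1)]
      using classes.cls_eq_iff[OF z y classes.Cmp_closed[OF z x y cH m(1)] g] by blast
    then show ?L
      using classes.cls_closed[OF cH] by blast
  qed
qed

text \<open>
  The case of a generalized element: it lies in the image sieve exactly if it factors through \<open>M\<close>
  as an arrow from a discrete setoid. This translates universal properties into membership.
\<close>

lemma mem_image_sieve_iff:
  assumes x: "x \<in> Obj Setoids" and y: "y \<in> Obj Setoids"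
    and mono: "is_mono classes.Q x y M" and U: "U \<in> Obj C" and a: "a \<in> Hom C U (fst y)"
  shows "(U, a) \<in> image_sieve C x y M \<longleftrightarrow> (\<exists>H\<in>Hom classes.Q (discrete_setoid C U) x.
    Cmp classes.Q (discrete_setoid C U) x y M H = classes.cls (discrete_setoid C U) y a)"
  using factors_through_mono_iff[OF x y discrete_setoid_obj[OF U] mono, of a] a
  by (simp only: discrete_setoid_Hom[OF U y] fst_discrete_setoid)

lemma slice_le_mono_iff:
  assumes x: "x \<in> Obj Setoids" and x': "x' \<in> Obj Setoids" and y: "y \<in> Obj Setoids"
    and "M \<in> Hom classes.Q x y" and mono: "is_mono classes.Q x' y M'"
  shows "slice_le classes.Q y (x, M) (x', M') \<longleftrightarrow> image_sieve C x y M \<subseteq> image_sieve C x' y M'"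
proof -
  interpret x: setoid C x using x by (rule setoidI)
  interpret x': setoid C x' using x' by (rule setoidI)
  interpret y: setoid C y using y by (rule setoidI)
  obtain m where m: "m \<in> Hom Setoids x y" "M = classes.cls x y m"
    using \<open>M \<in> _\<close> by (rule classes.Hom_Q_E)
  have "M' \<in> Hom classes.Q x' y"
    using mono unfolding is_mono_def by blast
  then obtain m' where m': "m' \<in> Hom Setoids x' y" "M' = classes.cls x' y m'"
    by (rule classes.Hom_Q_E)
  note mD = setoid_HomD(1)[OF m(1)] and m'D = setoid_HomD(1)[OF m'(1)]
  have "slice_le classes.Q y (x, M) (x', M') \<longleftrightarrow> (fst x, m) \<in> image_sieve C x' y M'"
    using factors_through_mono_iff[OF x' y x mono m(1)] m(2) by (simp add: slice_le_def)
  also have "\<dots> \<longleftrightarrow> image_sieve C x y M \<subseteq> image_sieve C x' y M'"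
  proof
    assume "image_sieve C x y M \<subseteq> image_sieve C x' y M'"
    moreover have "(fst x, m) \<in> image_sieve C x y M"
      unfolding m(2) mem_image_sieve[OF x y m(1)]
      using mD x.carrier_obj Id_closed[OF x.carrier_obj] y.refl[OF x.carrier_obj mD]
        Cmp_Id_right[OF x.carrier_obj y.carrier_obj mD] by (intro conjI bexI[of _ "Id C (fst x)"]) simp_all
    ultimately show "(fst x, m) \<in> image_sieve C x' y M'" by blast
  next
    assume "(fst x, m) \<in> image_sieve C x' y M'"
    then obtain c where c: "c \<in> Hom C (fst x) (fst x')" "(fst x, Cmp C (fst x) (fst x') (fst y) m' c, m) \<in> snd y"
      unfolding m'(2) mem_image_sieve[OF x' y m'(1)] by blast
    show "image_sieve C x y M \<subseteq> image_sieve C x' y M'"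
    proof clarify
      fix U a assume "(U, a) \<in> image_sieve C x y M"
      then obtain d where U: "U \<in> Obj C" "a \<in> Hom C U (fst y)" and d: "d \<in> Hom C U (fst x)"
        "(U, Cmp C U (fst x) (fst y) m d, a) \<in> snd y"
        unfolding m(2) mem_image_sieve[OF x y m(1)] by blast
      have "(U, Cmp C U (fst x') (fst y) m' (Cmp C U (fst x) (fst x') c d), Cmp C U (fst x) (fst y) m d) \<in> snd y"
        using y.precompose[OF c(2) U(1) d(1)] U(1) d(1) c(1) m'D x.carrier_obj x'.carrier_obj y.carrier_obj
        by (simp add: Cmp_assoc)
      from y.trans[OF this d(2)] show "(U, a) \<in> image_sieve C x' y M'"
        unfolding m'(2) mem_image_sieve[OF x' y m'(1)]
        using U Cmp_closed[OF U(1) x.carrier_obj x'.carrier_obj d(1) c(1)] by blast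
    qed
  qed
  finally show ?thesis .
qed

text \<open>
  The sieve is principal as the projection to \<open>y\<close> of the principal sieve of the pairs \<open>(c, a)\<close> on the
  product with \<open>m c\<close> related to \<open>a\<close>. It is compatible by transitivity.
\<close>

lemma image_sieve_compatible:
  assumes x: "x \<in> Obj Setoids" and y: "y \<in> Obj Setoids" and "M \<in> Hom classes.Q x y"
  shows "image_sieve C x y M \<in> compatible_sieves C y"
proof -
  interpret x: setoid C x using x by (rule setoidI)
  interpret y: setoid C y using y by (rule setoidI)
  obtain m where m: "m \<in> Hom Setoids x y" "M = classes.cls x y m"
    using \<open>M \<in> _\<close> by (rule classes.Hom_Q_E)
  note mD = setoid_HomD(1)[OF m(1)]
  note P = chosen_product[OF binary_products x.carrier_obj y.carrier_obj]
  note Po = product_cone[OF P]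
  let ?P = "prd C (fst x) (fst y)" and ?p = "pr1 C (fst x) (fst y)" and ?q = "pr2 C (fst x) (fst y)"
  let ?\<psi> = "{(U, w). U \<in> Obj C \<and> w \<in> Hom C U ?P \<and>
    (U, Cmp C U ?P (fst y) (Cmp C ?P (fst x) (fst y) m ?p) w, Cmp C U ?P (fst y) ?q w) \<in> snd y}"
  have "(U, a) \<in> image_sieve C x y M \<longleftrightarrow> (U, a) \<in> {(U, Cmp C U ?P (fst y) ?q w) | U w. (U, w) \<in> ?\<psi>}" for U a
  proof
    assume "(U, a) \<in> image_sieve C x y M"
    then obtain c where U: "U \<in> Obj C" "a \<in> Hom C U (fst y)" and c: "c \<in> Hom C U (fst x)"
      "(U, Cmp C U (fst x) (fst y) m c, a) \<in> snd y"
      unfolding m(2) mem_image_sieve[OF x y m(1)] by blast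
    note k = pairing[OF binary_products x.carrier_obj y.carrier_obj U(1) c(1) U(2)]
    then have "(U, pairing C U (fst x) (fst y) c a) \<in> ?\<psi>"
      using U c Po mD x.carrier_obj y.carrier_obj by (simp add: Cmp_assoc)
    then show "(U, a) \<in> {(U, Cmp C U ?P (fst y) ?q w) | U w. (U, w) \<in> ?\<psi>}"
      using k(3) by (auto intro!: exI[of _ "pairing C U (fst x) (fst y) c a"])
  next
    assume "(U, a) \<in> {(U, Cmp C U ?P (fst y) ?q w) | U w. (U, w) \<in> ?\<psi>}"
    then obtain w where U: "U \<in> Obj C" "w \<in> Hom C U ?P" and a: "a = Cmp C U ?P (fst y) ?q w"
      and e: "(U, Cmp C U ?P (fst y) (Cmp C ?P (fst x) (fst y) m ?p) w, Cmp C U ?P (fst y) ?q w) \<in> snd y"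
      by blast
    have "(U, Cmp C U (fst x) (fst y) m (Cmp C U ?P (fst x) ?p w), a) \<in> snd y"
      using e a U Po mD x.carrier_obj y.carrier_obj by (simp add: Cmp_assoc)
    then show "(U, a) \<in> image_sieve C x y M"
      unfolding m(2) mem_image_sieve[OF x y m(1)]
      using U(1) y.arrow Cmp_closed[OF U(1) Po(1) x.carrier_obj U(2) Po(2)] by blast
  qed
  then have "image_sieve C x y M = {(U, Cmp C U ?P (fst y) ?q w) | U w. (U, w) \<in> ?\<psi>}"
    by auto
  also have "\<dots> \<in> principal_sieves C (fst y)"
    by (rule image_sieve_principal[OF Po(1) y.carrier_obj Po(3)
          principal_relation_sieve[OF Po(1) y.carrier_obj Cmp_closed[OF Po(1) x.carrier_obj y.carrier_obj Po(2) mD] Po(3) y.principal]])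
  finally have "image_sieve C x y M \<in> principal_sieves C (fst y)" .
  moreover have "(U, a') \<in> image_sieve C x y M" if "(U, a, a') \<in> snd y" "(U, a) \<in> image_sieve C x y M" for U a a'
    using that y.arrow[OF that(1)] y.trans[OF _ that(1)] unfolding m(2) mem_image_sieve[OF x y m(1)] by blast
  ultimately show ?thesis
    unfolding compatible_sieves_def by blast
qed

text \<open>
  If \<open>k : K \<rightarrow> A\<close> generates \<open>\<phi>\<close>, then \<open>K\<close> with the relation pulled back along \<open>k\<close> is a subobject:
  \<open>k\<close> reflects the relation by construction, and compatibility of \<open>\<phi>\<close> gives equality of the sieves.
\<close>

lemma compatible_sieve_is_image:
  assumes y: "y \<in> Obj Setoids" and \<phi>: "\<phi> \<in> compatible_sieves C y"
  obtains x M where "x \<in> Obj Setoids" "is_mono classes.Q x y M" "image_sieve C x y M = \<phi>"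
proof -
  interpret y: setoid C y using y by (rule setoidI)
  obtain K k where K: "K \<in> Obj C" "k \<in> Hom C K (fst y)" and gen: "\<phi> = generated_sieve C (fst y) K k"
    using compatible_sieve_principal[OF \<phi>] by (rule principal_sieveE)
  define E where "E = {(U, c, c'). U \<in> Obj C \<and> c \<in> Hom C U K \<and> c' \<in> Hom C U K \<and>
    (U, Cmp C U K (fst y) k c, Cmp C U K (fst y) k c') \<in> snd y}"
  have E: "(U, c, c') \<in> E \<longleftrightarrow> U \<in> Obj C \<and> c \<in> Hom C U K \<and> c' \<in> Hom C U K \<and>
    (U, Cmp C U K (fst y) k c, Cmp C U K (fst y) k c') \<in> snd y" for U c c'
    by (simp add: E_def)
  have "E \<in> principal_relations C K"
    unfolding E_def by (rule reindex_relation_principal[OF K(1) y.carrier_obj K(2) y.principal])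
  then have "E \<in> principal_equivalences C K"
  proof (rule principal_equivalenceI)
    show "(U, c, c) \<in> E" if "U \<in> Obj C" "c \<in> Hom C U K" for U c
      using that y.refl Cmp_closed[OF that(1) K(1) y.carrier_obj that(2) K(2)] unfolding E by blast
    show "(U, c', c) \<in> E" if "(U, c, c') \<in> E" for U c c'
      using that y.sym unfolding E by blast
    show "(U, c, c'') \<in> E" if "(U, c, c') \<in> E" "(U, c', c'') \<in> E" for U c c' c''
      using that y.trans unfolding E by blast
  qed
  then have x: "(K, E) \<in> Obj Setoids"
    using K by simp
  have k: "k \<in> Hom Setoids (K, E) y"
    using K E by (simp add: mem_setoid_Hom)
  have "is_mono classes.Q (K, E) y (classes.cls (K, E) y k)"
    unfolding class_mono_iff[OF x y k] using E by simp
  moreover have "(U, a) \<in> image_sieve C (K, E) y (classes.cls (K, E) y k) \<longleftrightarrow> (U, a) \<in> \<phi>" for U a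
  proof
    assume "(U, a) \<in> image_sieve C (K, E) y (classes.cls (K, E) y k)"
    then obtain c where c: "U \<in> Obj C" "c \<in> Hom C U K" "(U, Cmp C U K (fst y) k c, a) \<in> snd y"
      unfolding mem_image_sieve[OF x y k] by auto
    then have "(U, Cmp C U K (fst y) k c) \<in> \<phi>"
      unfolding gen mem_generated_sieve by blast
    then show "(U, a) \<in> \<phi>"
      by (rule compatible_sieveD[OF \<phi> c(3)])
  next
    assume a: "(U, a) \<in> \<phi>"
    then obtain c where c: "U \<in> Obj C" "c \<in> Hom C U K" "Cmp C U K (fst y) k c = a"
      unfolding gen mem_generated_sieve by blast
    then show "(U, a) \<in> image_sieve C (K, E) y (classes.cls (K, E) y k)"
      unfolding mem_image_sieve[OF x y k] using y.refl[OF c(1)] Cmp_closed[OF c(1) K(1) y.carrier_obj c(2) K(2)]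
      by auto
  qed
  then have "image_sieve C (K, E) y (classes.cls (K, E) y k) = \<phi>"
    by auto
  ultimately show thesis
    using that x by blast
qed

end

context category
begin

lemma pullback_mono:
  assumes o: "A \<in> Obj C" "B \<in> Obj C" "D \<in> Obj C" and f: "f \<in> Hom C A D" and m: "is_mono C B D m"
    and W: "is_pullback C A B D f m W p q"
  shows "is_mono C W A p"
proof -
  have mH: "m \<in> Hom C B D"
    and mE: "\<And>Z g h. \<lbrakk>Z \<in> Obj C; g \<in> Hom C Z B; h \<in> Hom C Z B; Cmp C Z B D m g = Cmp C Z B D m h\<rbrakk> \<Longrightarrow> g = h"
    using m unfolding is_mono_def by blast+
  have Wo: "W \<in> Obj C" "p \<in> Hom C W A" "q \<in> Hom C W B" "Cmp C W A D f p = Cmp C W B D m q"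
    and u: "\<And>X a b. \<lbrakk>X \<in> Obj C; a \<in> Hom C X A; b \<in> Hom C X B; Cmp C X A D f a = Cmp C X B D m b\<rbrakk>
      \<Longrightarrow> \<exists>!h. h \<in> Hom C X W \<and> Cmp C X W A p h = a \<and> Cmp C X W B q h = b"
    using W unfolding is_pullback_def by blast+
  show ?thesis
    unfolding is_mono_def
  proof (intro conjI ballI impI Wo(2))
    fix Z g h assume Z: "Z \<in> Obj C" and g: "g \<in> Hom C Z W" and h: "h \<in> Hom C Z W"
      and e: "Cmp C Z W A p g = Cmp C Z W A p h"
    have sq: "Cmp C Z B D m (Cmp C Z W B q k) = Cmp C Z A D f (Cmp C Z W A p k)" if "k \<in> Hom C Z W" for k
      using that Z Wo o f mH by (simp add: Cmp_assoc[symmetric])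
    have c: "Cmp C Z W A p g \<in> Hom C Z A" "Cmp C Z W B q g \<in> Hom C Z B" "Cmp C Z W B q h \<in> Hom C Z B"
      using Z g h Wo o Cmp_closed by auto
    have "Cmp C Z W B q g = Cmp C Z W B q h"
      using mE[OF Z c(2,3)] sq[OF g] sq[OF h] e by simp
    then show "g = h"
      using u[OF Z c(1,2) sq[OF g, symmetric]] g h e by metis
  qed
qed

end

context weakly_lex_category
begin

text \<open>
  An element \<open>a\<close> factors through the pullback \<open>P\<close> exactly if \<open>f a\<close> factors through \<open>M\<close>.
\<close>

lemma pullback_image_sieve:
  assumes x: "x \<in> Obj Setoids" and y: "y \<in> Obj Setoids" and z: "z \<in> Obj Setoids"
    and f: "f \<in> Hom Setoids y z" and mono: "is_mono classes.Q x z M"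
    and W: "is_pullback classes.Q y x z (classes.cls y z f) M w P R"
  shows "is_mono classes.Q w y P"
    and "image_sieve C w y P = reindex C (fst y) (fst z) f (image_sieve C x z M)"
proof -
  interpret Q: category classes.Q by (rule classes.quotient_category)
  interpret y: setoid C y using y by (rule setoidI)
  interpret z: setoid C z using z by (rule setoidI)
  note fH = classes.cls_closed[OF f]
  show P: "is_mono classes.Q w y P"
    by (rule Q.pullback_mono[OF _ _ _ fH mono W]) (use x y z in simp_all)
  have w: "w \<in> Obj Setoids"
    and Wo: "P \<in> Hom classes.Q w y" "R \<in> Hom classes.Q w x"
      "Cmp classes.Q w y z (classes.cls y z f) P = Cmp classes.Q w x z M R"
    and u: "\<And>X a b. \<lbrakk>X \<in> Obj Setoids; a \<in> Hom classes.Q X y; b \<in> Hom classes.Q X x;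
        Cmp classes.Q X y z (classes.cls y z f) a = Cmp classes.Q X x z M b\<rbrakk>
      \<Longrightarrow> \<exists>!h. h \<in> Hom classes.Q X w \<and> Cmp classes.Q X w y P h = a \<and> Cmp classes.Q X w x R h = b"
    using W unfolding is_pullback_def classes.Obj_Q by blast+
  have MH: "M \<in> Hom classes.Q x z" using mono unfolding is_mono_def by blast
  have "(U, a) \<in> image_sieve C w y P \<longleftrightarrow> (U, Cmp C U (fst y) (fst z) f a) \<in> image_sieve C x z M"
    if U: "U \<in> Obj C" "a \<in> Hom C U (fst y)" for U a
  proof -
    let ?u = "discrete_setoid C U"
    note uo = discrete_setoid_obj[OF U(1)]
    have a: "a \<in> Hom Setoids ?u y"
      using U by (simp only: discrete_setoid_Hom[OF U(1) y])
    note aH = classes.cls_closed[OF a]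
    have fa: "Cmp C U (fst y) (fst z) f a \<in> Hom C U (fst z)"
      using Cmp_closed[OF U(1) y.carrier_obj z.carrier_obj U(2) setoid_HomD(1)[OF f]] .
    have cfa: "Cmp classes.Q ?u y z (classes.cls y z f) (classes.cls ?u y a) = classes.cls ?u z (Cmp C U (fst y) (fst z) f a)"
      using classes.Cmp_cls[OF uo y z a f] by simp
    have "(\<exists>H\<in>Hom classes.Q ?u w. Cmp classes.Q ?u w y P H = classes.cls ?u y a) \<longleftrightarrow>
        (\<exists>H\<in>Hom classes.Q ?u x. Cmp classes.Q ?u x z M H = Cmp classes.Q ?u y z (classes.cls y z f) (classes.cls ?u y a))"
    proof
      assume "\<exists>H\<in>Hom classes.Q ?u w. Cmp classes.Q ?u w y P H = classes.cls ?u y a"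
      then obtain H where H: "H \<in> Hom classes.Q ?u w" "Cmp classes.Q ?u w y P H = classes.cls ?u y a" by blast
      have "Cmp classes.Q ?u x z M (Cmp classes.Q ?u w x R H) = Cmp classes.Q ?u y z (classes.cls y z f) (classes.cls ?u y a)"
        using Q.Cmp_assoc[unfolded classes.Obj_Q, OF uo w x z H(1) Wo(2) MH]
          Q.Cmp_assoc[unfolded classes.Obj_Q, OF uo w y z H(1) Wo(1) fH] Wo(3) H(2) by simp
      moreover have "Cmp classes.Q ?u w x R H \<in> Hom classes.Q ?u x"
        using Q.Cmp_closed[of ?u w x H R] H Wo uo w x unfolding classes.Obj_Q by blast
      ultimately show "\<exists>H\<in>Hom classes.Q ?u x. Cmp classes.Q ?u x z M H = Cmp classes.Q ?u y z (classes.cls y z f) (classes.cls ?u y a)"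
        by blast
    next
      assume "\<exists>H\<in>Hom classes.Q ?u x. Cmp classes.Q ?u x z M H = Cmp classes.Q ?u y z (classes.cls y z f) (classes.cls ?u y a)"
      then show "\<exists>H\<in>Hom classes.Q ?u w. Cmp classes.Q ?u w y P H = classes.cls ?u y a"
        using u[OF uo aH] by metis
    qed
    then show ?thesis
      unfolding mem_image_sieve_iff[OF w y P U] mem_image_sieve_iff[OF x z mono U(1) fa] cfa .
  qed
  moreover have "image_sieve C w y P \<subseteq> slice_objs C (fst y)"
    by (auto simp: image_sieve_def mem_slice_objs)
  ultimately show "image_sieve C w y P = reindex C (fst y) (fst z) f (image_sieve C x z M)"
    by (auto simp: mem_reindex mem_slice_objs)
qed

text \<open>
  The subobject whose sieve is the preimage of the sieve of \<open>M\<close> is a pullback: factoring through it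
  or through \<open>M\<close> is membership in these sieves, and factorizations through monic arrows are unique.
\<close>

lemma pullback_of_mono_exists:
  assumes x: "x \<in> Obj Setoids" and y: "y \<in> Obj Setoids" and z: "z \<in> Obj Setoids"
    and f: "f \<in> Hom Setoids y z" and mono: "is_mono classes.Q x z M"
  obtains w P R where "is_pullback classes.Q y x z (classes.cls y z f) M w P R"
proof -
  interpret Q: category classes.Q by (rule classes.quotient_category)
  interpret y: setoid C y using y by (rule setoidI)
  interpret z: setoid C z using z by (rule setoidI)
  note fH = classes.cls_closed[OF f]
  have MH: "M \<in> Hom classes.Q x z"
    and ME: "\<And>Z g h. \<lbrakk>Z \<in> Obj Setoids; g \<in> Hom classes.Q Z x; h \<in> Hom classes.Q Z x;
      Cmp classes.Q Z x z M g = Cmp classes.Q Z x z M h\<rbrakk> \<Longrightarrow> g = h"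
    using mono unfolding is_mono_def classes.Obj_Q by blast+
  obtain w P where w: "w \<in> Obj Setoids" and P: "is_mono classes.Q w y P"
    and img: "image_sieve C w y P = reindex C (fst y) (fst z) f (image_sieve C x z M)"
    using compatible_sieve_is_image[OF y reindex_compatible[OF y z f image_sieve_compatible[OF x z MH]]] by blast
  have PH: "P \<in> Hom classes.Q w y"
    and PE: "\<And>Z g h. \<lbrakk>Z \<in> Obj Setoids; g \<in> Hom classes.Q Z w; h \<in> Hom classes.Q Z w;
      Cmp classes.Q Z w y P g = Cmp classes.Q Z w y P h\<rbrakk> \<Longrightarrow> g = h"
    using P unfolding is_mono_def classes.Obj_Q by blast+
  have factor: "(\<exists>H\<in>Hom classes.Q v w. Cmp classes.Q v w y P H = A) \<longleftrightarrow>
      (\<exists>H\<in>Hom classes.Q v x. Cmp classes.Q v x z M H = Cmp classes.Q v y z (classes.cls y z f) A)"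
    if v: "v \<in> Obj Setoids" and A: "A \<in> Hom classes.Q v y" for v A
  proof -
    obtain a where a: "a \<in> Hom Setoids v y" "A = classes.cls v y a"
      using A by (rule classes.Hom_Q_E)
    have vo: "fst v \<in> Obj C" using v by simp
    show ?thesis
      using factors_through_mono_iff[OF w y v P a(1)]
        factors_through_mono_iff[OF x z v mono classes.Cmp_closed[OF v y z a(1) f]]
        vo setoid_HomD(1)[OF a(1)]
      unfolding a(2) classes.Cmp_cls[OF v y z a(1) f] by (simp add: img mem_reindex)
  qed
  \<comment> \<open>\<open>P\<close> factors through itself, so \<open>factor\<close> yields the other projection.\<close>
  obtain I where I: "I \<in> Hom classes.Q w w" "Cmp classes.Q w w y P I = P"
    using Q.Id_closed[of w] Q.Cmp_Id_right[of w y P] w y PH by auto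
  obtain R where R: "R \<in> Hom classes.Q w x" "Cmp classes.Q w x z M R = Cmp classes.Q w y z (classes.cls y z f) P"
    using factor[OF w PH] I by blast
  have "is_pullback classes.Q y x z (classes.cls y z f) M w P R"
    unfolding is_pullback_def classes.Obj_Q
  proof (intro conjI ballI impI w PH R(1) R(2)[symmetric])
    fix v A B assume v: "v \<in> Obj Setoids" and A: "A \<in> Hom classes.Q v y" and B: "B \<in> Hom classes.Q v x"
      and e: "Cmp classes.Q v y z (classes.cls y z f) A = Cmp classes.Q v x z M B"
    obtain H where H: "H \<in> Hom classes.Q v w" "Cmp classes.Q v w y P H = A"
      using factor[OF v A] B e by metis
    have RH: "Cmp classes.Q v w x R H \<in> Hom classes.Q v x"
      using Q.Cmp_closed[of v w x H R] v w x H R unfolding classes.Obj_Q by blast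
    have "Cmp classes.Q v x z M (Cmp classes.Q v w x R H) = Cmp classes.Q v x z M B"
      using Q.Cmp_assoc[unfolded classes.Obj_Q, OF v w x z H(1) R(1) MH]
        Q.Cmp_assoc[unfolded classes.Obj_Q, OF v w y z H(1) PH fH] R(2) H(2) e by simp
    then have "Cmp classes.Q v w x R H = B"
      by (rule ME[OF v RH B])
    then show "\<exists>!H. H \<in> Hom classes.Q v w \<and> Cmp classes.Q v w y P H = A \<and> Cmp classes.Q v w x R H = B"
    proof (intro ex1I[of _ H] conjI H)
      show "H' = H" if "H' \<in> Hom classes.Q v w \<and> Cmp classes.Q v w y P H' = A \<and> Cmp classes.Q v w x R H' = B" for H'
        by (rule PE[OF v _ H(1)]) (use that H(2) in simp_all)
    qed
  qed
  then show thesis by (rule that)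
qed

end

section \<open>The doctrine of subobjects\<close>

definition subobject_sieve ::
  "('o, 'a) cat \<Rightarrow> ('x \<Rightarrow> 'o \<times> ('o \<times> 'a \<times> 'a) set) \<Rightarrow> 'x \<Rightarrow> ('x \<times> 'a set) set \<Rightarrow> ('o \<times> 'a) set" where
  "subobject_sieve C s A \<alpha> = (\<Union>(X, M)\<in>\<alpha>. image_sieve C (s X) (s A) M)"

context weakly_lex_category
begin

lemma slice_monos_reflection:
  assumes "relabels D s classes.Q" and A: "A \<in> Obj D"
  shows "sieve_reflection (slice_monos D A) (slice_le D A) (\<lambda>(X, M). image_sieve C (s X) (s A) M)"
    and "(\<lambda>(X, M). image_sieve C (s X) (s A) M) ` slice_monos D A = compatible_sieves C (s A)"
proof -
  interpret relabeling D s classes.Q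
    using assms(1) classes.quotient_category by (simp add: relabeling_def relabeling_axioms_def)
  have sobj: "s X \<in> Obj Setoids" if "X \<in> Obj D" for X
    using obj[OF that] unfolding classes.Obj_Q .
  have mem: "(X, M) \<in> slice_monos D A \<longleftrightarrow> X \<in> Obj D \<and> is_mono classes.Q (s X) (s A) M" for X M
    using is_mono_iff[OF _ A] by (auto simp: slice_monos_def)
  have H: "M \<in> Hom classes.Q (s X) (s A)" if "(X, M) \<in> slice_monos D A" for X M
    using that unfolding mem is_mono_def by blast
  show "sieve_reflection (slice_monos D A) (slice_le D A) (\<lambda>(X, M). image_sieve C (s X) (s A) M)"
  proof
    fix x y assume x: "x \<in> slice_monos D A" and y: "y \<in> slice_monos D A"
    obtain X M Y N where xy: "x = (X, M)" "y = (Y, N)" by (metis surj_pair)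
    show "slice_le D A x y \<longleftrightarrow> (\<lambda>(X, M). image_sieve C (s X) (s A) M) x \<subseteq> (\<lambda>(X, M). image_sieve C (s X) (s A) M) y"
      using slice_le_iff[OF A _ _ H[OF y[unfolded xy]], of X M]
        slice_le_mono_iff[OF sobj sobj sobj[OF A] H[OF x[unfolded xy]], of Y N] x y
      unfolding xy mem case_prod_conv by blast
  qed
  show "(\<lambda>(X, M). image_sieve C (s X) (s A) M) ` slice_monos D A = compatible_sieves C (s A)"
  proof
    show "(\<lambda>(X, M). image_sieve C (s X) (s A) M) ` slice_monos D A \<subseteq> compatible_sieves C (s A)"
    proof clarify
      fix X M U a assume XM: "(X, M) \<in> slice_monos D A"
      then show "image_sieve C (s X) (s A) M \<in> compatible_sieves C (s A)"
        using image_sieve_compatible[OF sobj sobj[OF A] H[OF XM]] mem by blast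
    qed
    show "compatible_sieves C (s A) \<subseteq> (\<lambda>(X, M). image_sieve C (s X) (s A) M) ` slice_monos D A"
    proof
      fix \<phi> assume "\<phi> \<in> compatible_sieves C (s A)"
      then obtain x M where x: "x \<in> Obj Setoids" "is_mono classes.Q x (s A) M" "image_sieve C x (s A) M = \<phi>"
        by (rule compatible_sieve_is_image[OF sobj[OF A]])
      obtain X where "X \<in> Obj D" "s X = x"
        using x(1) obj_surj[of x] unfolding classes.Obj_Q by blast
      then show "\<phi> \<in> (\<lambda>(X, M). image_sieve C (s X) (s A) M) ` slice_monos D A"
        using x mem[of X M] by force
    qed
  qed
qed

text \<open>
  All pullbacks of all representatives of \<open>\<beta>\<close> have the same sieve, the preimage of the sieve of \<open>\<beta>\<close>;
  so the action on subobjects is the fibre of \<open>image_sieve\<close> over that preimage.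
\<close>

lemma subobjects_relabels:
  assumes rel: "relabels D s classes.Q"
  shows "doctrine_relabels (subobjects D) s (subobject_sieve C s) (setoid_class_doctrine C)"
proof -
  interpret relabeling D s classes.Q
    using rel classes.quotient_category by (simp add: relabeling_def relabeling_axioms_def)
  have sobj: "s X \<in> Obj Setoids" if "X \<in> Obj D" for X
    using obj[OF that] unfolding classes.Obj_Q .
  have act: "act (subobjects D) A B F \<beta> = {x \<in> slice_monos D A. (\<lambda>(X, M). image_sieve C (s X) (s A) M) x
        = (\<Union>f\<in>F. reindex C (fst (s A)) (fst (s B)) f (subobject_sieve C s B \<beta>))}"
    and closed: "(\<Union>f\<in>F. reindex C (fst (s A)) (fst (s B)) f (subobject_sieve C s B \<beta>)) \<in> compatible_sieves C (s A)"
    if A: "A \<in> Obj D" and B: "B \<in> Obj D" and F: "F \<in> Hom D A B"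
      and \<beta>: "\<beta> \<in> carrier (fib (subobjects D) B)" for A B F \<beta>
  proof -
    interpret A: sieve_reflection "slice_monos D A" "slice_le D A" "\<lambda>(X, M). image_sieve C (s X) (s A) M"
      using rel A by (rule slice_monos_reflection)
    interpret B: sieve_reflection "slice_monos D B" "slice_le D B" "\<lambda>(X, M). image_sieve C (s X) (s B) M"
      using rel B by (rule slice_monos_reflection)
    have FQ: "F \<in> Hom classes.Q (s A) (s B)"
      using F hom[OF A B] by simp
    obtain f where f: "f \<in> Hom Setoids (s A) (s B)" "F = classes.cls (s A) (s B) f"
      using FQ by (rule classes.Hom_Q_E)
    have \<beta>': "\<beta> \<in> carrier (poset_reflection (slice_monos D B) (slice_le D B))"
      using \<beta> by (simp add: subobjects_def)
    have \<phi>: "subobject_sieve C s B \<beta> \<in> compatible_sieves C (s B)"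
      using B.Union_closed[OF \<beta>'] unfolding slice_monos_reflection(2)[OF rel B] subobject_sieve_def .
    have FU: "(\<Union>f\<in>F. reindex C (fst (s A)) (fst (s B)) f (subobject_sieve C s B \<beta>))
        = reindex C (fst (s A)) (fst (s B)) f (subobject_sieve C s B \<beta>)"
      unfolding f(2) by (rule Union_reindex_class[OF sobj[OF A] sobj[OF B] f(1) \<phi>])
    show "(\<Union>f\<in>F. reindex C (fst (s A)) (fst (s B)) f (subobject_sieve C s B \<beta>)) \<in> compatible_sieves C (s A)"
      unfolding FU by (rule reindex_compatible[OF sobj[OF A] sobj[OF B] f(1) \<phi>])
    have mem: "(Y, N) \<in> \<beta> \<Longrightarrow> Y \<in> Obj D \<and> is_mono classes.Q (s Y) (s B) N \<and> image_sieve C (s Y) (s B) N = subobject_sieve C s B \<beta>" for Y N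
      using B.member[OF \<beta>', of "(Y, N)"] is_mono_iff[OF _ B] by (auto simp: slice_monos_def subobject_sieve_def)
    obtain Y N where Y: "(Y, N) \<in> \<beta>"
      using B.nonempty[OF \<beta>'] by (metis surj_pair)
    note Yo = mem[OF Y, THEN conjunct1] and N = mem[OF Y, THEN conjunct2, THEN conjunct1]
    have pbD: "is_pullback D A Y' B F N' W P R \<longleftrightarrow> is_pullback classes.Q (s A) (s Y') (s B) F N' (s W) P R"
      if "(Y', N') \<in> \<beta>" "W \<in> Obj D" for Y' N' W P R
      using is_pullback_iff[OF A _ B that(2) FQ, of Y' N' P R] mem[OF that(1)] unfolding is_mono_def by blast
    obtain W P R where W: "is_pullback D A Y B F N W P R"
    proof -
      obtain w P R where w: "is_pullback classes.Q (s A) (s Y) (s B) F N w P R"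
        using pullback_of_mono_exists[OF sobj[OF Yo] sobj[OF A] sobj[OF B] f(1) N] unfolding f(2) by blast
      then have "w \<in> Obj classes.Q" unfolding is_pullback_def by blast
      then obtain W where "W \<in> Obj D" "s W = w" by (rule obj_surj)
      then show thesis
        using that[of W P R] pbD[OF Y] w by blast
    qed
    have pb: "slice_equiv D A x (W, P) \<longleftrightarrow> (\<lambda>(X, M). image_sieve C (s X) (s A) M) x
        = (\<Union>f\<in>F. reindex C (fst (s A)) (fst (s B)) f (subobject_sieve C s B \<beta>))"
      if x: "x \<in> slice_monos D A" and Y: "(Y, N) \<in> \<beta>" and W: "is_pullback D A Y B F N W P R" for x Y N W P R
    proof -
      note Yo = mem[OF Y, THEN conjunct1] and N = mem[OF Y, THEN conjunct2, THEN conjunct1]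
      have Wo: "W \<in> Obj D" using W unfolding is_pullback_def by blast
      have W': "is_pullback classes.Q (s A) (s Y) (s B) (classes.cls (s A) (s B) f) N (s W) P R"
        using W pbD[OF Y Wo] f(2) by simp
      note img = pullback_image_sieve[OF sobj[OF Yo] sobj[OF A] sobj[OF B] f(1) N W']
      have "(W, P) \<in> slice_monos D A"
        using Wo img(1) is_mono_iff[OF Wo A] by (simp add: slice_monos_def)
      then have "slice_equiv D A x (W, P) \<longleftrightarrow> (\<lambda>(X, M). image_sieve C (s X) (s A) M) x = image_sieve C (s W) (s A) P"
        using A.le_iff[OF x] A.le_iff[OF _ x] unfolding slice_equiv_def by auto
      then show ?thesis
        unfolding FU img(2) mem[OF Y, THEN conjunct2, THEN conjunct2] .
    qed
    have "(\<exists>(Y, N)\<in>\<beta>. \<exists>W P R. is_pullback D A Y B F N W P R \<and> slice_equiv D A x (W, P)) \<longleftrightarrow>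
        (\<lambda>(X, M). image_sieve C (s X) (s A) M) x
          = (\<Union>f\<in>F. reindex C (fst (s A)) (fst (s B)) f (subobject_sieve C s B \<beta>))" (is "?L \<longleftrightarrow> ?R")
      if x: "x \<in> slice_monos D A" for x
    proof
      show ?R if ?L
        using that pb[OF x] by blast
      show ?L if ?R
        using that pb[OF x Y W] W by (intro bexI[OF _ Y]) auto
    qed
    then show "act (subobjects D) A B F \<beta> = {x \<in> slice_monos D A. (\<lambda>(X, M). image_sieve C (s X) (s A) M) x
        = (\<Union>f\<in>F. reindex C (fst (s A)) (fst (s B)) f (subobject_sieve C s B \<beta>))}"
      unfolding subobjects_def doctrine.select_convs by (intro Collect_cong conj_cong refl)
  qed
  have "order_isomorphism (fib (subobjects D) A) (subset_order (compatible_sieves C (s A))) (subobject_sieve C s A)"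
    if "A \<in> Obj D" for A
    using sieve_reflection.isomorphism[OF slice_monos_reflection(1)[OF rel that]]
    unfolding slice_monos_reflection(2)[OF rel that] by (simp add: subobjects_def subobject_sieve_def[abs_def])
  moreover have "act (subobjects D) A B F \<beta> \<in> carrier (fib (subobjects D) A)"
    "subobject_sieve C s A (act (subobjects D) A B F \<beta>)
      = (\<Union>f\<in>F. reindex C (fst (s A)) (fst (s B)) f (subobject_sieve C s B \<beta>))"
    if A: "A \<in> Obj D" and "B \<in> Obj D" "F \<in> Hom D A B" "\<beta> \<in> carrier (fib (subobjects D) B)" for A B F \<beta>
  proof -
    note r = slice_monos_reflection[OF rel A]
    note c = closed[OF that, folded r(2)]
    show "act (subobjects D) A B F \<beta> \<in> carrier (fib (subobjects D) A)"
      unfolding act[OF that] using sieve_reflection.fibre_carrier[OF r(1) c] by (simp add: subobjects_def)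
    show "subobject_sieve C s A (act (subobjects D) A B F \<beta>)
      = (\<Union>f\<in>F. reindex C (fst (s A)) (fst (s B)) f (subobject_sieve C s B \<beta>))"
      using sieve_reflection.fibre_Union[OF r(1) c] unfolding act[OF that] subobject_sieve_def[of C s A] .
  qed
  moreover have "base (subobjects D) = D"
    by (simp add: subobjects_def)
  ultimately show ?thesis
    unfolding doctrine_relabels_def Let_def setoid_class_doctrine_simps using rel by simp
qed

end

section \<open>Pseudo-equivalence relations as setoids\<close>

text \<open>
  The setoid of a pseudo-equivalence relation, which forgets the generating pair.
\<close>

definition pseudo_setoid :: "('o, 'a) cat \<Rightarrow> 'o \<times> 'o \<times> 'a \<Rightarrow> 'o \<times> ('o \<times> 'a \<times> 'a) set" where
  "pseudo_setoid C = (\<lambda>(A, R, r). (A, generated_relation C A R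
    (Cmp C R (prd C A A) A (pr1 C A A) r) (Cmp C R (prd C A A) A (pr2 C A A) r)))"

context weakly_lex_category
begin

lemma mem_generated_relation_pairing:
  assumes A: "A \<in> Obj C" and R: "R \<in> Obj C" "r \<in> Hom C R (prd C A A)"
    and U: "U \<in> Obj C" "a \<in> Hom C U A" "a' \<in> Hom C U A"
  shows "(U, a, a') \<in> generated_relation C A R (Cmp C R (prd C A A) A (pr1 C A A) r) (Cmp C R (prd C A A) A (pr2 C A A) r)
    \<longleftrightarrow> (\<exists>h\<in>Hom C U R. Cmp C U R (prd C A A) r h = pairing C U A A a a')"
proof -
  note AA = chosen_product[OF binary_products A A]
  note AAo = product_cone[OF AA]
  note k = pairing[OF binary_products A A U]
  have "Cmp C U R A (Cmp C R (prd C A A) A (pr1 C A A) r) h = a \<and> Cmp C U R A (Cmp C R (prd C A A) A (pr2 C A A) r) h = a'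
      \<longleftrightarrow> Cmp C U R (prd C A A) r h = pairing C U A A a a'" if h: "h \<in> Hom C U R" for h
  proof
    have c: "Cmp C U R A (Cmp C R (prd C A A) A (pr1 C A A) r) h = Cmp C U (prd C A A) A (pr1 C A A) (Cmp C U R (prd C A A) r h)"
      "Cmp C U R A (Cmp C R (prd C A A) A (pr2 C A A) r) h = Cmp C U (prd C A A) A (pr2 C A A) (Cmp C U R (prd C A A) r h)"
      using h U R A AAo by (simp_all add: Cmp_assoc)
    show "Cmp C U R (prd C A A) r h = pairing C U A A a a'"
      if "Cmp C U R A (Cmp C R (prd C A A) A (pr1 C A A) r) h = a \<and> Cmp C U R A (Cmp C R (prd C A A) A (pr2 C A A) r) h = a'"
      by (rule product_eqI[OF AA A A U(1) Cmp_closed[OF U(1) R(1) AAo(1) h R(2)] k(1)]) (use that c k in simp_all)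
    show "Cmp C U R A (Cmp C R (prd C A A) A (pr1 C A A) r) h = a \<and> Cmp C U R A (Cmp C R (prd C A A) A (pr2 C A A) r) h = a'"
      if "Cmp C U R (prd C A A) r h = pairing C U A A a a'"
      using that c k by simp
  qed
  then show ?thesis
    unfolding mem_generated_relation using U by blast
qed

text \<open>
  The reflexivity, symmetry and transitivity arrows assert that the relation holds for the generic
  instances, and precomposition yields all others. The generic pair of composable instances lives on
  a weak pullback of \<open>r\<^sub>2\<close> and \<open>r\<^sub>1\<close>.
\<close>

lemma pseudo_equivalence_iff:
  "pseudo_equivalence C (A, R, r) \<longleftrightarrow> A \<in> Obj C \<and> R \<in> Obj C \<and> r \<in> Hom C R (prd C A A) \<and>
    snd (pseudo_setoid C (A, R, r)) \<in> principal_equivalences C A"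
proof (cases "A \<in> Obj C \<and> R \<in> Obj C \<and> r \<in> Hom C R (prd C A A)")
  case False
  then show ?thesis
    by (auto simp: pseudo_equivalence_def Let_def)
next
  case True
  then have A: "A \<in> Obj C" and R: "R \<in> Obj C" "r \<in> Hom C R (prd C A A)" by auto
  note AAo = product_cone[OF chosen_product[OF binary_products A A]]
  define r1 where "r1 = Cmp C R (prd C A A) A (pr1 C A A) r"
  define r2 where "r2 = Cmp C R (prd C A A) A (pr2 C A A) r"
  define E where "E = generated_relation C A R r1 r2"
  have rH: "r1 \<in> Hom C R A" "r2 \<in> Hom C R A"
    unfolding r1_def r2_def using R A AAo Cmp_closed by auto
  note mem = mem_generated_relation_pairing[OF A R, folded r1_def r2_def, folded E_def]
  have E: "E \<in> principal_relations C A"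
    unfolding E_def by (rule generated_relation_principal[OF R(1) rH])
  have gen: "(R, r1, r2) \<in> E"
    unfolding E_def by (rule relation_generator_mem[OF R(1) A rH])
  note pre = principal_relation_precompose[OF E A]
  have 1: "(\<exists>s\<in>Hom C A R. Cmp C A R (prd C A A) r s = diagonal C A) \<longleftrightarrow> (\<forall>U\<in>Obj C. \<forall>a\<in>Hom C U A. (U, a, a) \<in> E)"
    (is "?L \<longleftrightarrow> ?R")
  proof -
    have "?L \<longleftrightarrow> (A, Id C A, Id C A) \<in> E"
      unfolding mem[OF A Id_closed[OF A] Id_closed[OF A]] diagonal_def ..
    also have "\<dots> \<longleftrightarrow> ?R"
    proof
      assume i: "(A, Id C A, Id C A) \<in> E"
      show ?R
      proof (intro ballI)
        fix U a assume "U \<in> Obj C" "a \<in> Hom C U A"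
        then show "(U, a, a) \<in> E"
          using pre[OF i, of U a] Cmp_Id_left[OF _ A, of U a] by simp
      qed
    qed (use A Id_closed in blast)
    finally show ?thesis .
  qed
  have 2: "(\<exists>s\<in>Hom C R R. Cmp C R R (prd C A A) r s = pairing C R A A r2 r1) \<longleftrightarrow> (\<forall>U a a'. (U, a, a') \<in> E \<longrightarrow> (U, a', a) \<in> E)"
    (is "?L \<longleftrightarrow> ?R")
  proof -
    have "?L \<longleftrightarrow> (R, r2, r1) \<in> E"
      unfolding mem[OF R(1) rH(2,1)] ..
    also have "\<dots> \<longleftrightarrow> ?R"
    proof
      assume i: "(R, r2, r1) \<in> E"
      show ?R
      proof (intro allI impI)
        fix U a a' assume "(U, a, a') \<in> E"
        then obtain h where "U \<in> Obj C" "h \<in> Hom C U R" "Cmp C U R A r1 h = a" "Cmp C U R A r2 h = a'"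
          unfolding E_def mem_generated_relation by blast
        then show "(U, a', a) \<in> E"
          using pre[OF i, of U h] by simp
      qed
    qed (use gen in blast)
    finally show ?thesis .
  qed
  have 3: "(\<forall>W p q. is_weak_pullback C R R A r2 r1 W p q \<longrightarrow>
      (\<exists>t\<in>Hom C W R. Cmp C W R (prd C A A) r t = pairing C W A A (Cmp C W R A r1 p) (Cmp C W R A r2 q))) \<longleftrightarrow>
    (\<forall>U a a' a''. (U, a, a') \<in> E \<longrightarrow> (U, a', a'') \<in> E \<longrightarrow> (U, a, a'') \<in> E)" (is "?L \<longleftrightarrow> ?R")
  proof -
    have W: "(\<exists>t\<in>Hom C W R. Cmp C W R (prd C A A) r t = pairing C W A A (Cmp C W R A r1 p) (Cmp C W R A r2 q))
        \<longleftrightarrow> (W, Cmp C W R A r1 p, Cmp C W R A r2 q) \<in> E" if "is_weak_pullback C R R A r2 r1 W p q" for W p q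
    proof -
      have "W \<in> Obj C" "p \<in> Hom C W R" "q \<in> Hom C W R"
        using that unfolding is_weak_pullback_def by blast+
      then show ?thesis
        using mem[of W "Cmp C W R A r1 p" "Cmp C W R A r2 q"] Cmp_closed[OF _ R(1) A] rH by simp
    qed
    show ?thesis
    proof
      assume L: ?L
      show ?R
      proof (intro allI impI)
        fix U a a' a'' assume "(U, a, a') \<in> E" "(U, a', a'') \<in> E"
        then obtain h k where U: "U \<in> Obj C" and h: "h \<in> Hom C U R" "Cmp C U R A r1 h = a" "Cmp C U R A r2 h = a'"
          and k: "k \<in> Hom C U R" "Cmp C U R A r1 k = a'" "Cmp C U R A r2 k = a''"
          unfolding E_def mem_generated_relation by blast
        obtain W p q where Wp: "is_weak_pullback C R R A r2 r1 W p q"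
          using weak_pullbacks R(1) A rH unfolding has_weak_pullbacks_def by meson
        then have Wo: "W \<in> Obj C" "p \<in> Hom C W R" "q \<in> Hom C W R"
          and l: "\<exists>l. l \<in> Hom C U W \<and> Cmp C U W R p l = h \<and> Cmp C U W R q l = k"
          using U h k unfolding is_weak_pullback_def by auto
        obtain l where l: "l \<in> Hom C U W" "Cmp C U W R p l = h" "Cmp C U W R q l = k"
          using l by blast
        have "(W, Cmp C W R A r1 p, Cmp C W R A r2 q) \<in> E"
          using L W[OF Wp] Wp by blast
        from pre[OF this U l(1)] show "(U, a, a'') \<in> E"
          using U l Wo R(1) A rH h k by (simp add: Cmp_assoc)
      qed
    next
      assume R': ?R
      show ?L
      proof (intro allI impI)
        fix W p q assume Wp: "is_weak_pullback C R R A r2 r1 W p q"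
        then have Wo: "W \<in> Obj C" "p \<in> Hom C W R" "q \<in> Hom C W R" "Cmp C W R A r2 p = Cmp C W R A r1 q"
          unfolding is_weak_pullback_def by blast+
        have "(W, Cmp C W R A r1 p, Cmp C W R A r2 q) \<in> E"
          using R' pre[OF gen Wo(1,2)] pre[OF gen Wo(1,3)] Wo(4) by metis
        then show "\<exists>t\<in>Hom C W R. Cmp C W R (prd C A A) r t = pairing C W A A (Cmp C W R A r1 p) (Cmp C W R A r2 q)"
          unfolding W[OF Wp] .
      qed
    qed
  qed
  have s: "snd (pseudo_setoid C (A, R, r)) = E"
    unfolding pseudo_setoid_def E_def r1_def r2_def by simp
  show ?thesis
    unfolding s principal_equivalences_def mem_Collect_eq pseudo_equivalence_def Let_def case_prod_conv
      r1_def[symmetric] r2_def[symmetric] 1 2 3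
    using A R E by blast
qed

lemma pseudo_equivalence_category_relabels:
  "relabels (pseudo_equivalence_category C) (pseudo_setoid C) Setoids"
  unfolding relabels_def
proof (intro conjI ballI)
  let ?P = "pseudo_equivalence_category C"
  have obj: "x \<in> Obj ?P \<longleftrightarrow> fst x \<in> Obj C \<and> fst (snd x) \<in> Obj C \<and> snd (snd x) \<in> Hom C (fst (snd x)) (prd C (fst x) (fst x)) \<and>
      pseudo_setoid C x \<in> Obj Setoids" for x
    using pseudo_equivalence_iff[of "fst x" "fst (snd x)" "snd (snd x)"]
    by (auto simp: pseudo_equivalence_category_def pseudo_setoid_def case_prod_beta)
  have fst_x: "fst (pseudo_setoid C x) = fst x" for x
    by (simp add: pseudo_setoid_def case_prod_beta)
  show "pseudo_setoid C ` Obj ?P = Obj Setoids"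
  proof
    show "pseudo_setoid C ` Obj ?P \<subseteq> Obj Setoids"
      using obj by blast
    show "Obj Setoids \<subseteq> pseudo_setoid C ` Obj ?P"
    proof
      fix y assume y: "y \<in> Obj Setoids"
      interpret y: setoid C y using y by (rule setoidI)
      obtain R r1 r2 where R: "R \<in> Obj C" "r1 \<in> Hom C R (fst y)" "r2 \<in> Hom C R (fst y)"
        and E: "snd y = generated_relation C (fst y) R r1 r2"
        using y.principal by (rule principal_relationE)
      note k = pairing[OF binary_products y.carrier_obj y.carrier_obj R]
      let ?x = "(fst y, R, pairing C R (fst y) (fst y) r1 r2)"
      have "pseudo_setoid C ?x = y"
        using k E by (simp add: pseudo_setoid_def prod_eq_iff)
      moreover have "?x \<in> Obj ?P"
        unfolding obj calculation using y R k y.carrier_obj by simp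
      ultimately show "y \<in> pseudo_setoid C ` Obj ?P"
        by (metis image_eqI)
    qed
  qed
  show "Id ?P x = Id Setoids (pseudo_setoid C x)" for x
    by (simp add: pseudo_equivalence_category_def fst_x case_prod_beta)
  show "Cmp ?P x y z g f = Cmp Setoids (pseudo_setoid C x) (pseudo_setoid C y) (pseudo_setoid C z) g f" for x y z f g
    by (simp add: pseudo_equivalence_category_def fst_x case_prod_beta)
  fix x y assume x: "x \<in> Obj ?P" and y: "y \<in> Obj ?P"
  obtain A R r where xe: "x = (A, R, r)" by (rule prod_cases3)
  obtain B T s where ye: "y = (B, T, s)" by (rule prod_cases3)
  have A: "A \<in> Obj C" and R: "R \<in> Obj C" "r \<in> Hom C R (prd C A A)"
    and B: "B \<in> Obj C" and T: "T \<in> Obj C" "s \<in> Hom C T (prd C B B)"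
    using x y unfolding obj xe ye by simp_all
  note AAo = product_cone[OF chosen_product[OF binary_products A A]]
  define r1 where "r1 = Cmp C R (prd C A A) A (pr1 C A A) r"
  define r2 where "r2 = Cmp C R (prd C A A) A (pr2 C A A) r"
  define E where "E = generated_relation C A R r1 r2"
  define F where "F = generated_relation C B T (Cmp C T (prd C B B) B (pr1 C B B) s) (Cmp C T (prd C B B) B (pr2 C B B) s)"
  have sx: "pseudo_setoid C x = (A, E)" and sy: "pseudo_setoid C y = (B, F)"
    unfolding xe ye pseudo_setoid_def E_def F_def r1_def r2_def by simp_all
  interpret sy: setoid C "pseudo_setoid C y"
    by (rule setoidI) (use y obj in blast)
  have rH: "r1 \<in> Hom C R A" "r2 \<in> Hom C R A"
    unfolding r1_def r2_def using R A AAo Cmp_closed by auto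
  have gen: "(R, r1, r2) \<in> E"
    unfolding E_def by (rule relation_generator_mem[OF R(1) A rH])
  have "(\<exists>h\<in>Hom C R T. Cmp C R T (prd C B B) s h = Cmp C R (prd C A A) (prd C B B) (prd_map C A B f f) r) \<longleftrightarrow>
      (\<forall>U a a'. (U, a, a') \<in> E \<longrightarrow> (U, Cmp C U A B f a, Cmp C U A B f a') \<in> F)" (is "?L \<longleftrightarrow> ?R")
    if f: "f \<in> Hom C A B" for f
  proof -
    have fr: "Cmp C R A B f r1 \<in> Hom C R B" "Cmp C R A B f r2 \<in> Hom C R B"
      using f rH R(1) A B Cmp_closed by auto
    have fp: "Cmp C (prd C A A) A B f (pr1 C A A) \<in> Hom C (prd C A A) B" "Cmp C (prd C A A) A B f (pr2 C A A) \<in> Hom C (prd C A A) B"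
      using f AAo A B Cmp_closed by auto
    have "Cmp C R (prd C A A) (prd C B B) (prd_map C A B f f) r = pairing C R B B (Cmp C R A B f r1) (Cmp C R A B f r2)"
      unfolding prd_map_def pairing_Cmp[OF B B AAo(1) fp R]
      using f R A B AAo by (simp add: r1_def r2_def Cmp_assoc)
    then have "?L \<longleftrightarrow> (R, Cmp C R A B f r1, Cmp C R A B f r2) \<in> F"
      using mem_generated_relation_pairing[OF B T R(1) fr] by (simp add: F_def)
    also have "\<dots> \<longleftrightarrow> ?R"
    proof
      assume i: "(R, Cmp C R A B f r1, Cmp C R A B f r2) \<in> F"
      show ?R
      proof (intro allI impI)
        fix U a a' assume "(U, a, a') \<in> E"
        then obtain h where h: "U \<in> Obj C" "h \<in> Hom C U R" "Cmp C U R A r1 h = a" "Cmp C U R A r2 h = a'"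
          unfolding E_def mem_generated_relation by blast
        have "(U, Cmp C U R B (Cmp C R A B f r1) h, Cmp C U R B (Cmp C R A B f r2) h) \<in> F"
          using sy.precompose[of R "Cmp C R A B f r1" "Cmp C R A B f r2" U h] i h unfolding sy by simp
        then show "(U, Cmp C U A B f a, Cmp C U A B f a') \<in> F"
          using h f rH R(1) A B by (simp add: Cmp_assoc)
      qed
    qed (use gen in blast)
    finally show ?thesis .
  qed
  then show "Hom ?P x y = Hom Setoids (pseudo_setoid C x) (pseudo_setoid C y)"
    unfolding sx sy unfolding xe ye pseudo_equivalence_category_def setoid_category_def cat.select_convs
      case_prod_conv fst_conv snd_conv by (intro Collect_cong conj_cong refl)
qed

text \<open>
  That \<open>\<langle>f, g\<rangle>\<close> factors through \<open>s\<close> means that \<open>f\<close> and \<open>g\<close> are related in the setoid of \<open>s\<close>.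
\<close>

lemma exact_completion_relabels: "relabels (exact_completion C) (pseudo_setoid C) classes.Q"
  unfolding exact_completion_def Let_def
proof (rule relabels_quotient_category[OF setoid_congruence pseudo_equivalence_category_relabels])
  let ?P = "pseudo_equivalence_category C"
  fix x y assume x: "x \<in> Obj ?P" and y: "y \<in> Obj ?P"
  obtain A R r where xe: "x = (A, R, r)" by (rule prod_cases3)
  obtain B T s where ye: "y = (B, T, s)" by (rule prod_cases3)
  have A: "A \<in> Obj C" and B: "B \<in> Obj C" and T: "T \<in> Obj C" "s \<in> Hom C T (prd C B B)"
    using x y pseudo_equivalence_iff unfolding xe ye by (simp_all add: pseudo_equivalence_category_def)
  have hom: "Hom ?P x y = Hom Setoids (pseudo_setoid C x) (pseudo_setoid C y)"
    using pseudo_equivalence_category_relabels x y unfolding relabels_def by blast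
  have fst_x: "fst (pseudo_setoid C x) = A" and sy: "pseudo_setoid C y = (B, generated_relation C B T
      (Cmp C T (prd C B B) B (pr1 C B B) s) (Cmp C T (prd C B B) B (pr2 C B B) s))"
    unfolding xe ye pseudo_setoid_def by simp_all
  have "(\<exists>h\<in>Hom C A T. Cmp C A T (prd C B B) s h = pairing C A B B f g) \<longleftrightarrow> (A, f, g) \<in> snd (pseudo_setoid C y)"
    if "f \<in> Hom ?P x y" "g \<in> Hom ?P x y" for f g
  proof -
    have "f \<in> Hom C A B" "g \<in> Hom C A B"
      using that setoid_HomD(1)[of f C "pseudo_setoid C x" "pseudo_setoid C y"]
        setoid_HomD(1)[of g C "pseudo_setoid C x" "pseudo_setoid C y"]
      unfolding hom fst_x by (simp_all add: sy)
    then show ?thesis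
      using mem_generated_relation_pairing[OF B T A] by (simp add: sy)
  qed
  then show "{(f, g). f \<in> Hom ?P x y \<and> g \<in> Hom ?P x y \<and> (case x of (A, R, r) \<Rightarrow> case y of (B, T, s) \<Rightarrow>
          \<exists>h\<in>Hom C A T. Cmp C A T (prd C B B) s h = pairing C A B B f g)} =
      setoid_equal C (pseudo_setoid C x) (pseudo_setoid C y)"
    unfolding setoid_equal_def fst_x hom[symmetric] by (auto simp: xe ye)
qed

end

section \<open>The equivalence\<close>

theorem theorem6p1:
  fixes \<S> :: "('o, 'a) cat"
  assumes "cartesian_category \<S>" and "has_weak_pullbacks \<S>"
  shows "ED_equivalent
    (extensional_collapse (quotient_completion (weak_subobjects \<S>)))
    (subobjects (exact_completion \<S>))"
proof -
  interpret weakly_lex_category \<S>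
    using assms by (simp add: weakly_lex_category_def weakly_lex_category_axioms_def cartesian_category_def)
  have "doctrine_relabeling (quotient_completion (weak_subobjects \<S>)) (equivalence_setoid \<S>)
      (\<lambda>x. weak_subobject_sieve \<S> (fst x)) (setoid_doctrine \<S>)"
    using setoid_leibniz_doctrine quotient_completion_relabels
    by (simp add: doctrine_relabeling_def doctrine_relabeling_axioms_def)
  then show ?thesis
    by (rule relabelings_equivalent[OF class_leibniz_doctrine extensional_collapse_relabels
          subobjects_relabels[OF exact_completion_relabels]])
qed

end
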